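(* Let $n\ge1$ and let $\Gamma$, $\lambda$, $\Phi$, $E$ and $v_0$ be as in the context. The bijection $E:\Gamma\to\Gamma$ is minimal (every forward $E$-orbit is dense in $\Gamma$) and uniquely ergodic, with the Minkowski measure $\Phi^*\lambda$ as its unique invariant Borel probability measure. For every $p\in\Gamma$ the sequence $p,Ep,E^2p,\ldots$ is $\Phi^*\lambda$-uniformly distributed (i.e., $\frac1k\sum_{i<k}f(E^ip)\to\int f\,d\Phi^*\lambda$ for all continuous $f:\Gamma\to\mathbb{R}$). The orbit $v_0,Ev_0,E^2v_0,\ldots$ is an enumeration without repetitions of all points of $\Gamma$ having rational coordinates.
   Context: $\Gamma=\{(\alpha_1,\ldots,\alpha_n)\in\mathbb{R}^n:0\le\alpha_n\le\cdots\le\alpha_1\le1\}$, $\lambda$ Lebesgue measure with $\lambda(\Gamma)=1$; $\Gamma^o=\{\alpha\in\Gamma:\alpha_1<1\}$, $v_0=(0,\ldots,0)$. Points $\alpha\in\mathbb{R}^n$ are written in projective coordinates as column vectors $(\alpha_1,\ldots,\alpha_n,1)^{tr}$. Let $V$ be the $(n+1)\times(n+1)$ matrix whose entry $(i,j)$ is $1$ if $i=n+1$, or if $j\ge2$ and $i+j\le n+2$, and $0$ otherwise. Let $A_0$ be the $(n+1)\times(n+1)$ matrix with all entries $0$ except entries equal to $1$ in positions $(1,1)$, $(1,n+1)$, $(2,n+1)$ and $(j+1,j)$ for $2\le j\le n$; $A_1$ is the same except that the entry in position $(1,1)$ is replaced by an entry $1$ in position $(2,1)$. Let $B_a$ be $A_a$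 with the two entries $1$ in the last column replaced by $1/2$. Set $C_a=VA_aV^{-1}$, $D_a=VB_aV^{-1}$ ($a=0,1$). Define $\tau_a,\psi_a:\Gamma\to\Gamma$ by: $\tau_a(\alpha)=\beta$ iff $D_a(\alpha,1)^{tr}=(\beta,1)^{tr}$; $\psi_a(\alpha)=\beta$ iff $(\beta,1)^{tr}$ is a positive multiple of $C_a(\alpha,1)^{tr}$. For every $t\ge1$ and $a_0,\ldots,a_{t-1}\in\{0,1\}$, $\psi_{a_0}\cdots\psi_{a_{t-1}}\Gamma$ and $\tau_{a_0}\cdots\tau_{a_{t-1}}\Gamma$ are $n$-simplexes, and there is a unique orientation-preserving homeomorphism $\Phi:\Gamma\to\Gamma$ (the $n$-dimensional Minkowski question mark function) mapping $\psi_{a_0}\cdots\psi_{a_{t-1}}\Gamma$ homeomorphically onto $\tau_{a_0}\cdots\tau_{a_{t-1}}\Gamma$ for all such $t$ and $a_i$. The Minkowski measure is $(\Phi^*\lambda)(A)=\lambda(\Phi A)$ for Borel $A\subseteq\Gamma$. Let $v'_{-1}$ be the unique point of $\bigcap_{k\ge0}\psi_1^k\Gamma$. The sets $\{v'_{-1}\}$ and $\psi_1^k\psi_0\Gamma^o$ ($k\ge0$) partition $\Gamma$, and $E:\Gamma\to\Gamma$ is the bijection defined by $Ev'_{-1}=v_0$ and $E=\psi_0^k\psi_1\circ(\psi_1^k\psi_0)^{-1}$ on $\psi_1^k\psi_0\Gamma^o$. *)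

theory Defs
  imports "HOL-Probability.Probability" "HOL-Homology.Homology"
begin

text \<open>
  The dimension is \<open>n = CARD('n)\<close> for a finite well-ordered index type \<open>'n\<close>, whose increasing
  enumeration plays the role of the indices \<open>1, \<dots>, n\<close>. The \<open>n + 1\<close> projective coordinates are
  indexed by \<open>'n option\<close>, with \<^term>\<open>None\<close> in the last position; no order on the
  option type is used, only the numbering \<open>pos\<close> of its elements by \<open>1, \<dots>, n + 1\<close>.
\<close>

definition pos :: "'n::{finite,wellorder} option \<Rightarrow> nat" where
  "pos i = (case i of Some k \<Rightarrow> card {j. j \<le> k} | None \<Rightarrow> CARD('n) + 1)"

definition homog :: "real^'n::{finite,wellorder} \<Rightarrow> real^('n option)" where
  "homog \<alpha> = (\<chi> i. case i of Some k \<Rightarrow> \<alpha> $ k | None \<Rightarrow> 1)"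

definition Gam :: "(real^'n::{finite,wellorder}) set" where
  "Gam = {\<alpha>. (\<forall>i. 0 \<le> \<alpha> $ i \<and> \<alpha> $ i \<le> 1) \<and> (\<forall>i j. i \<le> j \<longrightarrow> \<alpha> $ j \<le> \<alpha> $ i)}"

definition Gam_o :: "(real^'n::{finite,wellorder}) set" where
  "Gam_o = {\<alpha> \<in> Gam. \<alpha> $ (Min UNIV) < 1}"


text \<open>The matrices; a Boolean argument \<open>a\<close> stands for the digit 1 if true and 0 if false.\<close>

definition mat_V :: "real^('n::{finite,wellorder} option)^('n option)" where
  "mat_V = (\<chi> i j. if pos i = CARD('n) + 1 \<or> (pos j \<ge> 2 \<and> pos i + pos j \<le> CARD('n) + 2)
                   then 1 else 0)"

definition mat_A :: "bool \<Rightarrow> real^('n::{finite,wellorder} option)^('n option)" where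
  "mat_A a = (\<chi> i j. if (pos i, pos j) \<in>
        {(if a then 2 else 1, 1), (1, CARD('n) + 1), (2, CARD('n) + 1)}
        \<union> {(k + 1, k) | k. 2 \<le> k \<and> k \<le> CARD('n)}
      then 1 else 0)"

definition mat_B :: "bool \<Rightarrow> real^('n::{finite,wellorder} option)^('n option)" where
  "mat_B a = (\<chi> i j. if (pos i, pos j) \<in> {(1, CARD('n) + 1), (2, CARD('n) + 1)}
                     then 1 / 2 else mat_A a $ i $ j)"

definition mat_C :: "bool \<Rightarrow> real^('n::{finite,wellorder} option)^('n option)" where
  "mat_C a = mat_V ** mat_A a ** matrix_inv mat_V"

definition mat_D :: "bool \<Rightarrow> real^('n::{finite,wellorder} option)^('n option)" where
  "mat_D a = mat_V ** mat_B a ** matrix_inv mat_V"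

definition tau :: "bool \<Rightarrow> real^'n::{finite,wellorder} \<Rightarrow> real^'n::_" where
  "tau a \<alpha> = (THE \<beta>. mat_D a *v homog \<alpha> = homog \<beta>)"

definition psi :: "bool \<Rightarrow> real^'n::{finite,wellorder} \<Rightarrow> real^'n::_" where
  "psi a \<alpha> = (THE \<beta>. \<exists>c>0. homog \<beta> = c *\<^sub>R (mat_C a *v homog \<alpha>))"

text \<open>\<open>word_comp f [a\<^sub>0, \<dots>, a\<^sub>m] = f a\<^sub>0 \<circ> \<dots> \<circ> f a\<^sub>m\<close>\<close>

definition word_comp :: "(bool \<Rightarrow> 'a \<Rightarrow> 'a) \<Rightarrow> bool list \<Rightarrow> 'a \<Rightarrow> 'a" where
  "word_comp f as = foldr (\<lambda>a g. f a \<circ> g) as id"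


text \<open>
  A self-homeomorphism of the \<open>n\<close>-cell \<open>S\<close> is orientation preserving if it fixes the
  fundamental class, i.e. acts as the identity on the infinite cyclic group \<open>H\<^sub>n(S, \<partial>S)\<close>.
\<close>

definition orientation_preserving_on ::
    "(real^'n::{finite,wellorder}) set \<Rightarrow> (real^'n::_ \<Rightarrow> real^'n::_) \<Rightarrow> bool" where
  "orientation_preserving_on S f \<longleftrightarrow>
     (\<forall>c \<in> carrier (relative_homology_group (int CARD('n)) (top_of_set S) (frontier S)).
        hom_induced (int CARD('n)) (top_of_set S) (frontier S) (top_of_set S) (frontier S) f c = c)"

text \<open>
  The \<open>n\<close>-dimensional Minkowski question mark function, as a function on \<open>Gam\<close>; the values
  of \<open>\<Phi>\<close> outside \<open>Gam\<close> are irrelevant.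
\<close>

definition is_minkowski_function :: "(real^'n::{finite,wellorder} \<Rightarrow> real^'n::_) \<Rightarrow> bool" where
  "is_minkowski_function \<Phi> \<longleftrightarrow>
     (\<exists>\<Phi>'. homeomorphism Gam Gam \<Phi> \<Phi>') \<and>
     orientation_preserving_on Gam \<Phi> \<and>
     (\<forall>as. as \<noteq> [] \<longrightarrow>
        (\<exists>g. homeomorphism (word_comp psi as ` Gam) (word_comp tau as ` Gam) \<Phi> g))"

definition lam :: "(real^'n::{finite,wellorder}) measure" where
  "lam = uniform_measure lborel Gam"

definition borel_on :: "'a::topological_space set \<Rightarrow> 'a measure" where
  "borel_on X = restrict_space borel X"

definition minkowski_measure ::
    "(real^'n::{finite,wellorder} \<Rightarrow> real^'n::_) \<Rightarrow> (real^'n::_) measure" where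
  "minkowski_measure \<Phi> = measure_of Gam (sets (borel_on Gam)) (\<lambda>A. emeasure lam (\<Phi> ` A))"


definition v'_minus1 :: "real^'n::{finite,wellorder}" where
  "v'_minus1 = (THE p. (\<Inter>k. (psi True ^^ k) ` Gam) = {p})"

definition E_map :: "real^'n::{finite,wellorder} \<Rightarrow> real^'n::_" where
  "E_map p =
     (if p = v'_minus1 then 0
      else let k = (THE k. p \<in> (psi True ^^ k \<circ> psi False) ` Gam_o)
           in (psi False ^^ k \<circ> psi True) (the_inv_into Gam_o (psi True ^^ k \<circ> psi False) p))"


definition minimal_on :: "'a::topological_space set \<Rightarrow> ('a \<Rightarrow> 'a) \<Rightarrow> bool" where
  "minimal_on X T \<longleftrightarrow> (\<forall>p\<in>X. top_of_set X closure_of (range (\<lambda>k. (T ^^ k) p)) = X)"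

definition invariant_borel_prob :: "'a::topological_space set \<Rightarrow> ('a \<Rightarrow> 'a) \<Rightarrow> 'a measure \<Rightarrow> bool" where
  "invariant_borel_prob X T \<mu> \<longleftrightarrow>
     sets \<mu> = sets (borel_on X) \<and> prob_space \<mu> \<and> T \<in> measurable \<mu> \<mu> \<and> distr \<mu> \<mu> T = \<mu>"

definition uniquely_ergodic_with :: "'a::topological_space set \<Rightarrow> ('a \<Rightarrow> 'a) \<Rightarrow> 'a measure \<Rightarrow> bool" where
  "uniquely_ergodic_with X T \<mu> \<longleftrightarrow> (\<forall>\<nu>. invariant_borel_prob X T \<nu> \<longleftrightarrow> \<nu> = \<mu>)"

definition uniformly_distributed_on ::
    "'a::topological_space set \<Rightarrow> 'a measure \<Rightarrow> (nat \<Rightarrow> 'a) \<Rightarrow> bool" where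
  "uniformly_distributed_on X \<mu> x \<longleftrightarrow>
     (\<forall>f::'a \<Rightarrow> real. continuous_on X f \<longrightarrow>
        (\<lambda>k. (\<Sum>i<k. f (x i)) / real k) \<longlonglongrightarrow> integral\<^sup>L \<mu> f)"

end

theory Submission
  imports Defs
begin

text \<open>
  Write \<open>\<psi>\<^sub>u\<close> for the composition of the maps \<open>\<psi>\<^sub>0, \<psi>\<^sub>1\<close> along a word \<open>u\<close>. The two maps agree
  exactly off \<open>\<Gamma>\<^sup>o\<close>, and \<open>E\<close> acts on codes as an odometer: \<open>E \<psi>\<^sub>0 x = \<psi>\<^sub>1 x\<close> for \<open>x \<in> \<Gamma>\<^sup>o\<close> and
  \<open>E \<psi>\<^sub>1 x = \<psi>\<^sub>0 E x\<close> for all \<open>x\<close>. Hence the orbit of \<open>\<psi>\<^sub>0\<^sup>T x\<close> is a concatenation of blocks, the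
  \<open>i\<close>-th block listing without repetition the points \<open>\<psi>\<^sub>u E\<^sup>i x\<close> with \<open>u\<close> of length \<open>T\<close>. Since cells
  shrink and the boundary is null, such a block is almost uniformly distributed for large \<open>T\<close>,
  uniformly in \<open>x\<close>, provided that coincidences are rare: each block has at least \<open>k 2\<^sup>T\<close> points
  because some cell lies in the interior, where no identifications occur, while only \<open>o(2\<^sup>T)\<close> of
  its points lie on the boundary. As \<open>E\<close> is not continuous, unique ergodicity is deduced from
  uniform distribution of every orbit by dominated convergence. The cells of \<open>\<psi>\<close> shrink since
  those of \<open>\<tau>\<close> do and \<open>\<Phi>\<^sup>-\<^sup>1\<close> is uniformly continuous; moreover \<open>\<Phi>\<close> conjugates \<open>\<psi>\<^sub>a\<close> to \<open>\<tau>\<^sub>a\<close>,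
  which halves volumes.
\<close>

section \<open>Towers and odometers over a coded space\<close>

text \<open>E is the dyadic adding machine, the first letter of a code being its lowest digit, but
  read through a coding that is not injective: within a block a point with several codes is visited
  once, not once per code. Two operators keep this apart. \<open>Q\<close> sums over words,
  preserves continuity and is tied to the measure by self-similarity. \<open>L\<close> sums over the
  points that the orbit really visits, but destroys continuity. The analysis is done for
  \<open>Q\<close> and carried over to \<open>L\<close> by fixing the number t of outer letters
  first and taking the number T of inner letters large afterwards, so that gluing among the outer
  letters happens only at rare inner points.

  The maps \<open>psi\<close> are not uniform contractions: for n = 1, \<open>psi False\<close> is
  \<alpha>/(1 + \<alpha>), with slope 1 at its fixed point 0. For \<open>tau\<close> the difficulty
  is that one step halves a single edge, which gives no fixed factor for the diameter; a definite
  gain appears only over n + 1 rounds of n steps.\<close>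

lemma word_comp_Nil [simp]: "word_comp f [] = id"
  and word_comp_Cons [simp]: "word_comp f (a # u) = f a \<circ> word_comp f u"
  by (simp_all add: word_comp_def)

lemma word_comp_replicate: "word_comp f (replicate k a) = f a ^^ k"
  by (induction k) auto

lemma funpow_image_subset: "f ` X \<subseteq> X \<Longrightarrow> (f ^^ k) ` X \<subseteq> X"
  by (induction k) auto

lemma continuous_on_funpow:
  assumes "continuous_on X f" "f ` X \<subseteq> X"
  shows "continuous_on X (f ^^ k)"
proof (induction k)
  case (Suc k)
  then show ?case using assms funpow_image_subset[OF assms(2), of k]
    by (auto intro!: continuous_on_compose intro: continuous_on_subset simp del: o_apply)
qed auto

lemma inj_on_funpow:
  assumes "inj_on f X" "f ` X \<subseteq> X"
  shows "inj_on (f ^^ k) X"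
proof (induction k)
  case (Suc k)
  then show ?case using assms funpow_image_subset[OF assms(2), of k]
    by (metis comp_inj_on funpow.simps(2) inj_on_subset)
qed auto

text \<open>Peeling off the image of Y: a point other than v leaves the decreasing images of X under
  the powers of f at some level, and pulled back from the last level containing it, it lies in the
  image of g. The result is used with the two branches in either order, once for the partition of
  the domain of E and once for that of its range.\<close>

lemma
  assumes inj: "inj_on f X" and sub: "f ` X \<subseteq> X" and gsub: "g ` Y \<subseteq> X"
    and cover: "X \<subseteq> f ` X \<union> g ` Y" and disj: "f ` X \<inter> g ` Y = {}"
    and int: "(\<Inter>k. (f ^^ k) ` X) = {v}"
  shows tower_cases: "p \<in> X \<Longrightarrow> p = v \<or> (\<exists>k. \<exists>x\<in>Y. p = (f ^^ k) (g x))"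
    and tower_neq: "x \<in> Y \<Longrightarrow> (f ^^ k) (g x) \<noteq> v"
    and tower_unique: "x \<in> Y \<Longrightarrow> y \<in> Y \<Longrightarrow> (f ^^ k) (g x) = (f ^^ l) (g y) \<Longrightarrow> k = l \<and> g x = g y"
proof -
  have pow: "(f ^^ k) ` X \<subseteq> X" for k by (rule funpow_image_subset[OF sub])
  have injp: "inj_on (f ^^ k) X" for k by (rule inj_on_funpow[OF inj sub])
  have notin: "(f ^^ k) (g x) \<notin> (f ^^ (k + Suc m)) ` X" if "x \<in> Y" for x k m
  proof
    assume "(f ^^ k) (g x) \<in> (f ^^ (k + Suc m)) ` X"
    then obtain y where y: "y \<in> X" "(f ^^ k) (g x) = (f ^^ k) ((f ^^ Suc m) y)"
      by (auto simp only: funpow_add o_apply image_iff)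
    moreover have "g x \<in> X" "(f ^^ Suc m) y \<in> X" using that gsub pow[of "Suc m"] y(1) by blast+
    ultimately have "g x = (f ^^ Suc m) y" using injp[of k] by (auto dest: inj_onD)
    then have "g x \<in> f ` X" using pow[of m] y(1) by auto
    then show False using disj that by auto
  qed
  show "(f ^^ k) (g x) \<noteq> v" if "x \<in> Y" for x k
    using notin[OF that, of k 0] int by (metis INT_iff UNIV_I singletonI)
  show "p = v \<or> (\<exists>k. \<exists>x\<in>Y. p = (f ^^ k) (g x))" if p: "p \<in> X" for p
  proof (cases "p = v")
    case False
    then have "\<exists>k. p \<notin> (f ^^ k) ` X" using int by blast
    then have *: "p \<notin> (f ^^ (LEAST k. p \<notin> (f ^^ k) ` X)) ` X" by (rule LeastI_ex)
    define k where "k = (LEAST k. p \<notin> (f ^^ k) ` X)"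
    have "k \<noteq> 0" using * p by (auto simp flip: k_def intro!: Nat.gr0I)
    then obtain l where l: "k = Suc l" by (cases k) auto
    then have "p \<in> (f ^^ l) ` X" using not_less_Least[of l "\<lambda>k. p \<notin> (f ^^ k) ` X"]
        by (auto simp: k_def)
    then obtain q where q: "q \<in> X" "p = (f ^^ l) q" by auto
    have "p \<notin> (f ^^ Suc l) ` X" using *[folded k_def] l by blast
    then have "q \<notin> f ` X" using q by (auto simp: funpow_swap1 image_iff)
    then show ?thesis using cover q by blast
  qed simp
  have lt: "\<not> k < l" if x: "x \<in> Y" and y: "y \<in> Y"
      and eq: "(f ^^ k) (g x) = (f ^^ l) (g y)" for x y k l
  proof
    assume "k < l"
    then obtain m where m: "l = k + Suc m" using less_imp_Suc_add by auto
    have "g y \<in> X" using y gsub by auto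
    then have "(f ^^ k) (g x) \<in> (f ^^ l) ` X" using eq by auto
    then show False using notin[OF x, of k m] m by auto
  qed
  show "k = l \<and> g x = g y" if x: "x \<in> Y" and y: "y \<in> Y"
      and eq: "(f ^^ k) (g x) = (f ^^ l) (g y)" for x y k l
  proof -
    have "g x \<in> X" "g y \<in> X" using x y gsub by auto
    moreover have "k = l" using lt[OF x y eq] lt[OF y x eq[symmetric]] by simp
    ultimately show ?thesis using injp[of k] eq by (auto dest: inj_onD)
  qed
qed

section \<open>Spaces coded by two injective branches\<close>

text \<open>By \<open>s_glue\<close>, images of different branches meet only for equal arguments
  outside \<open>Xo\<close>. The points v and z carry the constant codes. By \<open>deep\<close>
  there is a cell that avoids \<open>X - Xo\<close> whatever letters are put in front of its word;
  this keeps blocks from losing too many points.\<close>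

locale coded_ifs =
  fixes X Xo :: "'a::euclidean_space set" and s :: "bool \<Rightarrow> 'a \<Rightarrow> 'a" and v z :: 'a
  assumes compact_X: "compact X" and Xo_sub: "Xo \<subseteq> X" and closed_bd: "closed (X - Xo)"
    and s_in: "x \<in> X \<Longrightarrow> s a x \<in> X"
    and s_cont: "continuous_on X (s a)"
    and s_inj: "inj_on (s a) X"
    and s_cover: "X \<subseteq> s False ` X \<union> s True ` X"
    and s_glue: "x \<in> X \<Longrightarrow> y \<in> X \<Longrightarrow> s False x = s True y \<longleftrightarrow> x = y \<and> x \<notin> Xo"
    and Int_True: "(\<Inter>k. (s True ^^ k) ` X) = {v}"
    and Int_False: "(\<Inter>k. (s False ^^ k) ` X) = {z}"
    and shrink: "e > 0 \<Longrightarrow> \<exists>t. \<forall>u x y. t \<le> length u \<longrightarrow> x \<in> X \<longrightarrow> y \<in> X \<longrightarrow>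
           dist (word_comp s u x) (word_comp s u y) < e"
    and deep: "\<exists>w. \<forall>u. \<forall>x\<in>X. word_comp s u (word_comp s w x) \<in> Xo"
begin

lemma s_image: "s a ` X \<subseteq> X" using s_in by auto

lemma pow_in: "x \<in> X \<Longrightarrow> (s a ^^ k) x \<in> X"
  using funpow_image_subset[OF s_image] by blast

lemma word_in: "x \<in> X \<Longrightarrow> word_comp s u x \<in> X"
  by (induction u) (auto simp: s_in)

text \<open>Outside \<open>Xo\<close> the branches agree, so one of them may be cut down to
  \<open>Xo\<close> without losing points; this turns the cover into a partition.\<close>

lemma
  shows True_cover: "X \<subseteq> s True ` X \<union> s False ` Xo" and True_disj: "s True ` X \<inter> s False ` Xo = {}"
    and False_cover: "X \<subseteq> s False ` X \<union> s True ` Xo"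
        and False_disj: "s False ` X \<inter> s True ` Xo = {}"
proof -
  have *: "s False x = s True x" if "x \<in> X" "x \<notin> Xo" for x using that s_glue by auto
  show "X \<subseteq> s True ` X \<union> s False ` Xo" "X \<subseteq> s False ` X \<union> s True ` Xo"
    using s_cover * by (auto simp: image_iff subset_iff) metis+
  show "s True ` X \<inter> s False ` Xo = {}" "s False ` X \<inter> s True ` Xo = {}"
    using s_glue Xo_sub by fastforce+
qed

lemma sXo: "s a ` Xo \<subseteq> X" using Xo_sub s_in by auto

lemmas v_cases = tower_cases[OF s_inj s_image sXo True_cover True_disj Int_True]

lemma tower_in: "x \<in> Xo \<Longrightarrow> (s a ^^ k) (s b x) \<in> X"
  using Xo_sub by (auto intro!: pow_in s_in)

lemma v_in: "v \<in> X" and z_in: "z \<in> X"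
proof -
  have "v \<in> (s True ^^ 0) ` X" "z \<in> (s False ^^ 0) ` X" using Int_True Int_False by blast+
  then show "v \<in> X" "z \<in> X" by auto
qed

lemma s_False_z: "s False z = z"
proof -
  have "s False z \<in> (s False ^^ k) ` X" for k
  proof (cases k)
    case (Suc l)
    have "z \<in> (s False ^^ l) ` X" using Int_False by auto
    then show ?thesis using Suc by auto
  qed (auto simp: s_in z_in)
  then show ?thesis using Int_False by auto
qed

lemma s_True_v: "s True v = v"
proof -
  have "s True v \<in> (s True ^^ k) ` X" for k
  proof (cases k)
    case (Suc l)
    have "v \<in> (s True ^^ l) ` X" using Int_True by auto
    then show ?thesis using Suc by auto
  qed (auto simp: s_in v_in)
  then show ?thesis using Int_True by auto
qed

end

section \<open>The adding machine on a coded space\<close>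

locale odometer_ifs = coded_ifs X Xo s v z
  for X Xo :: "'a::euclidean_space set" and s v z +
  fixes E :: "'a \<Rightarrow> 'a"
  assumes E_v: "E v = z"
    and E_tower: "x \<in> Xo \<Longrightarrow> E ((s True ^^ k) (s False x)) = (s False ^^ k) (s True x)"
begin

lemma E_in: "x \<in> X \<Longrightarrow> E x \<in> X"
  using v_cases[of x] by (auto simp: E_v z_in E_tower tower_in)

lemma E_s_False: "x \<in> Xo \<Longrightarrow> E (s False x) = s True x"
  using E_tower[of x 0] by simp

text \<open>The carry rule. On the tower it merely raises the level by one; at v it holds because v
  and z are fixed by their branches.\<close>

lemma E_s_True: "x \<in> X \<Longrightarrow> E (s True x) = s False (E x)"
proof -
  assume "x \<in> X"
  then consider "x = v" | k y where "y \<in> Xo" "x = (s True ^^ k) (s False y)"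
    using v_cases[of x] by blast
  then show ?thesis
  proof cases
    case 1
    then show ?thesis by (simp add: s_True_v E_v s_False_z)
  next
    case 2
    then show ?thesis using E_tower[of y "Suc k"] E_tower[of y k] by simp
  qed
qed

text \<open>E carries level k of the tower built on \<open>s True\<close> to level k of the tower
  built on \<open>s False\<close>, and v to z; both towers partition X.\<close>

lemma E_bij: "bij_betw E X X"
proof (rule bij_betw_imageI)
  note T = tower_unique[OF s_inj s_image sXo True_cover True_disj Int_True]
  note F = tower_unique[OF s_inj s_image sXo False_cover False_disj Int_False]
  note nz = tower_neq[OF s_inj s_image sXo False_cover False_disj Int_False]
  have injX: "s a x = s a y \<longleftrightarrow> x = y" if "x \<in> Xo" "y \<in> Xo" for a x y
    using that Xo_sub s_inj by (auto dest: inj_onD)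
  show "inj_on E X"
  proof (rule inj_onI)
    fix x y assume "x \<in> X" "y \<in> X" and eq: "E x = E y"
    then consider "x = v" "y = v"
      | k x' where "x = v" "x' \<in> Xo" "y = (s True ^^ k) (s False x')"
      | k x' where "y = v" "x' \<in> Xo" "x = (s True ^^ k) (s False x')"
      | k x' l y' where "x' \<in> Xo" "x = (s True ^^ k) (s False x')" "y' \<in> Xo" "y
          = (s True ^^ l) (s False y')"
      using v_cases[of x] v_cases[of y] by blast
    then show "x = y"
    proof cases
      case (4 k x' l y')
      then show ?thesis using F[of x' y' k l] eq injX[of x' y'] by (simp add: E_tower)
    qed (use eq nz in \<open>auto simp: E_v E_tower dest: sym\<close>)
  qed
  show "E ` X = X"
  proof
    show "X \<subseteq> E ` X"
    proof
      fix p assume "p \<in> X"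
      then consider "p = z" | k y where "y \<in> Xo" "p = (s False ^^ k) (s True y)"
        using tower_cases[OF s_inj s_image sXo False_cover False_disj Int_False, of p] by blast
      then show "p \<in> E ` X"
      proof cases
        case 1
        then show ?thesis using E_v v_in by auto
      next
        case 2
        then show ?thesis using E_tower[of y k] tower_in[of y k True False] by (metis image_eqI)
      qed
    qed
  qed (use E_in in auto)
qed

lemma funE_in: "x \<in> X \<Longrightarrow> (E ^^ k) x \<in> X"
  by (induction k) (auto simp: E_in)

text \<open>The orbit of \<open>s False x\<close> imitates that of x: from \<open>s False y\<close>
  it reaches \<open>s True y\<close>, in one step or, for y outside \<open>Xo\<close>, in none, and
  the carry rule then leads to \<open>s False (E y)\<close>.\<close>

lemma orbit_s:
  assumes "x \<in> X"
  shows "\<exists>j. (E ^^ j) (s False x) = s a ((E ^^ i) x)"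
proof -
  have *: "\<exists>j. (E ^^ j) (s False y) = s True y" if "y \<in> X" for y
  proof (cases "y \<in> Xo")
    case True
    then show ?thesis using E_s_False by (intro exI[of _ 1]) simp
  next
    case False
    then show ?thesis using s_glue that by (intro exI[of _ 0]) auto
  qed
  have **: "\<exists>j. (E ^^ j) (s False y) = s False (E y)" if y: "y \<in> X" for y
  proof -
    obtain j where "(E ^^ j) (s False y) = s True y" using *[OF y] by blast
    then show ?thesis using E_s_True[OF y] by (intro exI[of _ "Suc j"]) simp
  qed
  have F: "\<exists>j. (E ^^ j) (s False x) = s False ((E ^^ i) x)" for i
  proof (induction i)
    case (Suc i)
    then obtain j where j: "(E ^^ j) (s False x) = s False ((E ^^ i) x)" by blast
    obtain l where l: "(E ^^ l) (s False ((E ^^ i) x)) = s False (E ((E ^^ i) x))"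
      using **[OF funE_in[OF assms]] by blast
    show ?case using j l by (intro exI[of _ "l + j"]) (simp add: funpow_add)
  qed (auto intro: exI[of _ 0])
  show ?thesis
  proof (cases a)
    case True
    obtain j where j: "(E ^^ j) (s False x) = s False ((E ^^ i) x)" using F by blast
    obtain l where l: "(E ^^ l) (s False ((E ^^ i) x)) = s True ((E ^^ i) x)"
      using *[OF funE_in[OF assms]] by blast
    show ?thesis using j l True by (intro exI[of _ "l + j"]) (simp add: funpow_add)
  qed (use F in auto)
qed

lemma orbit_enters: "p \<in> X \<Longrightarrow> \<exists>m. \<exists>x\<in>X. (E ^^ m) p = s False x"
proof -
  assume "p \<in> X"
  then consider x where "x \<in> X" "p = s False x" | x where "x \<in> X" "p = s True x"
      using s_cover by blast
  then show ?thesis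
  proof cases
    case 1
    then show ?thesis by (intro exI[of _ 0]) auto
  next
    case 2
    then show ?thesis using E_s_True E_in by (intro exI[of _ 1]) auto
  qed
qed

lemma orbit_enters_pow: "p \<in> X \<Longrightarrow> \<exists>m. \<exists>x\<in>X. (E ^^ m) p = (s False ^^ T) x"
proof (induction T arbitrary: p)
  case 0
  then show ?case by (intro exI[of _ 0]) auto
next
  case (Suc T)
  obtain m x where x: "x \<in> X" "(E ^^ m) p = s False x" using orbit_enters[OF Suc.prems] by blast
  obtain l y where y: "y \<in> X" "(E ^^ l) x = (s False ^^ T) y" using Suc.IH[OF x(1)] by blast
  obtain j where "(E ^^ j) (s False x) = s False ((E ^^ l) x)" using orbit_s[OF x(1)] by blast
  then show ?case using x y by (intro exI[of _ "j + m"] bexI[of _ y]) (simp_all add: funpow_add)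
qed

text \<open>The orbit enters the image of \<open>s False\<close> at some point x; from there it
  imitates the orbit of x, which by induction meets the cell of the remaining letters.\<close>

lemma orbit_cell: "p \<in> X \<Longrightarrow> \<exists>m. (E ^^ m) p \<in> word_comp s u ` X"
proof (induction u arbitrary: p)
  case Nil
  then show ?case by (intro exI[of _ 0]) auto
next
  case (Cons a u)
  obtain m x where x: "x \<in> X" "(E ^^ m) p = s False x" using orbit_enters[OF Cons.prems] by blast
  obtain l y where y: "y \<in> X" "(E ^^ l) x = word_comp s u y" using Cons.IH[OF x(1)] by blast
  obtain j where "(E ^^ j) (s False x) = s a ((E ^^ l) x)" using orbit_s[OF x(1)] by blast
  then show ?case using x y by (intro exI[of _ "j + m"]) (simp add: funpow_add)
qed

lemma word_ex: "p \<in> X \<Longrightarrow> \<exists>u. length u = t \<and> p \<in> word_comp s u ` X"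
proof (induction t arbitrary: p)
  case (Suc t)
  then obtain a x where x: "x \<in> X" "p = s a x" using s_cover by blast
  then obtain u where "length u = t" "x \<in> word_comp s u ` X" using Suc.IH by blast
  then show ?case using x by (intro exI[of _ "a # u"]) auto
qed auto

lemma minimal: "minimal_on X E"
  unfolding minimal_on_def
proof
  fix p assume p: "p \<in> X"
  have "q \<in> closure (X \<inter> range (\<lambda>k. (E ^^ k) p))" if q: "q \<in> X" for q
    unfolding closure_approachable
  proof (intro allI impI)
    fix e :: real assume "e > 0"
    then obtain t where t: "\<And>u x y. t \<le> length u \<Longrightarrow> x \<in> X \<Longrightarrow> y \<in> X \<Longrightarrow>
           dist (word_comp s u x) (word_comp s u y) < e" using shrink by metis
    obtain u y where u: "length u = t" "y \<in> X" "q = word_comp s u y" using word_ex[OF q] by blast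
    obtain m x where "x \<in> X" "(E ^^ m) p = word_comp s u x" using orbit_cell[OF p] by blast
    then show "\<exists>y\<in>X \<inter> range (\<lambda>k. (E ^^ k) p). dist y q < e"
      using t[of u x y] u funE_in[OF p, of m]
          by (intro bexI[of _ "(E ^^ m) p"]) (auto intro: range_eqI[of _ _ m])
  qed
  then show "top_of_set X closure_of range (\<lambda>k. (E ^^ k) p) = X"
    by (auto simp: closure_of_subtopology)
qed

lemma E_word: "z \<in> Xo \<Longrightarrow> E (word_comp s u z) \<in> range (\<lambda>w. word_comp s w z)"
proof (induction u)
  case Nil
  then have "E (word_comp s [] z) = word_comp s [True] z" using E_s_False[of z] s_False_z by simp
  then show ?case by (metis rangeI)
next
  case (Cons a u)
  let ?y = "word_comp s u z"
  have y: "?y \<in> X" using z_in by (rule word_in)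
  obtain w where w: "E ?y = word_comp s w z" using Cons by auto
  show ?case
  proof (cases "\<not> a \<and> ?y \<in> Xo")
    case True
    then have "E (word_comp s (a # u) z) = word_comp s (True # u) z" by (simp add: E_s_False)
    then show ?thesis by (metis rangeI)
  next
    case False
    \<comment> \<open>Either the letter is True or the branches agree at ?y; both ways the carry
      rule applies.\<close>
    then have "s a ?y = s True ?y" using s_glue[OF y y] by (cases a) auto
    then have "E (word_comp s (a # u) z) = word_comp s (False # w) z" by (simp add: E_s_True y w)
    then show ?thesis by (metis rangeI)
  qed
qed

lemma orbit_z:
  assumes "z \<in> Xo"
  shows "range (\<lambda>k. (E ^^ k) z) = range (\<lambda>w. word_comp s w z)"
proof
  have "(E ^^ k) z \<in> range (\<lambda>w. word_comp s w z)" for k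
  proof (induction k)
    case 0
    show ?case by (auto intro: range_eqI[of _ _ "[]"])
  next
    case (Suc k)
    then show ?case using E_word[OF assms] by auto
  qed
  then show "range (\<lambda>k. (E ^^ k) z) \<subseteq> range (\<lambda>w. word_comp s w z)" by auto
  have "\<exists>k. (E ^^ k) z = word_comp s w z" for w
  proof (induction w)
    case Nil
    show ?case by (intro exI[of _ 0]) simp
  next
    case (Cons a w)
    then obtain i where "(E ^^ i) z = word_comp s w z" by blast
    \<comment> \<open>Since z = \<open>s False z\<close>, the orbit that \<open>orbit_s\<close>
      describes is the orbit of z itself.\<close>
    then show ?case using orbit_s[OF z_in, of a i] by (auto simp: s_False_z)
  qed
  then show "range (\<lambda>w. word_comp s w z) \<subseteq> range (\<lambda>k. (E ^^ k) z)" by (metis image_subsetI rangeI)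
qed

text \<open>A repetition makes p periodic because E is injective; the orbit is then finite, hence
  closed, and being dense it would exhaust the infinite set X.\<close>

lemma orbit_inj:
  assumes "infinite X" and p: "p \<in> X"
  shows "inj (\<lambda>k. (E ^^ k) p)"
proof (rule ccontr)
  assume "\<not> inj (\<lambda>k. (E ^^ k) p)"
  then obtain i j where ij: "i < j" "(E ^^ i) p = (E ^^ j) p"
    unfolding inj_def by (metis linorder_neqE_nat)
  then obtain d where "j = i + Suc d" using less_imp_Suc_add by auto
  then have eq: "(E ^^ (i + Suc d)) p = (E ^^ i) p" using ij by simp
  have "inj_on (E ^^ i) X" using E_bij by (intro inj_on_funpow) (auto simp: bij_betw_def)
  moreover have "(E ^^ i) ((E ^^ Suc d) p) = (E ^^ i) p" using eq by (simp only: funpow_add o_apply)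
  ultimately have per: "(E ^^ Suc d) p = p" using funE_in[OF p] p by (metis inj_onD)
  have "(E ^^ k) p = (E ^^ (k mod Suc d)) p" for k
    by (rule funpow_mod_eq[OF per, symmetric])
  then have "range (\<lambda>k. (E ^^ k) p) \<subseteq> (\<lambda>k. (E ^^ k) p) ` {..<Suc d}"
    by (auto simp del: funpow.simps intro!: image_eqI[of _ _ "_ mod Suc d"])
  then have fin: "finite (range (\<lambda>k. (E ^^ k) p))" using finite_subset by blast
  let ?R = "range (\<lambda>k. (E ^^ k) p)"
  have "X \<inter> closure (X \<inter> ?R) = X"
    using minimal p by (simp add: minimal_on_def closure_of_subtopology)
  then have "X \<subseteq> closure ?R" using closure_mono[of "X \<inter> ?R" ?R] by blast
  then have "finite X" using fin by (simp add: finite_imp_closed closure_closed finite_subset)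
  then show False using assms(1) by blast
qed

section \<open>Sums over orbit blocks\<close>

text \<open>
  \<open>L f x\<close> sums \<open>f\<close> over the set \<open>{s False x, s True x}\<close>, counting a double point once; \<open>Q\<close> counts it
  twice. Thus \<open>L\<^sup>T f x\<close> is the sum of \<open>f\<close> over a block and \<open>L\<^sup>T 1 x\<close> its length.
\<close>

definition "L f x = f (s False x) + (if x \<in> Xo then f (s True x) else 0)"
definition "Q f x = f (s False x) + f (s True x)"

lemma L_pow_Suc: "(L ^^ Suc t) f = (L ^^ t) (L f)" and Q_pow_Suc: "(Q ^^ Suc t) f = (Q ^^ t) (Q f)"
  by (simp_all add: funpow_Suc_right del: funpow.simps)

lemma L_apply: "(L ^^ Suc T) f x = (L ^^ T) f (s False x)
    + (if x \<in> Xo then (L ^^ T) f (s True x) else 0)"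
  and Q_apply: "(Q ^^ Suc T) g x = (Q ^^ T) g (s False x) + (Q ^^ T) g (s True x)"
  by (simp_all add: L_def[of "(L ^^ T) f" x] Q_def[of "(Q ^^ T) g" x])

text \<open>A change of time: one step in the orbit of x costs two steps in the orbit of
  \<open>s False x\<close> if the current point lies in \<open>Xo\<close>, and one step otherwise.
  The end position is carried along so that the next piece can be attached.\<close>

lemma orbit_sum1:
  fixes f :: "'a \<Rightarrow> 'b::comm_monoid_add"
  assumes x: "x \<in> X"
  shows "(\<Sum>j<(\<Sum>i<m. L (\<lambda>_. 1::nat) ((E ^^ i) x)). f ((E ^^ j) (s False x)))
      = (\<Sum>i<m. L f ((E ^^ i) x))
     \<and> (E ^^ (\<Sum>i<m. L (\<lambda>_. 1::nat) ((E ^^ i) x))) (s False x) = s False ((E ^^ m) x)"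
proof (induction m)
  case (Suc m)
  let ?y = "(E ^^ m) x"
  have y: "?y \<in> X" by (rule funE_in[OF x])
  show ?case
  proof (cases "?y \<in> Xo")
    case True
    then have "L (\<lambda>_. 1::nat) ?y = Suc (Suc 0)" by (simp add: L_def)
    then show ?thesis using Suc True E_s_False[OF True] E_s_True[OF y]
      by (simp add: L_def add_ac)
  next
    case False
    then have "L (\<lambda>_. 1::nat) ?y = Suc 0" by (simp add: L_def)
    moreover have "E (s False ?y) = s False (E ?y)"
      using False s_glue[OF y y] E_s_True[OF y] by simp
    ultimately show ?thesis using Suc False by (simp add: L_def)
  qed
qed simp

text \<open>The level T formula enters twice, for the lengths \<open>L 1\<close> and for the sums
  \<open>L f\<close>; both uses are kept as hypotheses because their values have different
  types.\<close>

lemma orbit_sum_step: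
  fixes f :: "'a \<Rightarrow> 'b::comm_monoid_add"
  assumes x: "x \<in> X" and N: "N = (\<Sum>i<m. (L ^^ T) (\<lambda>_. 1::nat) ((E ^^ i) x))"
    and 1: "(\<Sum>j<N. L (\<lambda>_. 1::nat) ((E ^^ j) ((s False ^^ T) x)))
        = (\<Sum>i<m. (L ^^ Suc T) (\<lambda>_. 1::nat) ((E ^^ i) x))"
    and f: "(\<Sum>j<N. L f ((E ^^ j) ((s False ^^ T) x))) = (\<Sum>i<m. (L ^^ Suc T) f ((E ^^ i) x))"
  shows "(\<Sum>j<(\<Sum>i<m. (L ^^ Suc T) (\<lambda>_. 1::nat) ((E ^^ i) x)). f ((E ^^ j) ((s False ^^ Suc T) x)))
       = (\<Sum>i<m. (L ^^ Suc T) f ((E ^^ i) x))"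
  using orbit_sum1[OF pow_in[OF x, where a = False and k = T], of f N] unfolding 1 f by simp

text \<open>Lengths are natural numbers, so this instance has to precede the one for arbitrary
  values.\<close>

lemma orbit_sum_nat:
  fixes f :: "'a \<Rightarrow> nat"
  assumes x: "x \<in> X"
  shows "(\<Sum>j<(\<Sum>i<m. (L ^^ T) (\<lambda>_. 1::nat) ((E ^^ i) x)). f ((E ^^ j) ((s False ^^ T) x)))
       = (\<Sum>i<m. (L ^^ T) f ((E ^^ i) x))"
proof (induction T arbitrary: f)
  case (Suc T)
  show ?case
    by (rule orbit_sum_step[OF x refl]) (simp_all only: Suc L_pow_Suc)
qed simp

lemma orbit_sum:
  fixes f :: "'a \<Rightarrow> 'b::comm_monoid_add"
  assumes x: "x \<in> X"
  shows "(\<Sum>j<(\<Sum>i<m. (L ^^ T) (\<lambda>_. 1::nat) ((E ^^ i) x)). f ((E ^^ j) ((s False ^^ T) x)))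
       = (\<Sum>i<m. (L ^^ T) f ((E ^^ i) x))"
proof (induction T arbitrary: f)
  case (Suc T)
  show ?case
    by (rule orbit_sum_step[OF x refl]) (simp_all only: Suc L_pow_Suc orbit_sum_nat[OF x])
qed simp

lemma L_mono:
  fixes f g :: "'a \<Rightarrow> real"
  assumes "\<And>y. y \<in> X \<Longrightarrow> f y \<le> g y"
  shows "x \<in> X \<Longrightarrow> (L ^^ T) f x \<le> (L ^^ T) g x"
proof (induction T arbitrary: x)
  case (Suc T)
  then show ?case using Xo_sub by (auto simp: L_apply s_in simp del: funpow.simps intro!: add_mono)
qed (use assms in auto)

lemma L_diff: "(L ^^ T) (\<lambda>y. f y - g y) x = (L ^^ T) f x - (L ^^ T) g x"
  for f g :: "'a \<Rightarrow> real"
  by (induction T arbitrary: x) (auto simp: L_apply simp del: funpow.simps(2))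

lemma L_cmult: "(L ^^ T) (\<lambda>y. c * f y) x = c * (L ^^ T) f x"
  for f :: "'a \<Rightarrow> real"
  by (induction T arbitrary: x) (auto simp: L_apply algebra_simps simp del: funpow.simps(2))

lemma L_abs: "\<bar>(L ^^ T) f x\<bar> \<le> (L ^^ T) (\<lambda>y. \<bar>f y\<bar>) x"
  for f :: "'a \<Rightarrow> real"
proof (induction T arbitrary: x)
  case (Suc T)
  show ?case
    using Suc[of "s False x"] Suc[of "s True x"] by (auto simp: L_apply simp del: funpow.simps)
qed simp

lemma L_bound: 
  fixes f :: "'a \<Rightarrow> real"
  assumes "\<And>y. y \<in> X \<Longrightarrow> \<bar>f y\<bar> \<le> M" and x: "x \<in> X"
  shows "\<bar>(L ^^ T) f x\<bar> \<le> M * (L ^^ T) (\<lambda>_. 1) x"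
proof -
  have "\<bar>(L ^^ T) f x\<bar> \<le> (L ^^ T) (\<lambda>y. \<bar>f y\<bar>) x" by (rule L_abs)
  also have "\<dots> \<le> (L ^^ T) (\<lambda>_. M * 1) x" using assms by (intro L_mono) auto
  also have "\<dots> = M * (L ^^ T) (\<lambda>_. 1) x" by (rule L_cmult)
  finally show ?thesis .
qed

lemma L_of_nat: "real ((L ^^ T) (\<lambda>_. 1) x) = (L ^^ T) (\<lambda>_. 1) x"
  by (induction T arbitrary: x) (auto simp: L_apply simp del: funpow.simps(2))

lemma L_1_le: "(L ^^ T) (\<lambda>_. 1::real) x \<le> 2 ^ T"
proof (induction T arbitrary: x)
  case (Suc T)
  have "0 \<le> (2::real) ^ T" by simp
  then show ?case using Suc[of "s False x"] Suc[of "s True x"]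
    unfolding L_apply power_Suc by (smt (verit))
qed simp

lemma L_1_ge1: "1 \<le> (L ^^ T) (\<lambda>_. 1::nat) x"
proof (induction T arbitrary: x)
  case (Suc T)
  show ?case using Suc[of "s False x"] by (auto simp: L_apply simp del: funpow.simps)
qed simp

lemma L_le_Q:
  fixes f :: "'a \<Rightarrow> real"
  assumes "\<And>y. y \<in> X \<Longrightarrow> 0 \<le> f y" and "x \<in> X"
  shows "0 \<le> (L ^^ T) f x" "(L ^^ T) f x \<le> (Q ^^ T) f x"
proof -
  have "0 \<le> (L ^^ T) f x \<and> (L ^^ T) f x \<le> (Q ^^ T) f x" using assms(2)
  proof (induction T arbitrary: x)
    case (Suc T)
    show ?case using Suc.IH[of "s False x"] Suc.IH[of "s True x"] Suc.prems
      by (auto simp: L_apply Q_apply s_in simp del: funpow.simps)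
  qed (use assms in auto)
  then show "0 \<le> (L ^^ T) f x" "(L ^^ T) f x \<le> (Q ^^ T) f x" by auto
qed

text \<open>Merging double points loses none of them: where \<open>L\<close> skips
  \<open>s True y\<close>, that point equals \<open>s False y\<close>, which is counted.\<close>

lemma L_word_le:
  fixes f :: "'a \<Rightarrow> real"
  assumes "\<And>y. y \<in> X \<Longrightarrow> 0 \<le> f y" and "x \<in> X"
  shows "f (word_comp s u x) \<le> (L ^^ length u) f x"
  using assms(1)
proof (induction u arbitrary: f)
  case (Cons a u)
  let ?y = "word_comp s u x"
  have y: "?y \<in> X" using assms(2) by (rule word_in)
  have "f (s a ?y) \<le> L f ?y"
    using Cons.prems s_glue[OF y y] y by (cases a) (auto simp: L_def s_in)
  also have "\<dots> \<le> (L ^^ length u) (L f) x"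
    by (rule Cons.IH) (use Cons.prems in \<open>auto simp: L_def s_in\<close>)
  finally show ?case by (simp add: L_pow_Suc del: funpow.simps)
qed simp

text \<open>Nothing is merged in front of a deep word w, so its cell alone contributes 2^(T - n)
  points, n being the length of w. This gives k = 1/2^n; for T < n the bound is at most 1, and a
  block is never empty.\<close>

lemma L_1_lower: "\<exists>k>0. \<forall>T. \<forall>x\<in>X. k * 2 ^ T \<le> (L ^^ T) (\<lambda>_. 1::real) x"
proof -
  obtain w where w: "\<And>u x. x \<in> X \<Longrightarrow> word_comp s u (word_comp s w x) \<in> Xo" using deep by blast
  have full: "(L ^^ t) (\<lambda>_. 1::real) (word_comp s u (word_comp s w x)) = 2 ^ t" if "x \<in> X" for t u x
  proof (induction t arbitrary: u)
    case (Suc t)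
    show ?case using Suc[of "False # u"] Suc[of "True # u"] w[OF that, of u]
      by (simp add: L_apply del: funpow.simps)
  qed simp
  let ?n = "length w"
  have "1 / 2 ^ ?n * 2 ^ T \<le> (L ^^ T) (\<lambda>_. 1::real) x" if x: "x \<in> X" for x T
  proof (cases "?n \<le> T")
    case True
    then obtain t where t: "T = ?n + t" using le_Suc_ex by blast
    have "2 ^ t = (L ^^ t) (\<lambda>_. 1::real) (word_comp s w x)" using full[OF x, of t "[]"] by simp
    also have "\<dots> \<le> (L ^^ ?n) ((L ^^ t) (\<lambda>_. 1)) x"
      by (rule L_word_le[OF _ x]) (use L_le_Q(1) in auto)
    finally show ?thesis by (simp add: t funpow_add power_add)
  next
    case False
    then have "(2::real) ^ T \<le> 2 ^ ?n" by (intro power_increasing) auto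
    then have "1 / 2 ^ ?n * 2 ^ T \<le> (1::real)" by simp
    also have "1 \<le> (L ^^ T) (\<lambda>_. 1::real) x" using L_1_ge1[of T x] L_of_nat[of T x] by linarith
    finally show ?thesis .
  qed
  then show ?thesis by (intro exI[of _ "1 / 2 ^ ?n"]) auto
qed

text \<open>\<open>Q ^^ t\<close> is a sum of 2^t terms, one for each word, compared word by
  word.\<close>

lemma Q_osc:
  fixes f :: "'a \<Rightarrow> real"
  assumes "\<And>u. length u = t \<Longrightarrow> \<bar>f (word_comp s u x) - f (word_comp s u y)\<bar> \<le> e"
  shows "\<bar>(Q ^^ t) f x - (Q ^^ t) f y\<bar> \<le> 2 ^ t * e"
  using assms
proof (induction t arbitrary: f e)
  case 0
  then show ?case using 0[of "[]"] by simp
next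
  case (Suc t)
  have "\<bar>(Q ^^ t) (Q f) x - (Q ^^ t) (Q f) y\<bar> \<le> 2 ^ t * (2 * e)"
  proof (rule Suc.IH)
    fix u :: "bool list" assume "length u = t"
    then show "\<bar>Q f (word_comp s u x) - Q f (word_comp s u y)\<bar> \<le> 2 * e"
      using Suc.prems[of "False # u"] Suc.prems[of "True # u"] by (auto simp: Q_def)
  qed
  then show ?case by (simp add: Q_pow_Suc mult_ac del: funpow.simps)
qed

lemma Q_cont: 
  fixes f :: "'a \<Rightarrow> real"
  assumes "continuous_on X f"
  shows "continuous_on X ((Q ^^ t) f)"
proof (induction t)
  case (Suc t)
  have "continuous_on X (\<lambda>x. (Q ^^ t) f (s a x))" for a
    using continuous_on_compose[OF s_cont, of a "(Q ^^ t) f"] s_image continuous_on_subset[OF Suc]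
    by (auto simp: o_def)
  then have "continuous_on X (\<lambda>x. (Q ^^ t) f (s False x) + (Q ^^ t) f (s True x))"
    by (intro continuous_intros)
  then show ?case by (simp add: Q_apply[abs_def] del: funpow.simps)
qed (use assms in auto)

lemma Q_bound:
  fixes f :: "'a \<Rightarrow> real"
  assumes "\<And>y. y \<in> X \<Longrightarrow> \<bar>f y\<bar> \<le> M"
  shows "x \<in> X \<Longrightarrow> \<bar>(Q ^^ t) f x\<bar> \<le> 2 ^ t * M"
proof (induction t arbitrary: x)
  case (Suc t)
  show ?case using Suc.IH[of "s False x"] Suc.IH[of "s True x"] Suc.prems
    by (auto simp: Q_apply s_in simp del: funpow.simps)
qed (use assms in auto)

end

section \<open>Equidistribution and unique ergodicity\<close>

lemma space_borel_on [simp]: "space (borel_on X) = X"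
  by (simp add: borel_on_def space_restrict_space)

lemma continuous_on_borel_on:
  fixes f :: "'a::topological_space \<Rightarrow> 'b::topological_space"
  shows "continuous_on X f \<Longrightarrow> f \<in> borel_measurable (borel_on X)"
  unfolding borel_on_def by (rule borel_measurable_continuous_on_restrict)

lemma continuous_on_measurable_borel_on:
  assumes "continuous_on X f" "f ` X \<subseteq> Y"
  shows "f \<in> measurable (borel_on X) (borel_on Y)"
  using continuous_on_borel_on[OF assms(1)] assms(2) unfolding borel_on_def
  by (intro measurable_restrict_space2) (auto simp: space_restrict_space)

lemma closed_in_borel_on: "closed F \<Longrightarrow> F \<subseteq> X \<Longrightarrow> F \<in> sets (borel_on X)"
  unfolding borel_on_def sets_restrict_space by (auto intro!: image_eqI[of _ _ F])

lemma closed_bump_tendsto: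
  fixes F :: "'a::metric_space set"
  assumes "closed F" "F \<noteq> {}"
  shows "(\<lambda>m. max 0 (1 - real m * infdist x F)) \<longlonglongrightarrow> indicator F x"
proof (cases "x \<in> F")
  case False
  then have pos: "infdist x F > 0" using assms in_closed_iff_infdist_zero infdist_nonneg
    by (metis order_le_less)
  obtain N where N: "real N > 1 / infdist x F" using reals_Archimedean2 by blast
  have "max 0 (1 - real m * infdist x F) = 0" if "N \<le> m" for m
  proof -
    have "1 < real N * infdist x F" using N pos by (simp add: field_simps)
    also have "\<dots> \<le> real m * infdist x F" using that pos by (intro mult_right_mono) auto
    finally show ?thesis by simp
  qed
  then show ?thesis using False
    by (intro tendsto_eventually) (auto simp: eventually_sequentially)
qed (use assms in auto)

lemma closed_bump_continuous: "continuous_on S (\<lambda>x. max 0 (1 - real m * infdist x F))"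
  by (intro continuous_intros)

lemma integral_closed_bump_tendsto:
  fixes F :: "'a::metric_space set"
  assumes "finite_measure \<mu>" and sets: "sets \<mu> = sets (borel_on X)"
      and F: "closed F" "F \<noteq> {}" "F \<subseteq> X"
  shows "(\<lambda>m. \<integral>x. max 0 (1 - real m * infdist x F) \<partial>\<mu>) \<longlonglongrightarrow> measure \<mu> F"
proof -
  interpret finite_measure \<mu> by fact
  have "(\<lambda>m. \<integral>x. max 0 (1 - real m * infdist x F) \<partial>\<mu>) \<longlonglongrightarrow> (\<integral>x. indicator F x \<partial>\<mu>)"
  proof (rule integral_dominated_convergence[where w = "\<lambda>_. 1"])
    show "(\<lambda>x. max 0 (1 - real m * infdist x F)) \<in> borel_measurable \<mu>" for m
      unfolding measurable_cong_sets[OF sets refl]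
      by (rule continuous_on_borel_on[OF closed_bump_continuous])
    show "(indicator F :: 'a \<Rightarrow> real) \<in> borel_measurable \<mu>"
      using closed_in_borel_on[OF F(1,3)] sets by auto
  qed (use closed_bump_tendsto[OF F(1,2)] in \<open>auto simp: infdist_nonneg\<close>)
  then show ?thesis using closed_in_borel_on[OF F(1,3)] sets by simp
qed

text \<open>Closed sets form an intersection-stable generator, and their measures are limits of
  integrals of continuous cutoffs.\<close>

lemma borel_on_measure_eqI:
  fixes X :: "'a::metric_space set"
  assumes prob: "prob_space \<mu>" "prob_space \<nu>"
    and sets: "sets \<mu> = sets (borel_on X)" "sets \<nu> = sets (borel_on X)" and "closed X"
    and eq: "\<And>f :: 'a \<Rightarrow> real. continuous_on X f \<Longrightarrow> integral\<^sup>L \<mu> f = integral\<^sup>L \<nu> f"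
  shows "\<mu> = \<nu>"
proof -
  interpret M: prob_space \<mu> by fact
  interpret N: prob_space \<nu> by fact
  let ?C = "{F. closed F \<and> F \<subseteq> X}"
  have gen: "sets (borel_on X) = sigma_sets X ?C"
  proof -
    have "sets (borel_on X) = (\<inter>) X ` sigma_sets UNIV {F. closed F}"
      unfolding borel_on_def sets_restrict_space by (simp add: borel_eq_closed)
    also have "\<dots> = sigma_sets X ((\<inter>) X ` {F. closed F})"
      using \<open>closed X\<close> by (intro sigma_sets_Int) (auto intro: sigma_sets.Basic)
    also have "(\<inter>) X ` {F. closed F} = ?C"
      using \<open>closed X\<close> by auto
    finally show ?thesis .
  qed
  show ?thesis
  proof (rule measure_eqI_generator_eq[where E = ?C and \<Omega> = X and A = "\<lambda>_. X"])
    show "Int_stable ?C" by (auto simp: Int_stable_def)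
    show "emeasure \<mu> F = emeasure \<nu> F" if "F \<in> ?C" for F
    proof (cases "F = {}")
      case False
      then have F: "closed F" "F \<noteq> {}" "F \<subseteq> X" using that by auto
      have "measure \<mu> F = measure \<nu> F"
        using integral_closed_bump_tendsto[OF M.finite_measure_axioms sets(1) F]
          integral_closed_bump_tendsto[OF N.finite_measure_axioms sets(2) F]
        by (subst (asm) eq[OF closed_bump_continuous]) (rule LIMSEQ_unique)
      then show ?thesis by (simp add: M.emeasure_eq_measure N.emeasure_eq_measure)
    qed simp
  qed (use sets gen \<open>closed X\<close> in auto)
qed

section \<open>Self-similar measures and equidistribution of blocks\<close>

text \<open>The condition \<open>self_similar\<close> says that \<mu> is the mean of its
  push-forwards under the two branches.\<close>

locale odometer_measure = odometer_ifs X Xo s v z E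
  for X Xo :: "'a::euclidean_space set" and s v z E +
  fixes \<mu> :: "'a measure"
  assumes sets_mu: "sets \<mu> = sets (borel_on X)" and prob: "prob_space \<mu>"
    and self_similar: "A \<in> sets \<mu> \<Longrightarrow>
      2 * emeasure \<mu> A = emeasure \<mu> (s False -` A \<inter> X) + emeasure \<mu> (s True -` A \<inter> X)"
    and null_bd: "emeasure \<mu> (X - Xo) = 0"
begin

sublocale prob_space \<mu> by (rule prob)

lemma space_mu [simp]: "space \<mu> = X"
  using sets_eq_imp_space_eq[OF sets_mu] by simp

lemma prob_X [simp]: "prob X = 1"
  using prob_space by simp

lemma cont_meas: "continuous_on X f \<Longrightarrow> f \<in> borel_measurable \<mu>" for f :: "'a \<Rightarrow> real"
  unfolding measurable_cong_sets[OF sets_mu refl] by (rule continuous_on_borel_on)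

lemma s_meas [measurable]: "s a \<in> measurable \<mu> \<mu>"
  unfolding measurable_cong_sets[OF sets_mu sets_mu]
  by (rule continuous_on_measurable_borel_on[OF s_cont s_image])

lemma nn_self_similar:
  assumes "f \<in> borel_measurable \<mu>"
  shows "2 * (\<integral>\<^sup>+x. f x \<partial>\<mu>) = (\<integral>\<^sup>+x. f (s False x) \<partial>\<mu>) + (\<integral>\<^sup>+x. f (s True x) \<partial>\<mu>)"
  using assms
proof (induction rule: borel_measurable_induct)
  case (cong f g)
  have "(\<integral>\<^sup>+x. f (s a x) \<partial>\<mu>) = (\<integral>\<^sup>+x. g (s a x) \<partial>\<mu>)" for a
    using cong(3) by (intro nn_integral_cong) (auto simp: s_in)
  moreover have "(\<integral>\<^sup>+x. f x \<partial>\<mu>) = (\<integral>\<^sup>+x. g x \<partial>\<mu>)"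
    using cong(3) by (intro nn_integral_cong) auto
  ultimately show ?case using cong(4) by simp
next
  case (set A)
  have "(\<integral>\<^sup>+x. indicator A (s a x) \<partial>\<mu>) = emeasure \<mu> (s a -` A \<inter> X)" for a
  proof -
    have "(\<integral>\<^sup>+x. indicator A (s a x) \<partial>\<mu>) = (\<integral>\<^sup>+x. indicator (s a -` A \<inter> X) x \<partial>\<mu>)"
      by (intro nn_integral_cong) (auto simp: indicator_def)
    also have "\<dots> = emeasure \<mu> (s a -` A \<inter> X)"
      using measurable_sets[OF s_meas set] by simp
    finally show ?thesis .
  qed
  then show ?case using self_similar[OF set] set by simp
next
  case (mult f c)
  then show ?case by (simp add: nn_integral_cmult distrib_left mult.left_commute[of 2])
next
  case (add f g)
  then show ?case by (simp add: nn_integral_add distrib_left ac_simps)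
next
  case (seq U)
  have inc: "incseq (\<lambda>i x. U i (s a x))" for a using seq(3) by (auto simp: incseq_def le_fun_def)
  have *: "(\<integral>\<^sup>+x. (SUP i. U i) (s a x) \<partial>\<mu>) = (SUP i. \<integral>\<^sup>+x. U i (s a x) \<partial>\<mu>)" for a
    using nn_integral_monotone_convergence_SUP[OF inc, where M = \<mu>] seq(1) by (simp add: image_comp)
  have "2 * (\<integral>\<^sup>+x. (SUP i. U i) x \<partial>\<mu>) = (SUP i. 2 * (\<integral>\<^sup>+x. U i x \<partial>\<mu>))"
    using nn_integral_monotone_convergence_SUP[OF seq(3), where M = \<mu>] seq(1)
    by (simp add: image_comp SUP_mult_left_ennreal)
  also have "\<dots> = (SUP i. (\<integral>\<^sup>+x. U i (s False x) \<partial>\<mu>) + (\<integral>\<^sup>+x. U i (s True x) \<partial>\<mu>))"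
    using seq.IH by simp
  also have "\<dots> = (SUP i. \<integral>\<^sup>+x. U i (s False x) \<partial>\<mu>) + (SUP i. \<integral>\<^sup>+x. U i (s True x) \<partial>\<mu>)"
    using seq(3) by (intro ennreal_SUP_add) (auto simp: incseq_def le_fun_def intro!:
        nn_integral_mono)
  finally show ?case unfolding * .
qed

lemma cont_bounded: "continuous_on X f \<Longrightarrow> \<exists>M\<ge>0. \<forall>x\<in>X. \<bar>f x\<bar> \<le> M" for f :: "'a \<Rightarrow> real"
proof -
  assume "continuous_on X f"
  then have "bounded (f ` X)" using compact_X compact_continuous_image compact_imp_bounded by blast
  then obtain M where "\<forall>x\<in>X. \<bar>f x\<bar> \<le> M" by (auto simp: bounded_iff)
  then show ?thesis by (intro exI[of _ "max M 0"]) force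
qed

lemma cont_integrable: "continuous_on X f \<Longrightarrow> integrable \<mu> f" for f :: "'a \<Rightarrow> real"
proof -
  assume f: "continuous_on X f"
  then obtain M where "\<And>x. x \<in> X \<Longrightarrow> \<bar>f x\<bar> \<le> M" using cont_bounded by blast
  then show ?thesis using cont_meas[OF f] by (intro integrable_const_bound[where B = M]) auto
qed

lemma integral_Q1:
  fixes f :: "'a \<Rightarrow> real"
  assumes f: "continuous_on X f"
  shows "(\<integral>x. Q f x \<partial>\<mu>) = 2 * (\<integral>x. f x \<partial>\<mu>)"
proof -
  obtain M where M: "\<And>x. x \<in> X \<Longrightarrow> \<bar>f x\<bar> \<le> M" using cont_bounded[OF f] by blast
  \<comment> \<open>Adding the bound M makes the integrand nonnegative; it cancels at the end
    because \<mu> has mass 1.\<close>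
  let ?g = "\<lambda>x. f x + M"
  have fs: "continuous_on X (\<lambda>x. f (s a x))" for a
    using continuous_on_compose[OF s_cont, of a f] s_image continuous_on_subset[OF f]
        by (auto simp: o_def)
  have g0: "0 \<le> f x + M" if "x \<in> X" for x using M[OF that] by auto
  have I: "(\<integral>\<^sup>+x. ennreal (f x + M) \<partial>\<mu>) = ennreal (\<integral>x. f x + M \<partial>\<mu>)"
    using g0 by (intro nn_integral_eq_integral Bochner_Integration.integrable_add cont_integrable
        f) auto
  have Is: "(\<integral>\<^sup>+x. ennreal (f (s a x) + M) \<partial>\<mu>) = ennreal (\<integral>x. f (s a x) + M \<partial>\<mu>)" for a
    using g0 by (intro nn_integral_eq_integral Bochner_Integration.integrable_add cont_integrable
        fs) (auto simp: s_in)
  have pos: "0 \<le> (\<integral>x. f x + M \<partial>\<mu>)" "0 \<le> (\<integral>x. f (s a x) + M \<partial>\<mu>)" for a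
    using g0 by (auto intro!: integral_nonneg_AE simp: s_in)
  have "2 * ennreal (\<integral>x. f x + M \<partial>\<mu>) = ennreal (\<integral>x. f (s False x) + M \<partial>\<mu>)
      + ennreal (\<integral>x. f (s True x) + M \<partial>\<mu>)"
    using nn_self_similar[of "\<lambda>x. ennreal (f x + M)"] cont_meas[OF f] unfolding I Is by simp
  also have "2 * ennreal (\<integral>x. f x + M \<partial>\<mu>) = ennreal (2 * (\<integral>x. f x + M \<partial>\<mu>))"
    by (simp add: ennreal_mult pos)
  finally have "2 * (\<integral>x. f x + M \<partial>\<mu>) = (\<integral>x. f (s False x) + M \<partial>\<mu>) + (\<integral>x. f (s True x) + M \<partial>\<mu>)"
    using pos by (simp flip: ennreal_plus)
  then have "2 * (\<integral>x. f x \<partial>\<mu>) = (\<integral>x. f (s False x) \<partial>\<mu>) + (\<integral>x. f (s True x) \<partial>\<mu>)"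
    using cont_integrable[OF f] cont_integrable[OF fs] by (simp add: prob_space)
  then show ?thesis using cont_integrable[OF fs] by (simp add: Q_def)
qed

lemma integral_Q:
  fixes f :: "'a \<Rightarrow> real"
  assumes f: "continuous_on X f"
  shows "(\<integral>x. (Q ^^ t) f x \<partial>\<mu>) = 2 ^ t * (\<integral>x. f x \<partial>\<mu>)"
proof (induction t)
  case (Suc t)
  then show ?case using integral_Q1[OF Q_cont[OF f, of t]] by simp
qed simp

text \<open>The mean of \<open>Q ^^ t\<close> applied to f is 2^t times the mean of f, and its
  oscillation is at most 2^t e once the cells of level t are small enough for the uniform continuity
  of f. So it is close to its mean everywhere.\<close>

lemma Q_limit:
  fixes f :: "'a \<Rightarrow> real"
  assumes f: "continuous_on X f" and e: "e > 0"
  shows "\<exists>t0. \<forall>t\<ge>t0. \<forall>x\<in>X. \<bar>(Q ^^ t) f x - 2 ^ t * integral\<^sup>L \<mu> f\<bar> \<le> 2 ^ t * e"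
proof -
  have "uniformly_continuous_on X f" using f compact_X compact_uniformly_continuous by blast
  then obtain d where d: "d > 0" "\<And>x y. x \<in> X \<Longrightarrow> y \<in> X \<Longrightarrow> dist y x < d \<Longrightarrow> dist (f y) (f x) < e"
    using e unfolding uniformly_continuous_on_def by metis
  obtain t0 where t0: "\<And>u x y. t0 \<le> length u \<Longrightarrow> x \<in> X \<Longrightarrow> y \<in> X \<Longrightarrow>
           dist (word_comp s u x) (word_comp s u y) < d" using shrink[OF d(1)] by metis
  have "\<bar>(Q ^^ t) f x - 2 ^ t * integral\<^sup>L \<mu> f\<bar> \<le> 2 ^ t * e" if t: "t \<ge> t0" and x: "x \<in> X" for t x
  proof -
    have int: "integrable \<mu> ((Q ^^ t) f)" by (rule cont_integrable[OF Q_cont[OF f]])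
    have "\<bar>(Q ^^ t) f y - (Q ^^ t) f x\<bar> \<le> 2 ^ t * e" if y: "y \<in> X" for y
    proof (rule Q_osc)
      fix u :: "bool list" assume "length u = t"
      then show "\<bar>f (word_comp s u y) - f (word_comp s u x)\<bar> \<le> e"
        using d(2)[OF word_in[OF x, of u] word_in[OF y, of u]] t0[of u y x] t x y
        by (auto simp: dist_real_def)
    qed
    then have b: "\<And>y. y \<in> X \<Longrightarrow> (Q ^^ t) f y \<le> (Q ^^ t) f x + 2 ^ t * e"
       "\<And>y. y \<in> X \<Longrightarrow> (Q ^^ t) f x - 2 ^ t * e \<le> (Q ^^ t) f y"
           by (simp_all add: abs_le_iff) (smt (verit))+
    have "(\<integral>y. (Q ^^ t) f y \<partial>\<mu>) \<le> (Q ^^ t) f x + 2 ^ t * e"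
      using b int by (intro integral_le_const) auto
    moreover have "(Q ^^ t) f x - 2 ^ t * e \<le> (\<integral>y. (Q ^^ t) f y \<partial>\<mu>)"
      using b int by (intro integral_ge_const) auto
    ultimately show ?thesis unfolding integral_Q[OF f] by auto
  qed
  then show ?thesis by blast
qed

text \<open>The indicator is dominated by a continuous cutoff of integral below e/2; for the cutoff,
  \<open>L\<close> is bounded by \<open>Q\<close>, which is controlled uniformly.\<close>

lemma L_bd_small:
  fixes e :: real
  assumes e: "e > 0"
  shows "\<exists>T0. \<forall>T\<ge>T0. \<forall>x\<in>X. (L ^^ T) (indicator (X - Xo)) x \<le> e * 2 ^ T"
proof (cases "X - Xo = {}")
  \<comment> \<open>The function \<open>infdist\<close> is 0 for the empty set, so the cutoffs of
    the other case would be constantly 1.\<close>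
  case True
  then have "(L ^^ T) (indicator (X - Xo) :: 'a \<Rightarrow> real) x = 0" for T x
    unfolding True by (induction T arbitrary: x) (auto simp: L_apply simp del: funpow.simps(2))
  then show ?thesis using e by simp
next
  case False
  let ?g = "\<lambda>m x. max 0 (1 - real m * infdist x (X - Xo))"
  have "measure \<mu> (X - Xo) = 0" using null_bd by (simp add: measure_def)
  then have "(\<lambda>m. \<integral>x. ?g m x \<partial>\<mu>) \<longlonglongrightarrow> 0"
    using integral_closed_bump_tendsto[OF finite_measure_axioms sets_mu closed_bd False] by auto
  then have "eventually (\<lambda>m. (\<integral>x. ?g m x \<partial>\<mu>) < e / 2) sequentially"
    using e by (intro order_tendstoD) auto
  then obtain m where m: "(\<integral>x. ?g m x \<partial>\<mu>) < e / 2" by (auto simp: eventually_sequentially)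
  obtain t0 where t0: "\<And>t x. t \<ge> t0 \<Longrightarrow> x \<in> X \<Longrightarrow>
      \<bar>(Q ^^ t) (?g m) x - 2 ^ t * integral\<^sup>L \<mu> (?g m)\<bar> \<le> 2 ^ t * (e / 2)"
    using Q_limit[OF closed_bump_continuous, of "e / 2" m "X - Xo"] e by auto
  have "(L ^^ T) (indicator (X - Xo)) x \<le> e * 2 ^ T" if T: "T \<ge> t0" and x: "x \<in> X" for T x
  proof -
    have "(L ^^ T) (indicator (X - Xo)) x \<le> (L ^^ T) (?g m) x"
      using x by (intro L_mono) (auto simp: indicator_def)
    also have "\<dots> \<le> (Q ^^ T) (?g m) x"
      using x by (intro L_le_Q) auto
    also have "\<dots> \<le> 2 ^ T * integral\<^sup>L \<mu> (?g m) + 2 ^ T * (e / 2)" using t0[OF T x] by linarith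
    also have "\<dots> \<le> 2 ^ T * (e / 2) + 2 ^ T * (e / 2)"
        using m by (intro add_right_mono mult_left_mono) auto
    finally show ?thesis by (simp add: mult.commute)
  qed
  then show ?thesis by blast
qed

text \<open>Replacing by \<open>Q\<close> the t copies of \<open>L\<close> that act on g first makes
  an error only at points of \<open>X - Xo\<close>, and these become rare in the blocks formed by
  the other T copies.\<close>

lemma L_Q_close:
  fixes g :: "'a \<Rightarrow> real"
  assumes g: "\<And>y. y \<in> X \<Longrightarrow> \<bar>g y\<bar> \<le> M" and "e > 0"
  shows "\<exists>T0. \<forall>T\<ge>T0. \<forall>x\<in>X. \<bar>(L ^^ (T + t)) g x - (L ^^ T) ((Q ^^ t) g) x\<bar> \<le> e * 2 ^ T"
  using \<open>e > 0\<close>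
proof (induction t arbitrary: e)
  case 0
  then show ?case by auto
next
  case (Suc t)
  let ?h = "(Q ^^ t) g"
  \<comment> \<open>The summand 1 keeps B positive, so that e may be divided by it.\<close>
  define B where "B = 2 ^ t * \<bar>M\<bar> + 1"
  have B: "B > 0" "\<And>y. y \<in> X \<Longrightarrow> \<bar>?h y\<bar> \<le> B"
  proof -
    show "B > 0" unfolding B_def by (simp add: add_nonneg_pos)
    fix y assume "y \<in> X"
    then have "\<bar>?h y\<bar> \<le> 2 ^ t * M" by (intro Q_bound g)
    also have "\<dots> \<le> 2 ^ t * \<bar>M\<bar>" by (intro mult_left_mono) auto
    finally show "\<bar>?h y\<bar> \<le> B" unfolding B_def by simp
  qed
  \<comment> \<open>This is used at level \<open>Suc T\<close>, where e/4 times 2^(T+1) is e/2 times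
    2^T.\<close>
  obtain T1 where T1: "\<And>T x. T \<ge> T1 \<Longrightarrow> x \<in> X \<Longrightarrow>
      \<bar>(L ^^ (T + t)) g x - (L ^^ T) ?h x\<bar> \<le> (e / 4) * 2 ^ T"
    using Suc.IH[of "e / 4"] Suc.prems by auto
  obtain T2 where T2: "\<And>T x. T \<ge> T2 \<Longrightarrow> x \<in> X \<Longrightarrow> (L ^^ T) (indicator (X - Xo)) x \<le> (e / 2 / B) * 2 ^ T"
    using L_bd_small[of "e / 2 / B"] Suc.prems B by auto
  have "\<bar>(L ^^ (T + Suc t)) g x - (L ^^ T) ((Q ^^ Suc t) g) x\<bar> \<le> e * 2 ^ T"
    if T: "T \<ge> max T1 T2" and x: "x \<in> X" for T x
  proof -
    have 1: "\<bar>(L ^^ (T + Suc t)) g x - (L ^^ T) (L ?h) x\<bar> \<le> e / 2 * 2 ^ T"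
      using T1[of "Suc T" x] T x by (simp add: L_pow_Suc del: funpow.simps)
    have "\<bar>(L ^^ T) (L ?h) x - (L ^^ T) (Q ?h) x\<bar> = \<bar>(L ^^ T) (\<lambda>y. L ?h y - Q ?h y) x\<bar>"
      by (simp add: L_diff)
    also have "\<dots> \<le> (L ^^ T) (\<lambda>y. \<bar>L ?h y - Q ?h y\<bar>) x" by (rule L_abs)
    also have "\<dots> \<le> (L ^^ T) (\<lambda>y. B * indicator (X - Xo) y) x"
      by (rule L_mono[OF _ x]) (use B in \<open>auto simp: L_def Q_def indicator_def s_in simp del:
          funpow.simps\<close>)
    also have "\<dots> = B * (L ^^ T) (indicator (X - Xo)) x" by (rule L_cmult)
    also have "\<dots> \<le> B * ((e / 2 / B) * 2 ^ T)" using T2[of T x] T x B by (intro mult_left_mono) auto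
    also have "\<dots> = e / 2 * 2 ^ T" using B by simp
    finally have 2: "\<bar>(L ^^ T) (L ?h) x - (L ^^ T) (Q ?h) x\<bar> \<le> e / 2 * 2 ^ T" .
    have 3: "(Q ^^ Suc t) g = Q ?h" by simp
    have "e * 2 ^ T = e / 2 * 2 ^ T + e / 2 * 2 ^ T" by simp
    then show ?thesis using 1 2 unfolding 3 by linarith
  qed
  then show ?case by blast
qed

text \<open>The order of choices matters: t makes \<open>Q ^^ t\<close> nearly constant, and T,
  depending on t, makes the replacement of \<open>L\<close> by \<open>Q\<close> harmless. The
  constant k turns a bound relative to 2^(T+t) into one relative to the true block length.\<close>

lemma block_average:
  fixes f :: "'a \<Rightarrow> real"
  assumes f: "continuous_on X f" and e: "e > 0"
  shows "\<exists>T. \<forall>x\<in>X. \<bar>(L ^^ T) (\<lambda>y. f y - integral\<^sup>L \<mu> f) x\<bar> \<le> e * (L ^^ T) (\<lambda>_. 1) x"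
proof -
  let ?g = "\<lambda>y. f y - integral\<^sup>L \<mu> f"
  have g: "continuous_on X ?g" by (intro continuous_intros f)
  have g0: "integral\<^sup>L \<mu> ?g = 0" using cont_integrable[OF f] by (simp add: prob_space)
  obtain k where k: "k > 0" "\<And>T x. x \<in> X \<Longrightarrow>
      k * 2 ^ T \<le> (L ^^ T) (\<lambda>_. 1::real) x" using L_1_lower by blast
  obtain t where t: "\<And>x. x \<in> X \<Longrightarrow> \<bar>(Q ^^ t) ?g x\<bar> \<le> 2 ^ t * (k * e / 2)"
    using Q_limit[OF g, of "k * e / 2"] k(1) e unfolding g0 by auto
  obtain M where M: "\<And>x. x \<in> X \<Longrightarrow> \<bar>?g x\<bar> \<le> M" using cont_bounded[OF g] by blast
  obtain T where T: "\<And>x. x \<in> X \<Longrightarrow> \<bar>(L ^^ (T + t)) ?g x - (L ^^ T) ((Q ^^ t) ?g) x\<bar>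
      \<le> (k * e / 2) * 2 ^ T"
    using L_Q_close[where g = ?g and M = M, OF M, of "k * e / 2" t] k(1) e by auto
  have "\<bar>(L ^^ (T + t)) ?g x\<bar> \<le> e * (L ^^ (T + t)) (\<lambda>_. 1) x" if x: "x \<in> X" for x
  proof -
    have "\<bar>(L ^^ T) ((Q ^^ t) ?g) x\<bar> \<le> 2 ^ t * (k * e / 2) * (L ^^ T) (\<lambda>_. 1) x"
      by (rule L_bound[OF t x])
    also have "\<dots> \<le> 2 ^ t * (k * e / 2) * 2 ^ T"
      using k(1) e by (intro mult_left_mono L_1_le) auto
    finally have "\<bar>(L ^^ (T + t)) ?g x\<bar> \<le> 2 ^ t * (k * e / 2) * 2 ^ T + (k * e / 2) * 2 ^ T"
      using T[OF x] by linarith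
    also have "\<dots> \<le> 2 ^ t * (k * e / 2) * 2 ^ T + 2 ^ t * ((k * e / 2) * 2 ^ T)"
    proof -
      have "1 * ((k * e / 2) * 2 ^ T) \<le> 2 ^ t * ((k * e / 2) * 2 ^ T)"
        using k(1) e by (intro mult_right_mono) auto
      then show ?thesis by linarith
    qed
    also have "\<dots> = e * (k * 2 ^ (T + t))" by (simp add: power_add field_simps)
    also have "\<dots> \<le> e * (L ^^ (T + t)) (\<lambda>_. 1) x" using k(2)[OF x] e by (intro mult_left_mono) auto
    finally show ?thesis .
  qed
  then show ?thesis by blast
qed

lemma orbit_average:
  fixes f :: "'a \<Rightarrow> real"
  assumes f: "continuous_on X f" and p: "p \<in> X"
  shows "(\<lambda>N. (\<Sum>i<N. f ((E ^^ i) p)) / real N) \<longlonglongrightarrow> integral\<^sup>L \<mu> f"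
proof -
  define g where "g = (\<lambda>y. f y - integral\<^sup>L \<mu> f)"
  have cg: "continuous_on X g" unfolding g_def by (intro continuous_intros f)
  obtain M where M: "M \<ge> 0" "\<And>x. x \<in> X \<Longrightarrow> \<bar>g x\<bar> \<le> M" using cont_bounded[OF cg] by blast
  have "(\<lambda>N. (\<Sum>i<N. g ((E ^^ i) p)) / real N) \<longlonglongrightarrow> 0"
  proof (rule LIMSEQ_I)
    fix r :: real assume r: "r > 0"
    obtain T where T: "\<And>x. x \<in> X \<Longrightarrow> \<bar>(L ^^ T) g x\<bar> \<le> (r / 2) * (L ^^ T) (\<lambda>_. 1) x"
      using block_average[OF f, of "r / 2"] r unfolding g_def by auto
    obtain m0 x where x: "x \<in> X" "(E ^^ m0) p = (s False ^^ T) x"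
        using orbit_enters_pow[OF p] by blast
    \<comment> \<open>n m is the time needed for the first m complete blocks.\<close>
    define n where "n = (\<lambda>m. \<Sum>i<m. (L ^^ T) (\<lambda>_. 1::nat) ((E ^^ i) x))"
    have n_Suc: "n (Suc m) = n m + (L ^^ T) (\<lambda>_. 1::nat) ((E ^^ m) x)" for m by (simp add: n_def)
    have n_ge: "m \<le> n m" for m
    proof (induction m)
      case (Suc m)
      then show ?case using L_1_ge1[of T "(E ^^ m) x"] by (simp add: n_Suc)
    qed (simp add: n_def)
    have n_step: "real (n (Suc m)) \<le> n m + 2 ^ T" for m
      using L_1_le[of T "(E ^^ m) x"] unfolding n_Suc of_nat_add L_of_nat by simp
    have block: "\<bar>\<Sum>j<n m. g ((E ^^ j) ((s False ^^ T) x))\<bar> \<le> (r / 2) * n m" for m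
    proof -
      have "\<bar>\<Sum>j<n m. g ((E ^^ j) ((s False ^^ T) x))\<bar> = \<bar>\<Sum>i<m. (L ^^ T) g ((E ^^ i) x)\<bar>"
        unfolding n_def orbit_sum[OF x(1)] ..
      also have "\<dots> \<le> (\<Sum>i<m. \<bar>(L ^^ T) g ((E ^^ i) x)\<bar>)" by (rule sum_abs)
      also have "\<dots> \<le> (\<Sum>i<m. (r / 2) * (L ^^ T) (\<lambda>_. 1) ((E ^^ i) x))"
        by (intro sum_mono T funE_in x)
      also have "\<dots> = (r / 2) * n m" by (simp add: n_def sum_distrib_left flip: L_of_nat)
      finally show ?thesis .
    qed
    \<comment> \<open>Three pieces: m0 steps before the orbit reaches the image of
      \<open>s False ^^ T\<close>, then complete blocks, then an unfinished block of at most 2^T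
      steps.\<close>
    have bound: "\<bar>\<Sum>i<N. g ((E ^^ i) p)\<bar> \<le> M * m0 + (r / 2) * N + M * 2 ^ T" if N: "N \<ge> m0" for N
    proof -
      obtain K where K: "N = m0 + K" using N le_Suc_ex by blast
      have "\<exists>m. n m \<le> K \<and> K < n (Suc m)"
      proof -
        define m where "m = (LEAST m. K < n (Suc m))"
        have ex: "K < n (Suc K)" using n_ge[of "Suc K"] by simp
        have "K < n (Suc m)" unfolding m_def by (rule LeastI[of "\<lambda>m. K < n (Suc m)", OF ex])
        moreover have "n m \<le> K"
        proof (cases m)
          case (Suc l)
          then show ?thesis using not_less_Least[of l "\<lambda>m. K < n (Suc m)"] unfolding m_def by auto
        qed (simp add: n_def)
        ultimately show ?thesis by blast
      qed
      then obtain m where m: "n m \<le> K" "K < n (Suc m)" by blast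
      have term_bd: "\<bar>g ((E ^^ i) q)\<bar> \<le> M" if "q \<in> X" for q i using M(2) funE_in that by blast
      let ?h = "\<lambda>j. g ((E ^^ j) ((s False ^^ T) x))"
      have "(\<Sum>i<N. g ((E ^^ i) p)) = (\<Sum>i<m0. g ((E ^^ i) p)) + (\<Sum>j<K. ?h j)"
        unfolding K lessThan_atLeast0 by (subst sum.atLeastLessThan_concat[of 0 m0 "m0
            + K", symmetric])
          (auto simp: sum.shift_bounds_nat_ivl[of _ 0 m0 K, simplified add.commute[of K]]
              funpow_add x(2)[symmetric]
            sum.atLeastLessThan_shift_0[of _ m0] add.commute[of m0])
      also have "(\<Sum>j<K. ?h j) = (\<Sum>j<n m. ?h j) + (\<Sum>j=n m..<K. ?h j)"
        unfolding lessThan_atLeast0 using m(1) by (simp add: sum.atLeastLessThan_concat)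
      finally have eq: "(\<Sum>i<N. g ((E ^^ i) p))
          = (\<Sum>i<m0. g ((E ^^ i) p)) + ((\<Sum>j<n m. ?h j) + (\<Sum>j=n m..<K. ?h j))" .
      have 1: "\<bar>\<Sum>i<m0. g ((E ^^ i) p)\<bar> \<le> M * m0"
        using sum_norm_bound[of "{..<m0}" "\<lambda>i. g ((E ^^ i) p)" M] term_bd[OF p]
            by (simp add: mult.commute)
      have "\<bar>\<Sum>j=n m..<K. ?h j\<bar> \<le> M * (K - n m)"
        using sum_norm_bound[of "{n m..<K}" ?h M] term_bd[OF pow_in[OF x(1)]]
            by (simp add: mult.commute)
      also have "\<dots> \<le> M * 2 ^ T"
        using m n_step[of m] M(1) by (intro mult_left_mono) (auto simp: of_nat_diff)
      finally have 3: "\<bar>\<Sum>j=n m..<K. ?h j\<bar> \<le> M * 2 ^ T" .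
      have "(r / 2) * n m \<le> (r / 2) * N" using m(1) K r by (intro mult_left_mono) auto
      then have 2: "\<bar>\<Sum>j<n m. ?h j\<bar> \<le> (r / 2) * N" using block[of m] by linarith
      show ?thesis unfolding eq using 1 2 3 by linarith
    qed
    define C where "C = M * m0 + M * 2 ^ T"
    obtain N0 where N0: "real N0 > 2 * C / r" using reals_Archimedean2 by blast
    show "\<exists>no. \<forall>N\<ge>no. norm ((\<Sum>i<N. g ((E ^^ i) p)) / real N - 0) < r"
    proof (intro exI[of _ "max (Suc m0) N0"] allI impI)
      fix N assume N: "max (Suc m0) N0 \<le> N"
      have "2 * C / r < N" using N0 N by linarith
      then have "C < r / 2 * N" using r by (simp add: field_simps)
      then have "\<bar>\<Sum>i<N. g ((E ^^ i) p)\<bar> < r * N" using bound[of N] N by (simp add: C_def)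
      then show "norm ((\<Sum>i<N. g ((E ^^ i) p)) / real N - 0) < r" using N by (simp add: field_simps)
    qed
  qed
  then have "(\<lambda>N. (\<Sum>i<N. g ((E ^^ i) p)) / real N + integral\<^sup>L \<mu> f) \<longlonglongrightarrow> 0 + integral\<^sup>L \<mu> f"
    by (intro tendsto_intros)
  moreover have "\<forall>\<^sub>F N in sequentially. (\<Sum>i<N. g ((E ^^ i) p)) / real N + integral\<^sup>L \<mu> f
      = (\<Sum>i<N. f ((E ^^ i) p)) / real N"
    using eventually_gt_at_top[of 0]
    by eventually_elim (simp add: g_def sum_subtractf field_simps)
  ultimately show ?thesis by (simp add: tendsto_cong)
qed

lemma uniformly_distributed: "p \<in> X \<Longrightarrow> uniformly_distributed_on X \<mu> (\<lambda>i. (E ^^ i) p)"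
  unfolding uniformly_distributed_on_def by (auto intro: orbit_average)

section \<open>Measurability, invariance and unique ergodicity\<close>

lemma sets_mu_iff: "A \<in> sets \<mu> \<longleftrightarrow> A \<in> sets borel \<and> A \<subseteq> X"
  unfolding sets_mu borel_on_def using compact_X
  by (subst sets_restrict_space_iff) (auto simp: compact_imp_closed)

text \<open>On a compact set a continuous injection has a continuous inverse, so forward images of
  Borel sets are preimages under that inverse.\<close>

lemma inj_image_sets:
  assumes f: "continuous_on X f" "inj_on f X" "f ` X \<subseteq> X" and B: "B \<in> sets \<mu>"
  shows "f ` B \<in> sets \<mu>"
proof -
  let ?g = "the_inv_into X f"
  have BX: "B \<subseteq> X" using B sets_mu_iff by auto
  have inv: "the_inv_into X f (f x) = x" if "x \<in> X" for x using f(2) that by (rule the_inv_into_f_f)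
  have "continuous_on (f ` X) ?g"
    by (rule continuous_on_inv_into[OF f(1) compact_X]) (use f(2) in auto)
  then have "?g \<in> measurable (borel_on (f ` X)) (borel_on X)"
    using inv by (intro continuous_on_measurable_borel_on) auto
  then have "?g -` B \<inter> f ` X \<in> sets (borel_on (f ` X))"
    using measurable_sets[of ?g "borel_on (f ` X)" "borel_on X" B] B sets_mu by simp
  moreover have "?g -` B \<inter> f ` X = f ` B" using inv BX by auto
  moreover have "f ` X \<in> sets borel"
    using compact_continuous_image[OF f(1) compact_X] by (simp add: compact_imp_closed)
  ultimately have "f ` B \<in> sets borel" unfolding borel_on_def by (simp add: sets_restrict_space_iff)
  then show ?thesis using f(3) BX by (auto simp: sets_mu_iff)
qed

lemma Xo_sets: "Xo \<in> sets \<mu>"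
proof -
  have "X \<in> sets \<mu>" "X - Xo \<in> sets \<mu>"
    using compact_X closed_bd by (auto simp: sets_mu_iff compact_imp_closed)
  then have "X - (X - Xo) \<in> sets \<mu>" by auto
  moreover have "X - (X - Xo) = Xo" using Xo_sub by auto
  ultimately show ?thesis by simp
qed

lemma s_pow_meas: "(s a ^^ k) \<in> measurable \<mu> \<mu>"
  by (induction k) (auto intro!: measurable_comp[OF _ s_meas] simp: id_def)

text \<open>E is given level by level on the tower, so a preimage is a countable union of injective
  images of Borel sets, together with v if z lies in A.\<close>

lemma E_meas [measurable]: "E \<in> measurable \<mu> \<mu>"
proof (rule measurableI)
  show "x \<in> space \<mu> \<Longrightarrow> E x \<in> space \<mu>" for x by (simp add: E_in)
  fix A assume A: "A \<in> sets \<mu>"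
  define h where "h = (\<lambda>k x. (s True ^^ k) (s False x))"
  define B where "B = (\<lambda>k. (\<lambda>x. (s False ^^ k) (s True x)) -` A \<inter> X \<inter> Xo)"
  have B: "B k \<in> sets \<mu>" for k
  proof -
    have "(\<lambda>x. (s False ^^ k) (s True x)) \<in> measurable \<mu> \<mu>"
      using measurable_comp[OF s_meas s_pow_meas] by (simp add: o_def)
    from measurable_sets[OF this A] show ?thesis unfolding B_def using Xo_sets by auto
  qed
  have hB: "h k ` B k \<in> sets \<mu>" for k
  proof (rule inj_image_sets[OF _ _ _ B])
    show "continuous_on X (h k)"
      using continuous_on_compose[OF s_cont, of False "s True ^^ k"]
        continuous_on_subset[OF continuous_on_funpow[OF s_cont s_image] s_image]
      by (auto simp: h_def o_def)
    show "inj_on (h k) X"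
      using comp_inj_on[OF s_inj, of "s True ^^ k" False] inj_on_subset[OF inj_on_funpow[OF s_inj
          s_image] s_image]
      by (auto simp: h_def o_def)
    show "h k ` X \<subseteq> X" by (auto simp: h_def pow_in s_in)
  qed
  have eq: "E -` A \<inter> X = (if z \<in> A then {v} else {}) \<union> (\<Union>k. h k ` B k)"
  proof
    show "E -` A \<inter> X \<subseteq> (if z \<in> A then {v} else {}) \<union> (\<Union>k. h k ` B k)"
    proof
      fix x assume x: "x \<in> E -` A \<inter> X"
      then consider "x = v" | k y where "y \<in> Xo" "x = (s True ^^ k) (s False y)"
        using v_cases[of x] by blast
      then show "x \<in> (if z \<in> A then {v} else {}) \<union> (\<Union>k. h k ` B k)"
      proof cases
        case (2 k y)
        then have "y \<in> B k" using x Xo_sub by (auto simp: B_def E_tower)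
        then show ?thesis using 2 by (auto simp: h_def)
      qed (use x E_v in auto)
    qed
    show "(if z \<in> A then {v} else {}) \<union> (\<Union>k. h k ` B k) \<subseteq> E -` A \<inter> X"
      using v_in E_v by (auto simp: B_def h_def E_tower pow_in s_in)
  qed
  have "{v} \<in> sets \<mu>" using v_in by (auto simp: sets_mu_iff)
  then show "E -` A \<inter> space \<mu> \<in> sets \<mu>" unfolding space_mu eq by (intro sets.Un) (use hB in auto)
qed

lemma self_similar_measure: "A \<in> sets \<mu> \<Longrightarrow>
    2 * prob A = prob (s False -` A \<inter> X) + prob (s True -` A \<inter> X)"
proof -
  assume "A \<in> sets \<mu>"
  from self_similar[OF this] have "ennreal (2 * prob A)
      = ennreal (prob (s False -` A \<inter> X) + prob (s True -` A \<inter> X))"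
    by (simp add: emeasure_eq_measure ennreal_mult)
  then show ?thesis by (simp flip: ennreal_plus)
qed

text \<open>By self-similarity and the two rules for E, the defect of A is half the defect of its
  preimage under \<open>s False\<close>, the remaining terms cancelling up to a null set. Starting
  from the trivial bound 1, the defect is halved k times.\<close>

lemma E_preimage_close: "A \<in> sets \<mu> \<Longrightarrow> \<bar>prob (E -` A \<inter> X) - prob A\<bar> \<le> 1 / 2 ^ k"
proof (induction k arbitrary: A)
  case 0
  then show ?case using prob_le_1[of "E -` A \<inter> X"] prob_le_1[of A] measure_nonneg[of \<mu> "E -` A \<inter>
      X"] measure_nonneg[of \<mu> A]
    by (simp only: power_0 div_by_1)
next
  case (Suc k)
  let ?B = "E -` A \<inter> X" and ?A' = "s False -` A \<inter> X"
  have B: "?B \<in> sets \<mu>" using measurable_sets[OF E_meas Suc.prems] by simp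
  have A': "?A' \<in> sets \<mu>" using measurable_sets[OF s_meas Suc.prems] by simp
  have "s True -` ?B \<inter> X = E -` ?A' \<inter> X" by (auto simp: E_s_True s_in E_in)
  moreover have "prob (s False -` ?B \<inter> X) = prob (s True -` A \<inter> X)"
  proof (rule measure_eq_AE)
    have "X - Xo \<in> null_sets \<mu>"
      using null_bd sets.Diff[OF sets.top Xo_sets] by (intro null_setsI) auto
    then have "AE x in \<mu>. x \<notin> X - Xo" by (rule AE_not_in)
    then show "AE x in \<mu>. x \<in> s False -` ?B \<inter> X \<longleftrightarrow> x \<in> s True -` A \<inter> X"
      using AE_space by eventually_elim (auto simp: E_s_False s_in)
    show "s False -` ?B \<inter> X \<in> sets \<mu>" using measurable_sets[OF s_meas B] by simp
    show "s True -` A \<inter> X \<in> sets \<mu>" using measurable_sets[OF s_meas Suc.prems] by simp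
  qed
  ultimately have "2 * (prob ?B - prob A) = prob (E -` ?A' \<inter> X) - prob ?A'"
    using self_similar_measure[OF B] self_similar_measure[OF Suc.prems] by simp
  then have "\<bar>2 * (prob ?B - prob A)\<bar> \<le> 1 / 2 ^ k" using Suc.IH[OF A'] by simp
  then show ?case by (simp add: abs_mult)
qed

lemma invariant: "invariant_borel_prob X E \<mu>"
proof -
  have "emeasure (distr \<mu> \<mu> E) A = emeasure \<mu> A" if A: "A \<in> sets \<mu>" for A
  proof -
    have "(\<lambda>k. 1 / 2 ^ k :: real) \<longlonglongrightarrow> 0" by (intro LIMSEQ_divide_realpow_zero) simp
    then have "\<bar>prob (E -` A \<inter> X) - prob A\<bar> \<le> 0"
      by (rule LIMSEQ_le_const) (use E_preimage_close[OF A] in auto)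
    then show ?thesis using A by (simp add: emeasure_distr emeasure_eq_measure)
  qed
  then show ?thesis unfolding invariant_borel_prob_def
    using sets_mu prob by (auto intro: measure_eqI)
qed

lemma uniquely_ergodic: "uniquely_ergodic_with X E \<mu>"
  unfolding uniquely_ergodic_with_def
proof (intro allI iffI)
  fix \<nu> :: "'a measure" assume inv: "invariant_borel_prob X E \<nu>"
  then have sets: "sets \<nu> = sets (borel_on X)" and pr: "prob_space \<nu>"
    and [measurable]: "E \<in> measurable \<nu> \<nu>" and dist: "distr \<nu> \<nu> E = \<nu>"
    by (auto simp: invariant_borel_prob_def)
  interpret N: prob_space \<nu> by (rule pr)
  have sp [simp]: "space \<nu> = X" using sets_eq_imp_space_eq[OF sets] by simp
  have Em: "(E ^^ i) \<in> measurable \<nu> \<nu>" for i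
      by (induction i) (auto simp: id_def intro: measurable_comp)
  have Ed: "distr \<nu> \<nu> (E ^^ i) = \<nu>" for i
  proof (induction i)
    case (Suc i)
    have "distr \<nu> \<nu> (E ^^ Suc i) = distr (distr \<nu> \<nu> (E ^^ i)) \<nu> E"
      by (subst distr_distr) (auto simp: Em)
    then show ?case unfolding Suc dist .
  qed (simp add: id_def distr_id2)
  show "\<nu> = \<mu>"
  proof (rule borel_on_measure_eqI[OF pr prob sets sets_mu])
    show "closed X" using compact_X by (rule compact_imp_closed)
    fix f :: "'a \<Rightarrow> real" assume f: "continuous_on X f"
    obtain M where M: "M \<ge> 0" "\<And>x. x \<in> X \<Longrightarrow> \<bar>f x\<bar> \<le> M" using cont_bounded[OF f] by blast
    have fm: "f \<in> borel_measurable \<nu>"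
      unfolding measurable_cong_sets[OF sets refl] by (rule continuous_on_borel_on[OF f])
    have fEm: "(\<lambda>x. f ((E ^^ i) x)) \<in> borel_measurable \<nu>" for i
      using measurable_comp[OF Em fm] by (simp add: o_def)
    have fE: "integrable \<nu> (\<lambda>x. f ((E ^^ i) x))" for i
      using M funE_in fEm by (intro N.integrable_const_bound[where B = M]) auto
    have int: "(\<integral>x. f ((E ^^ i) x) \<partial>\<nu>) = integral\<^sup>L \<nu> f" for i
      using integral_distr[OF Em fm, of i] unfolding Ed by simp
    \<comment> \<open>At n = 0 the average is 0 by the convention for division, so that index is
      excluded and the sequence is only eventually constant.\<close>
    have avg: "(\<integral>x. (\<Sum>i<n. f ((E ^^ i) x)) / real n \<partial>\<nu>) = integral\<^sup>L \<nu> f" if "n > 0" for n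
      using that by (simp add: Bochner_Integration.integral_sum fE int)
    have "(\<lambda>n. \<integral>x. (\<Sum>i<n. f ((E ^^ i) x)) / real n \<partial>\<nu>) \<longlonglongrightarrow> (\<integral>x. integral\<^sup>L \<mu> f \<partial>\<nu>)"
    proof (rule integral_dominated_convergence[where w = "\<lambda>_. M"])
      show "AE x in \<nu>. (\<lambda>n. (\<Sum>i<n. f ((E ^^ i) x)) / real n) \<longlonglongrightarrow> integral\<^sup>L \<mu> f"
        using orbit_average[OF f] by (intro AE_I2) auto
      show "AE x in \<nu>. norm ((\<Sum>i<n. f ((E ^^ i) x)) / real n) \<le> M" for n
      proof (intro AE_I2)
        fix x assume "x \<in> space \<nu>"
        then have "norm (\<Sum>i<n. f ((E ^^ i) x)) \<le> real n * M"
          using sum_norm_bound[of "{..<n}" "\<lambda>i. f ((E ^^ i) x)" M] M funE_in by auto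
        then show "norm ((\<Sum>i<n. f ((E ^^ i) x)) / real n) \<le> M"
          using M(1) by (cases "n = 0") (auto simp: field_simps)
      qed
    qed (use fEm in auto)
    moreover have "(\<lambda>n. \<integral>x. (\<Sum>i<n. f ((E ^^ i) x)) / real n \<partial>\<nu>) \<longlonglongrightarrow> integral\<^sup>L \<nu> f"
      by (intro tendsto_eventually eventually_mono[OF eventually_gt_at_top[of 0] avg])
    ultimately show "integral\<^sup>L \<nu> f = integral\<^sup>L \<mu> f"
      using LIMSEQ_unique N.prob_space by fastforce
  qed
qed (use invariant in simp)

end

section \<open>Coordinate formulas for \<open>\<psi>\<close> and \<open>\<tau>\<close>\<close>

definition idx :: "'n::{finite,wellorder} \<Rightarrow> nat" where
  "idx k = card {j. j \<le> k}"

lemma idx_less: "i < j \<Longrightarrow> idx i < idx j"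
  unfolding idx_def by (rule psubset_card_mono) (auto simp: psubset_eq set_eq_iff intro!: exI[of _
      j])

lemma idx_le_iff: "idx i \<le> idx j \<longleftrightarrow> i \<le> j"
  by (metis idx_less leD leI linorder_le_less_linear order_le_less)

lemma idx_inj: "inj idx"
  by (metis injI idx_less less_irrefl linorder_neqE)

lemma idx_range: "1 \<le> idx i" "idx i \<le> CARD('n)" for i :: "'n::{finite,wellorder}"
proof -
  have "i \<in> {j. j \<le> i}" by simp
  then show "1 \<le> idx i" unfolding idx_def
      by (metis Suc_leI card_gt_0_iff empty_iff finite One_nat_def)
  show "idx i \<le> CARD('n)" unfolding idx_def by (rule card_mono) auto
qed

lemma idx_bij: "bij_betw idx (UNIV :: 'n::{finite,wellorder} set) {1..CARD('n)}"
proof -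
  have "idx ` (UNIV :: 'n set) \<subseteq> {1..CARD('n)}" using idx_range by auto
  moreover have "card (idx ` (UNIV :: 'n set)) = card {1..CARD('n)}"
    using card_image[OF idx_inj] by simp
  ultimately show ?thesis using idx_inj by (simp add: bij_betw_def card_subset_eq)
qed

lemma idx_Min: "idx (Min (UNIV :: 'n::{finite,wellorder} set)) = 1"
proof -
  have "{j::'n. j \<le> Min UNIV} = {Min UNIV}" by (auto intro: antisym)
  then show ?thesis by (simp add: idx_def)
qed

lemma pos_Some [simp]: "pos (Some i) = idx i"
  and pos_None [simp]: "pos (None :: 'n::{finite,wellorder} option) = Suc CARD('n)"
  by (simp_all add: pos_def idx_def)

lemma pos_bij: "bij_betw pos (UNIV :: 'n::{finite,wellorder} option set) {1..Suc CARD('n)}"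
proof -
  have "bij_betw pos (range (Some :: 'n \<Rightarrow> _)) {1..CARD('n)}"
    using idx_bij by (auto simp: bij_betw_def inj_on_def image_image)
  moreover have "bij_betw pos {None :: 'n option} {Suc CARD('n)}" by (simp add: bij_betw_def)
  ultimately have "bij_betw pos (range (Some :: 'n \<Rightarrow> _) \<union> {None}) ({1..CARD('n)} \<union> {Suc CARD('n)})"
    by (intro bij_betw_combine) auto
  moreover have "range (Some :: 'n \<Rightarrow> _) \<union> {None} = UNIV" by (auto simp: UNIV_option_conv)
  moreover have "{1..CARD('n)} \<union> {Suc CARD('n)} = {1..Suc CARD('n)}" by auto
  ultimately show ?thesis by simp
qed

definition unpos :: "nat \<Rightarrow> 'n::{finite,wellorder} option" where
  "unpos = the_inv_into UNIV pos"

lemma unpos_pos [simp]: "unpos (pos i) = i"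
  unfolding unpos_def using pos_bij by (auto intro!: the_inv_into_f_f simp: bij_betw_def)

text \<open>Summing over the positions 1, ..., n + 1 instead of the index type makes shifts and
  telescoping available.\<close>

lemma matrix_vector_pos:
  "((\<chi> i j. m (pos i) (pos j)) *v y) $ i = (\<Sum>r=1..Suc CARD('n). m (pos i) r * y $ unpos r)"
  for y :: "real^('n::{finite,wellorder} option)"
proof -
  have "((\<chi> i j. m (pos i) (pos j)) *v y) $ i
      = (\<Sum>j\<in>(UNIV :: 'n option set). m (pos i) (pos j) * y $ unpos (pos j))"
    by (simp add: matrix_vector_mult_def)
  also have "\<dots> = (\<Sum>r=1..Suc CARD('n). m (pos i) r * y $ unpos r)"
    by (rule sum.reindex_bij_betw[OF pos_bij])
  finally show ?thesis .
qed

lemma homog_None [simp]: "homog \<alpha> $ None = 1" and homog_Some [simp]: "homog \<alpha> $ Some i = \<alpha> $ i"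
  by (simp_all add: homog_def)

text \<open>\<open>crd \<alpha>\<close> extends the coordinates by the boundary values \<open>\<alpha>\<^sub>0 = 1\<close> and \<open>\<alpha>\<^sub>n\<^sub>+\<^sub>1 = 0\<close>.\<close>

definition hcrd :: "real^('n::{finite,wellorder} option) \<Rightarrow> nat \<Rightarrow> real" where
  "hcrd y k = (if k = 0 then y $ None else if k \<le> CARD('n) then y $ unpos k else 0)"

definition crd :: "real^'n::{finite,wellorder} \<Rightarrow> nat \<Rightarrow> real" where
  "crd \<alpha> = hcrd (homog \<alpha>)"

lemma hcrd_simps [simp]: "hcrd y 0 = y $ None" "hcrd y (idx i) = y $ Some i" "CARD('n) < k \<Longrightarrow>
    hcrd y k = 0"
  for y :: "real^('n::{finite,wellorder} option)"
  using idx_range[of i] unpos_pos[of "Some i"] by (auto simp: hcrd_def simp del: unpos_pos)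

lemma crd_simps [simp]: "crd \<alpha> 0 = 1" "crd \<alpha> (idx i) = \<alpha> $ i" "CARD('n) < k \<Longrightarrow> crd \<alpha> k = 0"
  for \<alpha> :: "real^'n::{finite,wellorder}"
  by (simp_all add: crd_def)

text \<open>The candidate for \<open>V\<^sup>-\<^sup>1 y\<close>: multiplying by \<open>V\<close> telescopes these differences.\<close>

definition bary :: "real^('n::{finite,wellorder} option) \<Rightarrow> real^('n option)" where
  "bary y = (\<chi> i. if pos i = 1 then hcrd y 0 - hcrd y 1
     else hcrd y (CARD('n) + 2 - pos i) - hcrd y (CARD('n) + 3 - pos i))"

lemma pos_unpos:
  assumes "r \<in> {1..Suc CARD('n)}"
  shows "pos (unpos r :: 'n::{finite,wellorder} option) = r"
proof -
  have "r \<in> range (pos :: 'n option \<Rightarrow> nat)"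
      using assms pos_bij[where 'n = 'n] by (simp add: bij_betw_def)
  then obtain i :: "'n option" where "r = pos i" by (rule rangeE)
  then show ?thesis by simp
qed

lemma bary_entry:
  fixes y :: "real^('n::{finite,wellorder} option)"
  shows "r \<in> {2..Suc CARD('n)} \<Longrightarrow> bary y $ unpos r
      = hcrd y (CARD('n) + 2 - r) - hcrd y (CARD('n) + 3 - r)"
    and "bary y $ unpos 1 = hcrd y 0 - hcrd y 1"
proof -
  show "bary y $ unpos 1 = hcrd y 0 - hcrd y 1"
    by (simp add: bary_def pos_unpos[of 1, simplified])
  assume r: "r \<in> {2..Suc CARD('n)}"
  then have "pos (unpos r :: 'n option) = r" by (intro pos_unpos) auto
  then show "bary y $ unpos r = hcrd y (CARD('n) + 2 - r) - hcrd y (CARD('n) + 3 - r)"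
    using r by (simp add: bary_def)
qed

lemma sum_reverse_telescope_2: "1 \<le> (m::nat) \<Longrightarrow> m \<le> n + 1 \<Longrightarrow>
    (\<Sum>r=2..m. g (n + 2 - r) - g (n + 3 - r)) = g (n + 2 - m) - (g (n + 1) :: real)"
proof (induction m rule: nat_induct_at_least)
  case (Suc m)
  then have "n + 3 - Suc m = n + 2 - m" by simp
  then show ?case using Suc by (simp add: sum.cl_ivl_Suc)
qed simp

lemma sum_bary: "1 \<le> m \<Longrightarrow> m \<le> CARD('n) + 1 \<Longrightarrow> (\<Sum>r=2..m. bary y $ unpos r) = hcrd y (CARD('n) + 2 - m)"
  for y :: "real^('n::{finite,wellorder} option)"
proof -
  assume m: "1 \<le> m" "m \<le> CARD('n) + 1"
  have "(\<Sum>r=2..m. bary y $ unpos r) = (\<Sum>r=2..m. hcrd y (CARD('n) + 2 - r) - hcrd y (CARD('n)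
      + 3 - r))"
    using m by (intro sum.cong refl bary_entry) auto
  also have "\<dots> = hcrd y (CARD('n) + 2 - m)" using sum_reverse_telescope_2[OF m, of "hcrd y"] by simp
  finally show ?thesis .
qed

lemma mat_V_entry:
  fixes c :: "real^('n::{finite,wellorder} option)"
  shows "(mat_V *v c) $ Some i = (\<Sum>r=2..CARD('n) + 2 - idx i. c $ unpos r)"
    and "(mat_V *v c) $ None = c $ unpos 1 + (\<Sum>r=2..CARD('n) + 1. c $ unpos r)"
proof -
  let ?n = "CARD('n)"
  let ?m = "\<lambda>p r. if p = ?n + 1 \<or> (r \<ge> 2 \<and> p + r \<le> ?n + 2) then 1 else 0 :: real"
  have V: "(mat_V :: real^('n option)^('n option)) = (\<chi> i j. ?m (pos i) (pos j))"
      by (simp add: mat_V_def)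
  have e: "(mat_V *v c) $ i = (\<Sum>r=1..Suc ?n. ?m (pos i) r * c $ unpos r)" for i
    unfolding V by (rule matrix_vector_pos[where m = ?m])
  have "(mat_V *v c) $ Some i = (\<Sum>r=1..Suc ?n. ?m (idx i) r * c $ unpos r)"
    unfolding e by simp
  also have "\<dots> = (\<Sum>r=2..?n + 2 - idx i. c $ unpos r)"
    using idx_range[of i] by (intro sum.mono_neutral_cong_right) auto
  finally show "(mat_V *v c) $ Some i = (\<Sum>r=2..?n + 2 - idx i. c $ unpos r)" .
  have "(mat_V *v c) $ None = (\<Sum>r=1..Suc ?n. c $ unpos r)"
    unfolding e by simp
  then show "(mat_V *v c) $ None = c $ unpos 1 + (\<Sum>r=2..?n + 1. c $ unpos r)"
    by (simp add: sum.atLeast_Suc_atMost numeral_2_eq_2)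
qed

lemma mat_V_bary: "mat_V *v bary y = y"
proof -
  have "(mat_V *v bary y) $ i = y $ i" for i
  proof (cases i)
    case None
    then show ?thesis using bary_entry(2)[of y] by (simp only: mat_V_entry sum_bary) simp
  next
    case (Some k)
    then show ?thesis using idx_range[of k] by (simp only: mat_V_entry) (subst sum_bary, auto)
  qed
  then show ?thesis by (simp add: vec_eq_iff)
qed

text \<open>A right inverse on vectors makes a square matrix invertible, and its inverse must agree
  with \<open>bary\<close>.\<close>

lemma matrix_inv_V: "matrix_inv mat_V *v y = bary y"
proof -
  have "surj ((*v) (mat_V :: real^('a option)^('a option)))" by (metis mat_V_bary surjI)
  then have "invertible (mat_V :: real^('a option)^('a option))"
    by (simp add: invertible_right_inverse matrix_right_invertible_surjective)
  then have "matrix_inv mat_V ** mat_V = (mat 1 :: real^('a option)^('a option))"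
    unfolding matrix_inv_def invertible_def by (rule someI_ex[THEN conjunct2])
  then have "bary y = matrix_inv mat_V *v (mat_V *v bary y)" by (simp add: matrix_vector_mul_assoc)
  then show ?thesis by (simp add: mat_V_bary)
qed

text \<open>h = 1 gives the projective maps and h = 1/2 the affine ones, so one computation serves
  both.\<close>

definition mat_h :: "real \<Rightarrow> bool \<Rightarrow> real^('n::{finite,wellorder} option)^('n option)" where
  "mat_h h a = (\<chi> i j. if (pos i, pos j) \<in> {(1, CARD('n) + 1), (2, CARD('n) + 1)}
                     then h else mat_A a $ i $ j)"

lemma mat_A_h: "mat_A a = mat_h 1 a" and mat_B_h: "mat_B a = mat_h (1 / 2) a"
  by (auto simp: mat_B_def mat_A_def mat_h_def vec_eq_iff)

lemma mat_h_entry: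
  fixes c :: "real^('n::{finite,wellorder} option)"
  shows "(mat_h h a *v c) $ unpos 1 = (if a then 0 else c $ unpos 1) + h * c $ unpos (CARD('n) + 1)"
    and "(mat_h h a *v c) $ unpos 2 = (if a then c $ unpos 1 else 0) + h * c $ unpos (CARD('n) + 1)"
    and "p \<in> {3..CARD('n) + 1} \<Longrightarrow> (mat_h h a *v c) $ unpos p = c $ unpos (p - 1)"
proof -
  let ?n = "CARD('n)"
  let ?m = "\<lambda>p r. if (p, r) \<in> {(1, ?n + 1), (2, ?n + 1)} then h else
     if (p, r) \<in> {(if a then 2 else 1, 1)} \<union> {(k + 1, k) | k. 2 \<le> k \<and> k \<le> ?n} then 1 else 0 :: real"
  have M: "(mat_h h a :: real^('n option)^('n option)) = (\<chi> i j. ?m (pos i) (pos j))"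
      by (auto simp: mat_h_def mat_A_def vec_eq_iff)
  have e: "(mat_h h a *v c) $ unpos p = (\<Sum>r=1..Suc ?n. ?m p r * c $ unpos r)"
      if "p \<in> {1..Suc ?n}" for p
    unfolding M using matrix_vector_pos[where m = ?m and i = "unpos p :: 'n option" and y = c]
    unfolding pos_unpos[OF that] .
  have n: "1 \<le> ?n" using idx_range by (metis order_trans)
  have 12: "(\<Sum>r=1..Suc ?n. ?m p r * c $ unpos r)
      = (\<Sum>r\<in>{1, Suc ?n}. ?m p r * c $ unpos r)" if "p \<in> {1, 2}" for p
    using that by (intro sum.mono_neutral_right) auto
  show "(mat_h h a *v c) $ unpos 1 = (if a then 0 else c $ unpos 1) + h * c $ unpos (?n + 1)"
    using n by (intro trans[OF e trans[OF 12]]) auto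
  show "(mat_h h a *v c) $ unpos 2 = (if a then c $ unpos 1 else 0) + h * c $ unpos (?n + 1)"
    using n by (intro trans[OF e trans[OF 12]]) auto
  show "(mat_h h a *v c) $ unpos p = c $ unpos (p - 1)" if "p \<in> {3..?n + 1}"
  proof -
    have "(\<Sum>r=1..Suc ?n. ?m p r * c $ unpos r) = (\<Sum>r\<in>{p - 1}. ?m p r * c $ unpos r)"
      using that by (intro sum.mono_neutral_right) auto
    also have "\<dots> = c $ unpos (p - 1)" using that by (auto intro!: exI[of _ "p - 1"])
    finally show ?thesis using that by (subst e) auto
  qed
qed

text \<open>The row shift of \<open>mat_h\<close> becomes a coordinate shift after telescoping. The
  last entry is 1 for h = 1/2, so that \<open>tau\<close> is affine, and 1 + \<alpha>_1 - \<alpha>_2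
  for h = 1, the denominator of \<open>psi\<close>.\<close>

lemma mat_V_h:
  fixes \<alpha> :: "real^'n::{finite,wellorder}" and h :: real and a :: bool
  defines "y \<equiv> (mat_V ** mat_h h a ** matrix_inv mat_V) *v homog \<alpha>"
  shows "y $ Some i = (if a then 1 - crd \<alpha> 1 else 0) + h * (crd \<alpha> 1 - crd \<alpha> 2)
      + crd \<alpha> (Suc (idx i))"
    and "y $ None = 1 - crd \<alpha> 1 + 2 * h * (crd \<alpha> 1 - crd \<alpha> 2) + crd \<alpha> 2"
proof -
  let ?n = "CARD('n)" and ?c = "bary (homog \<alpha>)" and ?c' = "mat_h h a *v bary (homog \<alpha>)"
  have n: "1 \<le> ?n" using idx_range by (metis order_trans)
  have y: "y = mat_V *v ?c'" by (simp add: y_def matrix_inv_V flip: matrix_vector_mul_assoc)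
  have 1: "?c' $ unpos 1 = (if a then 0 else 1 - crd \<alpha> 1) + h * (crd \<alpha> 1 - crd \<alpha> 2)"
    and 2: "?c' $ unpos 2 = (if a then 1 - crd \<alpha> 1 else 0) + h * (crd \<alpha> 1 - crd \<alpha> 2)"
    using bary_entry(1)[of "?n + 1" "homog \<alpha>"] bary_entry(2)[of "homog \<alpha>"] n
      mat_h_entry(1,2)[of h a ?c]
    by (simp_all add: crd_def) 
  have S: "(\<Sum>r=2..m. ?c' $ unpos r) = ?c' $ unpos 2 + crd \<alpha> (?n + 3 - m)"
      if m: "m \<in> {2..?n + 1}" for m
  proof -
    have "(\<Sum>r=2..m. ?c' $ unpos r) = ?c' $ unpos 2 + (\<Sum>r=3..m. ?c' $ unpos r)"
      using m by (simp add: sum.atLeast_Suc_atMost numeral_3_eq_3 numeral_2_eq_2)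
    also have "(\<Sum>r=3..m. ?c' $ unpos r) = (\<Sum>r=3..m. ?c $ unpos (r - 1))"
      using m by (intro sum.cong) (auto simp: mat_h_entry)
    also have "\<dots> = (\<Sum>r=2..m - 1. ?c $ unpos r)"
      using m by (intro sum.reindex_bij_witness[of _ "\<lambda>r. r + 1" "\<lambda>r. r - 1"]) auto
    also have "\<dots> = crd \<alpha> (?n + 3 - m)" using m
        by (subst sum_bary) (auto simp: crd_def Suc_diff_le numeral_3_eq_3)
    finally show ?thesis .
  qed
  show "y $ Some i = (if a then 1 - crd \<alpha> 1 else 0) + h * (crd \<alpha> 1 - crd \<alpha> 2) + crd \<alpha> (Suc (idx i))"
  proof -
    have eq: "?n + 3 - (?n + 2 - idx i) = Suc (idx i)" and "?n + 2 - idx i \<in> {2..?n + 1}"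
      using idx_range[of i] by auto
    then show ?thesis unfolding y mat_V_entry using S[of "?n + 2 - idx i"] 2 by simp
  qed
  show "y $ None = 1 - crd \<alpha> 1 + 2 * h * (crd \<alpha> 1 - crd \<alpha> 2) + crd \<alpha> 2"
    unfolding y mat_V_entry using S[of "?n + 1"] 1 2 n by (cases a) (simp_all add: algebra_simps)
qed

lemma homog_eq_iff: "homog \<alpha> = y \<longleftrightarrow> y $ None = 1 \<and> (\<forall>i. \<alpha> $ i = y $ Some i)"
  by (auto simp: vec_eq_iff split_option_all homog_def split: option.splits)

lemma tau_nth:
  "tau a \<alpha> $ i = (if a then 1 - crd \<alpha> 1 else 0) + (crd \<alpha> 1 - crd \<alpha> 2) / 2 + crd \<alpha> (Suc (idx i))"
proof -
  let ?y = "mat_D a *v homog \<alpha>"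
  have y: "?y $ None = 1"
    "?y $ Some i = (if a then 1 - crd \<alpha> 1 else 0) + (crd \<alpha> 1 - crd \<alpha> 2) / 2
        + crd \<alpha> (Suc (idx i))" for i
    unfolding mat_D_def mat_B_h using mat_V_h[of "1/2" a \<alpha>] by (simp_all add: field_simps)
  have "tau a \<alpha> = (\<chi> i. ?y $ Some i)" unfolding tau_def
  proof (rule the_equality)
    show "?y = homog (\<chi> i. ?y $ Some i)" using y(1) by (subst eq_commute) (simp add: homog_eq_iff)
    show "\<beta> = (\<chi> i. ?y $ Some i)" if "?y = homog \<beta>" for \<beta> using that by (simp add: vec_eq_iff)
  qed
  then show ?thesis by (simp add: y)
qed

lemma psi_nth:
  assumes pos: "1 + crd \<alpha> 1 - crd \<alpha> 2 > 0"
  shows "psi a \<alpha> $ i = ((if a then 1 - crd \<alpha> 1 else 0) + (crd \<alpha> 1 - crd \<alpha> 2) + crd \<alpha> (Suc (idx i)))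
     / (1 + crd \<alpha> 1 - crd \<alpha> 2)"
proof -
  let ?y = "mat_C a *v homog \<alpha>" and ?d = "1 + crd \<alpha> 1 - crd \<alpha> 2"
  have y: "?y $ None = ?d"
    "?y $ Some i = (if a then 1 - crd \<alpha> 1 else 0) + (crd \<alpha> 1 - crd \<alpha> 2) + crd \<alpha> (Suc (idx i))" for i
    unfolding mat_C_def mat_A_h using mat_V_h[of 1 a \<alpha>] by (simp_all add: field_simps)
  have "psi a \<alpha> = (\<chi> i. ?y $ Some i / ?d)" unfolding psi_def
  proof (rule the_equality)
    show "\<exists>c>0. homog (\<chi> i. ?y $ Some i / ?d) = c *\<^sub>R ?y"
      using pos y(1) by (intro exI[of _ "1 / ?d"]) (simp add: homog_eq_iff)
    show "\<beta> = (\<chi> i. ?y $ Some i / ?d)" if "\<exists>c>0. homog \<beta> = c *\<^sub>R ?y" for \<beta>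
    proof -
      from that obtain c where c: "homog \<beta> = c *\<^sub>R ?y" by blast
      have "1 = c * ?d" using arg_cong[OF c, of "\<lambda>v. v $ None"] y(1) by simp
      then have "c = 1 / ?d" using pos by (simp add: field_simps)
      then show ?thesis using c unfolding homog_eq_iff by (simp add: vec_eq_iff)
    qed
  qed
  then show ?thesis by (simp add: y)
qed

section \<open>Contraction of repeated bisection\<close>

text \<open>
  A list holds the values of an affine function at \<open>v\<^sub>0, \<dots>, v\<^sub>n\<close>; composing with \<open>\<tau>\<^sub>a\<close> bisects
  the edge \<open>v\<^sub>0v\<^sub>1\<close>, keeps one of its ends in front, and appends the midpoint value.
\<close>

fun bisect :: "bool \<Rightarrow> real list \<Rightarrow> real list" where
  "bisect a (x # y # xs) = (if a then y else x) # xs @ [(x + y) / 2]"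
| "bisect a xs = xs"

lemma length_bisect [simp]: "length (bisect a xs) = length xs"
  by (induction a xs rule: bisect.induct) auto

lemma bisect_range:
  assumes "set xs \<subseteq> {l..h}" shows "set (bisect a xs) \<subseteq> {l..h}"
  using assms by (induction a xs rule: bisect.induct) auto

definition run :: "bool list \<Rightarrow> real list \<Rightarrow> real list" where
  "run us xs = foldl (\<lambda>xs a. bisect a xs) xs us"

lemma run_Nil [simp]: "run [] xs = xs"
  and run_Cons: "run (a # us) xs = run us (bisect a xs)"
  and run_append: "run (us @ ws) xs = run ws (run us xs)"
  by (simp_all add: run_def)

lemma length_run [simp]: "length (run us xs) = length xs"
  by (induction us arbitrary: xs) (auto simp: run_Cons)

lemma run_range: "set xs \<subseteq> {l..h} \<Longrightarrow> set (run us xs) \<subseteq> {l..h}"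
  by (induction us arbitrary: xs) (auto simp: run_Cons bisect_range)

text \<open>A round lets the front value meet every other entry once; \<open>anchor\<close> is what
  is left in front, and \<open>means\<close> lists the midpoints produced on the way.\<close>

fun anchor :: "real \<Rightarrow> real list \<Rightarrow> bool list \<Rightarrow> real" where
  "anchor y (z # zs) (u # us) = anchor (if u then z else y) zs us"
| "anchor y _ _ = y"

fun means :: "real \<Rightarrow> real list \<Rightarrow> bool list \<Rightarrow> real list" where
  "means y (z # zs) (u # us) = (y + z) / 2 # means (if u then z else y) zs us"
| "means _ _ _ = []"

text \<open>D stands for midpoints already appended; the round ends when zs is used up, before any
  of them is met.\<close>

lemma run_round: "length us = length zs \<Longrightarrow> run us (y # zs @ D) = anchor y zs us # D @ means y zs us"
  by (induction y zs us arbitrary: D rule: means.induct) (auto simp: run_Cons)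

text \<open>
  Values at distance at least \<open>e\<close> from both ends of \<open>[l, h]\<close> are counted. Over a full round of
  bisections this count (with \<open>e\<close> halved) cannot drop, and it grows as long as both ends are
  represented, because then at some point the anchor is averaged with a value of another kind.
\<close>

definition inner_count :: "real \<Rightarrow> real \<Rightarrow> real \<Rightarrow> real list \<Rightarrow> nat" where
  "inner_count l h e xs = length (filter (\<lambda>x. l + e \<le> x \<and> x \<le> h - e) xs)"

lemma inner_count_round:
  assumes "length us = length zs" "set (y # zs) \<subseteq> {l..h}" "0 < e" "2 * e \<le> h - l"
  shows "inner_count l h e (y # zs) \<le> inner_count l h (e / 2) (anchor y zs us # means y zs us)
    \<and> ((\<exists>x\<in>set (y # zs). x < l + e) \<and> (\<exists>x\<in>set (y # zs). h - e < x) \<longrightarrow>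
       inner_count l h e (y # zs) < inner_count l h (e / 2) (anchor y zs us # means y zs us))"
  using assms
proof (induction y zs us rule: means.induct)
  case (1 y z zs u us)
  define y' where "y' = (if u then z else y)"
  \<comment> \<open>Of the pair y, z the value y' stays in front and w is dropped; in the count the
    midpoint takes the place of w.\<close>
  define w where "w = (if u then y else z)"
  define c where "c = (\<lambda>e x. if l + e \<le> x \<and> x \<le> h - e then 1 else 0 :: nat)"
  have cnt: "inner_count l h e (x # xs) = c e x + inner_count l h e xs" for e x xs
    by (auto simp: inner_count_def c_def)
  have rng: "y \<in> {l..h}" "z \<in> {l..h}" "y' \<in> {l..h}" "w \<in> {l..h}"
      using 1(3) by (auto simp: y'_def w_def)
  have IH: "inner_count l h e (y' # zs)
      \<le> inner_count l h (e / 2) (anchor y' zs us # means y' zs us)"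
    "(\<exists>x\<in>set (y' # zs). x < l + e) \<Longrightarrow> (\<exists>x\<in>set (y' # zs). h - e < x) \<Longrightarrow>
       inner_count l h e (y' # zs) < inner_count l h (e / 2) (anchor y' zs us # means y' zs us)"
    using 1(1)[folded y'_def] 1(2-) by (auto simp: y'_def)
  have mean: "(y + z) / 2 = (y' + w) / 2" by (simp add: y'_def w_def)
  have sum: "inner_count l h e (y # z # zs) = c e w + inner_count l h e (y' # zs)"
    by (simp add: cnt y'_def w_def)
  have out: "inner_count l h (e / 2) (anchor y (z # zs) (u # us) # means y (z # zs) (u # us))
     = c (e / 2) ((y' + w) / 2) + inner_count l h (e / 2) (anchor y' zs us # means y' zs us)"
    by (simp only: means.simps anchor.simps y'_def[symmetric] mean cnt add.left_commute)
  have set: "set (y # z # zs) = insert w (set (y' # zs))" by (auto simp: y'_def w_def)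
  \<comment> \<open>Averaging with a value in [l, h] at worst halves the distance to each
    end.\<close>
  have le: "c e w \<le> c (e / 2) ((y' + w) / 2)"
    using rng 1(4,5) by (auto simp: c_def field_simps)
  \<comment> \<open>Here w itself is not counted, and y' pulls the midpoint off the end near w; the
    condition 2 e \<le> h - l keeps it off the other end.\<close>
  have lt: "c e w < c (e / 2) ((y' + w) / 2)"
    if "w < l + e \<and> \<not> y' < l + e \<or> h - e < w \<and> \<not> h - e < y'"
    using that rng 1(4,5) by (auto simp: c_def field_simps)
  show ?case
  proof (intro conjI impI)
    show "inner_count l h e (y # z # zs)
      \<le> inner_count l h (e / 2) (anchor y (z # zs) (u # us) # means y (z # zs) (u # us))"
      unfolding sum out using le IH(1) by simp
    assume both: "(\<exists>x\<in>set (y # z # zs). x < l + e) \<and> (\<exists>x\<in>set (y # z # zs). h - e < x)"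
    show "inner_count l h e (y # z # zs)
      < inner_count l h (e / 2) (anchor y (z # zs) (u # us) # means y (z # zs) (u # us))"
    proof (cases "(\<exists>x\<in>set (y' # zs). x < l + e) \<and> (\<exists>x\<in>set (y' # zs). h - e < x)")
      case True
      then show ?thesis unfolding sum out using le IH(2) by simp
    next
      case False
      \<comment> \<open>One end is no longer represented, so w was its last representative and y' is
        not near it.\<close>
      then have "w < l + e \<and> \<not> y' < l + e \<or> h - e < w \<and> \<not> h - e < y'"
        using both unfolding set by auto
      then show ?thesis unfolding sum out using lt IH(1) by simp
    qed
  qed
qed (auto simp: inner_count_def)

text \<open>While both ends are represented, every round adds an inner value; once an end is
  abandoned, averaging never returns to it.\<close>

lemma run_rounds:
  assumes "set xs \<subseteq> {l..h}" "length xs = Suc n" "0 < e" "2 * e \<le> h - l" "length us = k * n"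
  shows "set (run us xs) \<subseteq> {l + e / 2 ^ k..h} \<or> set (run us xs) \<subseteq> {l..h - e / 2 ^ k}
    \<or> k \<le> inner_count l h (e / 2 ^ k) (run us xs)"
  using assms(5)
proof (induction k arbitrary: us)
  case (Suc k)
  define vs ws where "vs = take (k * n) us" and "ws = drop (k * n) us"
  have us: "us = vs @ ws" "length vs = k * n" "length ws = n"
      using Suc.prems by (auto simp: vs_def ws_def)
  let ?e = "e / 2 ^ k" and ?xs = "run vs xs"
  have rng: "set ?xs \<subseteq> {l..h}" using assms(1) by (rule run_range)
  have "e / 2 ^ k \<le> e / 1" using assms(3) by (intro divide_left_mono) auto
  then have e: "0 < ?e" "2 * ?e \<le> h - l" using assms(3,4) by auto
  have half: "e / 2 ^ Suc k = ?e / 2" by simp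
  obtain y zs where y: "?xs = y # zs" "length zs = n"
      using length_run[of vs xs] assms(2) by (cases ?xs) auto
  have r: "run us xs = anchor y zs ws # means y zs ws"
    using run_round[of ws zs y "[]"] us y by (simp add: run_append)
  have *: "run us xs = run ws ?xs" by (simp add: us run_append)
  consider "set ?xs \<subseteq> {l + ?e..h}" | "set ?xs \<subseteq> {l..h - ?e}"
    | "k \<le> inner_count l h ?e ?xs" "\<not> set ?xs \<subseteq> {l + ?e..h}" "\<not> set ?xs \<subseteq> {l..h - ?e}"
    using Suc.IH[OF us(2)] by blast
  then show ?case
  proof cases
    case 1
    then have "set (run us xs) \<subseteq> {l + ?e..h}" unfolding * by (rule run_range)
    then show ?thesis using e half by fastforce
  next
    case 2
    then have "set (run us xs) \<subseteq> {l..h - ?e}" unfolding * by (rule run_range)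
    then show ?thesis using e half by fastforce
  next
    case 3
    have "inner_count l h ?e (y # zs) < inner_count l h (?e / 2) (anchor y zs ws # means y zs ws)"
      using inner_count_round[of ws zs y l h ?e] us y rng e 3(2,3) by fastforce
    then show ?thesis using 3(1) unfolding half r y by simp
  qed
qed simp

text \<open>After n + 1 rounds the third alternative of \<open>run_rounds\<close> makes all n + 1
  values inner. In every case one end has been cut by e/2^(n+1) with e = (h - l)/2, whence the
  factor.\<close>

lemma run_contracts:
  assumes "set xs \<subseteq> {l..h}" "length xs = Suc n" "length us = (n + 1) * n" "l \<le> h"
  shows "\<exists>l' h'. set (run us xs) \<subseteq> {l'..h'} \<and> l' \<le> h' \<and> h' - l' \<le> (1 - 1 / 2 ^ (n + 2)) * (h - l)"
proof (cases "l = h")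
  case True
  then show ?thesis using run_range[OF assms(1), of us] by (intro exI[of _ l] exI[of _ h]) auto
next
  case False
  let ?e = "(h - l) / 2"
  let ?f = "?e / 2 ^ (n + 1)"
  have e: "0 < ?e" "2 * ?e \<le> h - l" using False assms(4) by auto
  have "?f \<le> ?e / 1"
    using e one_le_power[of "2::real" "n + 1"] by (intro divide_left_mono) simp_all
  then have "?f \<le> h - l" using e by linarith
  moreover have "?f = (h - l) / 2 ^ (n + 2)" by simp
  moreover have "0 < ?f" using e by (intro divide_pos_pos) auto
  ultimately have f: "?f = (h - l) / 2 ^ (n + 2)" "?f \<le> h - l" "0 < ?f" by blast+
  have "set (run us xs) \<subseteq> {l + ?f..h} \<or> set (run us xs) \<subseteq> {l..h - ?f}"
  proof -
    have "set (run us xs) \<subseteq> {l + ?f..h}" if "n + 1 \<le> inner_count l h ?f (run us xs)"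
    proof -
      have "length (run us xs) = length (filter (\<lambda>x. l + ?f \<le> x \<and> x \<le> h - ?f) (run us xs))"
        using that assms(2) length_filter_le[of "\<lambda>x. l + ?f \<le> x \<and> x \<le> h - ?f" "run us xs"]
        unfolding inner_count_def by simp
      then have "\<forall>x\<in>set (run us xs). l + ?f \<le> x \<and> x \<le> h - ?f"
        by (metis (no_types, lifting) filter_id_conv length_filter_less less_irrefl)
      then show ?thesis using f(3) by fastforce
    qed
    then show ?thesis using run_rounds[OF assms(1,2) e assms(3)] by blast
  qed
  then show ?thesis
  proof
    assume "set (run us xs) \<subseteq> {l + ?f..h}"
    then show ?thesis using f by (intro exI[of _ "l + ?f"] exI[of _ h]) (simp add: algebra_simps)
  next
    assume "set (run us xs) \<subseteq> {l..h - ?f}"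
    then show ?thesis using f by (intro exI[of _ l] exI[of _ "h - ?f"]) (simp add: algebra_simps)
  qed
qed

lemma run_contracts_pow:
  assumes "set xs \<subseteq> {l..h}" "length xs = Suc n" "k * ((n + 1) * n) \<le> length us" "l \<le> h"
  shows "\<exists>l' h'. set (run us xs) \<subseteq> {l'..h'} \<and> l' \<le> h' \<and> h' - l'
      \<le> (1 - 1 / 2 ^ (n + 2)) ^ k * (h - l)"
  using assms(3)
proof (induction k arbitrary: us)
  case 0
  then show ?case using run_range[OF assms(1), of us] assms(4)
      by (intro exI[of _ l] exI[of _ h]) auto
next
  case (Suc k)
  let ?c = "(1::real) - 1 / 2 ^ (n + 2)"
  let ?m = "(n + 1) * n"
  \<comment> \<open>xs' holds the letters beyond k + 1 full batches; they cannot enlarge the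
    range.\<close>
  define vs ws xs' where "vs = take (k * ?m) us" and "ws = take ?m (drop (k * ?m) us)"
    and "xs' = drop ?m (drop (k * ?m) us)"
  have us: "us = vs @ ws @ xs'" "length ws = ?m" "length vs = k * ?m" using Suc.prems
    by (simp_all add: vs_def ws_def xs'_def del: drop_drop)
  have c: "0 \<le> ?c" using one_le_power[of "2::real" "n + 2"] by (simp add: field_simps)
  obtain l1 h1 where 1: "set (run vs xs) \<subseteq> {l1..h1}" "l1 \<le> h1" "h1 - l1 \<le> ?c ^ k * (h - l)"
    using Suc.IH[of vs] us(3) by auto
  obtain l2 h2 where 2: "set (run ws (run vs xs)) \<subseteq> {l2..h2}" "l2 \<le> h2" "h2 - l2 \<le> ?c * (h1 - l1)"
    using run_contracts[OF 1(1) _ us(2) 1(2)] assms(2) by auto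
  have "?c * (h1 - l1) \<le> ?c * (?c ^ k * (h - l))" using 1(3) c by (intro mult_left_mono)
  then have "h2 - l2 \<le> ?c ^ Suc k * (h - l)" using 2(3) by (simp add: mult.assoc)
  moreover have "set (run us xs) \<subseteq> {l2..h2}" using run_range[OF 2(1)] by (simp add: us run_append)
  ultimately show ?case using 2(2) by blast
qed

section \<open>Geometry of the simplex\<close>

lemma card_n: "1 \<le> CARD('n::{finite,wellorder})"
  using idx_range by (metis order_trans)

lemma idx_ex: "k \<in> {1..CARD('n)} \<Longrightarrow> \<exists>i :: 'n::{finite,wellorder}. idx i = k"
  using idx_bij[where 'n = 'n] unfolding bij_betw_def by (metis imageE)

lemma crd_eqI:
  fixes \<alpha> \<beta> :: "real^'n::{finite,wellorder}"
  assumes "\<And>k. k \<in> {1..CARD('n)} \<Longrightarrow> crd \<alpha> k = crd \<beta> k"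
  shows "\<alpha> = \<beta>"
proof -
  have "\<alpha> $ i = \<beta> $ i" for i using assms[of "idx i"] idx_range[of i] by simp
  then show ?thesis by (simp add: vec_eq_iff)
qed

lemma crd_decI:
  fixes \<alpha> :: "real^'n::{finite,wellorder}"
  assumes "\<And>k. k \<le> CARD('n) \<Longrightarrow> crd \<alpha> (Suc k) \<le> crd \<alpha> k"
  shows "crd \<alpha> (Suc k) \<le> crd \<alpha> k"
  using assms[of k] by (cases "k \<le> CARD('n)") auto

text \<open>With the boundary values 1 and 0 built into \<open>crd\<close>, all the inequalities
  become a single monotonicity.\<close>

lemma Gam_iff: "\<alpha> \<in> Gam \<longleftrightarrow> (\<forall>k. crd \<alpha> (Suc k) \<le> crd \<alpha> k)"
  for \<alpha> :: "real^'n::{finite,wellorder}"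
proof
  assume \<alpha>: "\<alpha> \<in> Gam"
  show "\<forall>k. crd \<alpha> (Suc k) \<le> crd \<alpha> k"
  proof (rule allI, rule crd_decI)
    fix k assume k: "k \<le> CARD('n)"
    show "crd \<alpha> (Suc k) \<le> crd \<alpha> k"
    proof (cases "Suc k \<le> CARD('n)")
      case True
      then obtain i :: 'n where i: "idx i = Suc k" using idx_ex[of "Suc k"] by auto
      show ?thesis
      proof (cases "k = 0")
        case True
        then show ?thesis using \<alpha> crd_simps(2)[of \<alpha> i] i by (auto simp: Gam_def)
      next
        case False
        then obtain j :: 'n where j: "idx j = k" using idx_ex[of k] k by auto
        then have "j \<le> i" using i idx_le_iff[of j i] by simp
        then show ?thesis using \<alpha> crd_simps(2)[of \<alpha> i] crd_simps(2)[of \<alpha> j] i j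
            by (auto simp: Gam_def)
      qed
    next
      case False
      then have k: "k = CARD('n)" using k by simp
      then obtain j :: 'n where j: "idx j = k" using idx_ex[of k] card_n[where 'n = 'n] by auto
      then show ?thesis using \<alpha> crd_simps(2)[of \<alpha> j] k by (auto simp: Gam_def)
    qed
  qed
next
  assume "\<forall>k. crd \<alpha> (Suc k) \<le> crd \<alpha> k"
  then have dec: "crd \<alpha> l \<le> crd \<alpha> k" if "k \<le> l" for k l
    using lift_Suc_antimono_le[of "crd \<alpha>" k l] that by auto
  have "0 \<le> \<alpha> $ i \<and> \<alpha> $ i \<le> 1" for i
    using dec[of 0 "idx i"] dec[of "idx i" "Suc CARD('n)"] idx_range[of i] by simp
  moreover have "\<alpha> $ j \<le> \<alpha> $ i" if "i \<le> j" for i j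
    using dec[of "idx i" "idx j"] that by (simp add: idx_le_iff)
  ultimately show "\<alpha> \<in> Gam" by (auto simp: Gam_def)
qed

lemma Gam_antimono: "\<alpha> \<in> Gam \<Longrightarrow> k \<le> l \<Longrightarrow> crd \<alpha> l \<le> crd \<alpha> k"
  using lift_Suc_antimono_le[of "crd \<alpha>" k l] by (auto simp: Gam_iff)

lemma crd_range: "\<alpha> \<in> Gam \<Longrightarrow> 0 \<le> crd \<alpha> k" "\<alpha> \<in> Gam \<Longrightarrow> crd \<alpha> k \<le> 1"
  for \<alpha> :: "real^'n::{finite,wellorder}"
  using Gam_antimono[of \<alpha> k "k + Suc CARD('n)"] Gam_antimono[of \<alpha> 0 k] by auto

lemma Gam_o_iff: "\<alpha> \<in> Gam_o \<longleftrightarrow> \<alpha> \<in> Gam \<and> crd \<alpha> 1 < 1"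
  using crd_simps(2)[of \<alpha> "Min UNIV"] by (simp add: Gam_o_def idx_Min)

definition of_crd :: "(nat \<Rightarrow> real) \<Rightarrow> real^'n::{finite,wellorder}" where
  "of_crd f = (\<chi> i. f (idx i))"

lemma crd_of_crd: 
  assumes "k \<in> {1..CARD('n)}"
  shows "crd (of_crd f :: real^'n::{finite,wellorder}) k = f k"
proof -
  obtain i :: 'n where i: "idx i = k" using idx_ex[OF assms] by auto
  then show ?thesis using crd_simps(2)[of "of_crd f" i] by (simp add: of_crd_def)
qed

lemma crd_of_crd':
  assumes "f 0 = 1" "f (Suc CARD('n)) = 0" "k \<le> Suc CARD('n)"
  shows "crd (of_crd f :: real^'n::{finite,wellorder}) k = f k"
  using crd_of_crd[where 'n = 'n, of k f] assms by (cases "k = 0"; cases "k = Suc CARD('n)") auto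

lemma of_crd_Gam:
  assumes "f 0 = 1" "f (Suc CARD('n)) = 0" "\<And>k. k \<le> CARD('n) \<Longrightarrow> f (Suc k) \<le> f k"
  shows "(of_crd f :: real^'n::{finite,wellorder}) \<in> Gam"
  unfolding Gam_iff
  by (rule allI, rule crd_decI) (use crd_of_crd'[where 'n = 'n, of f] assms in auto)

section \<open>The maps \<open>tau\<close> and \<open>psi\<close> on the simplex\<close>

lemma crd_tau:
  fixes \<alpha> :: "real^'n::{finite,wellorder}"
  assumes "k \<in> {1..CARD('n)}"
  shows "crd (tau a \<alpha>) k = (if a then 1 - crd \<alpha> 1 else 0) + (crd \<alpha> 1 - crd \<alpha> 2) / 2 + crd \<alpha> (Suc k)"
  using idx_ex[OF assms] tau_nth[of a \<alpha>] by auto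

lemma psi_den: "\<alpha> \<in> Gam \<Longrightarrow> 1 \<le> 1 + crd \<alpha> 1 - crd \<alpha> 2"
  using Gam_antimono[of \<alpha> 1 2] by simp

lemma crd_psi:
  fixes \<alpha> :: "real^'n::{finite,wellorder}"
  assumes "\<alpha> \<in> Gam" "k \<in> {1..CARD('n)}"
  shows "crd (psi a \<alpha>) k = ((if a then 1 - crd \<alpha> 1 else 0) + (crd \<alpha> 1 - crd \<alpha> 2) + crd \<alpha> (Suc k))
     / (1 + crd \<alpha> 1 - crd \<alpha> 2)"
  using idx_ex[OF assms(2)] psi_nth[of \<alpha> a] psi_den[OF assms(1)] by auto

lemma tau_in: "\<alpha> \<in> Gam \<Longrightarrow> tau a \<alpha> \<in> Gam"
  for \<alpha> :: "real^'n::{finite,wellorder}"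
proof -
  assume \<alpha>: "\<alpha> \<in> Gam"
  have d: "crd \<alpha> 1 \<le> 1" "crd \<alpha> 2 \<le> crd \<alpha> 1" using crd_range[OF \<alpha>] Gam_antimono[OF \<alpha>] by auto
  show ?thesis unfolding Gam_iff
  proof (rule allI, rule crd_decI)
    fix k assume k: "k \<le> CARD('n)"
    consider "k = 0" | "1 \<le> k" "k < CARD('n)" | "1 \<le> k" "k = CARD('n)" using k by linarith
    then show "crd (tau a \<alpha>) (Suc k) \<le> crd (tau a \<alpha>) k"
    proof cases
      case 1
      have S: "Suc 1 = (2::nat)" by simp
      have "crd (tau a \<alpha>) 1 \<le> 1"
        using crd_tau[of 1 a \<alpha>] d card_n[where 'n = 'n]
            unfolding S by (cases a) (simp_all add: field_simps)
      then show ?thesis using 1 by simp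
    next
      case 2
      then show ?thesis using Gam_antimono[OF \<alpha>, of "Suc k" "Suc (Suc k)"] by (simp add: crd_tau)
    next
      case 3
      then show ?thesis using d by (simp add: crd_tau)
    qed
  qed
qed

lemma psi_in: "\<alpha> \<in> Gam \<Longrightarrow> psi a \<alpha> \<in> Gam"
  for \<alpha> :: "real^'n::{finite,wellorder}"
proof -
  assume \<alpha>: "\<alpha> \<in> Gam"
  have d: "crd \<alpha> 1 \<le> 1" "crd \<alpha> 2 \<le> crd \<alpha> 1" using crd_range[OF \<alpha>] Gam_antimono[OF \<alpha>] by auto
  note den = psi_den[OF \<alpha>]
  show ?thesis unfolding Gam_iff
  proof (rule allI, rule crd_decI)
    fix k assume k: "k \<le> CARD('n)"
    consider "k = 0" | "1 \<le> k" "k < CARD('n)" | "1 \<le> k" "k = CARD('n)" using k by linarith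
    then show "crd (psi a \<alpha>) (Suc k) \<le> crd (psi a \<alpha>) k"
    proof cases
      case 1
      then show ?thesis using d den card_n[where 'n = 'n] crd_psi[OF \<alpha>, of 1 a] 
        by (simp add: numeral_2_eq_2 divide_le_eq)
    next
      case 2
      then show ?thesis using Gam_antimono[OF \<alpha>, of "Suc k" "Suc (Suc k)"] den
        by (simp add: crd_psi[OF \<alpha>] divide_right_mono)
    next
      case 3
      then show ?thesis using d den by (simp add: crd_psi[OF \<alpha>])
    qed
  qed
qed

lemma tau_cover: "Gam \<subseteq> tau False ` Gam \<union> tau True ` (Gam :: (real^'n::{finite,wellorder}) set)"
proof
  fix \<beta> :: "real^'n::_" assume \<beta>: "\<beta> \<in> Gam"
  let ?n = "CARD('n)" and ?b = "crd \<beta>"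
  note n = card_n[where 'n = 'n]
  \<comment> \<open>As \<alpha>_(n+1) = 0, the last coordinate of \<open>tau a \<alpha>\<close> is
    the summand common to all coordinates. Hence \<alpha>_k = \<beta>_(k-1) - \<beta>_n for k \<ge>
    2, and only \<alpha>_1 = c depends on the branch.\<close>
  define f where "f = (\<lambda>c k. if k = 0 then 1 else if k = 1 then c else ?b (k - 1) - ?b ?n)"
  define \<alpha> where "\<alpha> = (\<lambda>c. of_crd (f c) :: real^'n::_)"
  have mono: "?b (Suc k) \<le> ?b k" for k using Gam_antimono[OF \<beta>] by simp
  have cr: "crd (\<alpha> c) k = f c k" if "k \<le> Suc ?n" for k c
    unfolding \<alpha>_def by (rule crd_of_crd'[OF _ _ that]) (use n in \<open>auto simp: f_def\<close>)
  have in_Gam: "\<alpha> c \<in> Gam" if "?b 1 - ?b ?n \<le> c" "c \<le> 1" for c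
    unfolding \<alpha>_def
  proof (rule of_crd_Gam)
    fix k assume "k \<le> ?n"
    then show "f c (Suc k) \<le> f c k" using mono[of "k - 1"] that
        by (cases "k = 0"; cases "k = 1") (auto simp: f_def)
  qed (use n in \<open>auto simp: f_def\<close>)
  have b: "0 \<le> ?b ?n" "?b ?n \<le> ?b 1" "?b 1 \<le> 1" using crd_range[OF \<beta>] Gam_antimono[OF \<beta>] n by auto
  show "\<beta> \<in> tau False ` Gam \<union> tau True ` Gam"
  proof (cases "?b 1 + ?b ?n \<le> 1")
    case True
    have "tau False (\<alpha> (?b 1 + ?b ?n)) = \<beta>"
      by (rule crd_eqI) (use n in \<open>auto simp: crd_tau cr f_def\<close>)
    then show ?thesis using in_Gam[of "?b 1 + ?b ?n"] True b by force
  next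
    case False
    have "tau True (\<alpha> (2 - ?b 1 - ?b ?n)) = \<beta>"
      by (rule crd_eqI) (use n in \<open>auto simp: crd_tau cr f_def field_simps\<close>)
    then show ?thesis using in_Gam[of "2 - ?b 1 - ?b ?n"] False b by force
  qed
qed

text \<open>N is the reciprocal of the denominator 1 + \<alpha>_1 - \<alpha>_2 of the preimage. The
  equations are kept multiplied by N because in this form they are integral in \<beta>, as the
  descent on denominators of rational points requires.\<close>

lemma psi_preimage:
  fixes \<beta> :: "real^'n::{finite,wellorder}"
  assumes \<beta>: "\<beta> \<in> Gam"
  defines "a \<equiv> \<not> crd \<beta> 1 + crd \<beta> CARD('n) \<le> 1"
  defines "N \<equiv> (if a then crd \<beta> 1 else 1 - crd \<beta> CARD('n))"
  shows "0 < N \<and> N \<le> 1 \<and> (\<exists>\<alpha>\<in>Gam. psi a \<alpha> = \<beta> \<and> N * crd \<alpha> 1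
      = (if a then 1 - crd \<beta> CARD('n) else crd \<beta> 1)
    \<and> (\<forall>k\<in>{2..CARD('n)}. N * crd \<alpha> k = crd \<beta> (k - 1) - crd \<beta> CARD('n)))"
proof -
  let ?n = "CARD('n)" and ?b = "crd \<beta>"
  note n = card_n[where 'n = 'n]
  define c where "c = (if a then 1 - ?b ?n else ?b 1)"
  define f where "f = (\<lambda>k. if k = 0 then 1 else if k = 1 then c / N else (?b (k - 1) - ?b ?n) / N)"
  define \<alpha> where "\<alpha> = (of_crd f :: real^'n::_)"
  have mono: "?b (Suc k) \<le> ?b k" for k using Gam_antimono[OF \<beta>] by simp
  have b: "0 \<le> ?b ?n" "?b ?n \<le> ?b 1" "?b 1 \<le> 1" using crd_range[OF \<beta>] Gam_antimono[OF \<beta>] n by auto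
  have N: "0 < N" "N \<le> 1" using b by (auto simp: N_def a_def)
  have c: "c \<le> N" "?b 1 - ?b ?n \<le> c" using b by (auto simp: N_def a_def c_def)
  have cr: "crd \<alpha> k = f k" if "k \<le> Suc ?n" for k
    unfolding \<alpha>_def by (rule crd_of_crd'[OF _ _ that]) (use n in \<open>auto simp: f_def\<close>)
  have in_Gam: "\<alpha> \<in> Gam"
    unfolding \<alpha>_def
  proof (rule of_crd_Gam)
    fix k assume "k \<le> ?n"
    then show "f (Suc k) \<le> f k" using mono[of "k - 1"] c N
      by (cases "k = 0"; cases "k = 1") (auto simp: f_def divide_right_mono)
  qed (use n in \<open>auto simp: f_def\<close>)
  have f1: "crd \<alpha> 1 = c / N" "crd \<alpha> 2 = (?b 1 - ?b ?n) / N"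
      using n cr[of 1] cr[of 2] by (auto simp: f_def)
  have c': "c - (?b 1 - ?b ?n) = 1 - N" by (auto simp: c_def N_def)
  have d1: "crd \<alpha> 1 - crd \<alpha> 2 = (1 - N) / N"
    unfolding f1 using c' by (simp flip: diff_divide_distrib)
  moreover have "1 + (1 - N) / N = 1 / N" using N by (simp add: diff_divide_distrib)
  ultimately have d: "crd \<alpha> 1 - crd \<alpha> 2 = (1 - N) / N" "1 + crd \<alpha> 1 - crd \<alpha> 2 = 1 / N" by linarith+
  have "psi a \<alpha> = \<beta>"
  proof (rule crd_eqI)
    fix k assume k: "k \<in> {1..?n}"
    then have "crd \<alpha> (Suc k) = (?b k - ?b ?n) / N" by (simp add: cr f_def)
    then have "crd (psi a \<alpha>) k = ((if a then 1 - c / N else 0) + (1 - N) / N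
        + (?b k - ?b ?n) / N) / (1 / N)"
      unfolding crd_psi[OF in_Gam k] unfolding d unfolding f1 by simp
    also have "\<dots> = (if a then N - c else 0) + (1 - N) + (?b k - ?b ?n)"
      using N by (simp add: field_simps)
    also have "\<dots> = ?b k" by (auto simp: c_def N_def)
    finally show "crd (psi a \<alpha>) k = crd \<beta> k" .
  qed
  moreover have "N * crd \<alpha> 1 = (if a then 1 - crd \<beta> CARD('n) else crd \<beta> 1)"
    using N unfolding f1 c_def by simp
  moreover have "\<forall>k\<in>{2..?n}. N * crd \<alpha> k = crd \<beta> (k - 1) - crd \<beta> ?n"
    using N by (auto simp: cr f_def)
  ultimately show ?thesis using in_Gam N by blast
qed

lemma psi_cover: "Gam \<subseteq> psi False ` Gam \<union> psi True ` (Gam :: (real^'n::{finite,wellorder}) set)"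
proof
  fix \<beta> :: "real^'n::_" assume "\<beta> \<in> Gam"
  from psi_preimage[OF this] obtain a \<alpha> where "\<alpha> \<in> Gam" "psi a \<alpha> = \<beta>" by blast
  then show "\<beta> \<in> psi False ` Gam \<union> psi True ` Gam" by (cases a) auto
qed

text \<open>One of these equations, depending on the branch, recovers the denominator from the
  image; the other then gives the remaining one of \<alpha>_1 and \<alpha>_2.\<close>

lemma psi_ends:
  fixes \<alpha> :: "real^'n::{finite,wellorder}"
  assumes "\<alpha> \<in> Gam"
  shows "crd (psi a \<alpha>) CARD('n) * (1 + crd \<alpha> 1 - crd \<alpha> 2)
      = (if a then 1 - crd \<alpha> 2 else crd \<alpha> 1 - crd \<alpha> 2)"
    and "crd (psi a \<alpha>) 1 * (1 + crd \<alpha> 1 - crd \<alpha> 2) = (if a then 1 else crd \<alpha> 1)"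
  using psi_den[OF assms] card_n[where 'n
      = 'n] crd_psi[OF assms, of 1 a] crd_psi[OF assms, of "CARD('n)" a]
  by (auto simp: numeral_2_eq_2)

lemma psi_tail_eq:
  fixes \<alpha> \<beta> :: "real^'n::{finite,wellorder}"
  assumes \<alpha>: "\<alpha> \<in> Gam" and \<beta>: "\<beta> \<in> Gam" and eq: "psi a \<alpha> = psi b \<beta>"
    and 1: "crd \<alpha> 1 = crd \<beta> 1" and 2: "crd \<alpha> 2 = crd \<beta> 2" and ab: "a = b \<or> crd \<alpha> 1 = 1"
  shows "\<alpha> = \<beta>"
proof (rule crd_eqI)
  fix k assume k: "k \<in> {1..CARD('n)}"
  show "crd \<alpha> k = crd \<beta> k"
  proof (cases "k = 1")
    case False
    then have k': "k - 1 \<in> {1..CARD('n)}" "Suc (k - 1) = k" using k by auto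
    have "crd (psi a \<alpha>) (k - 1) = crd (psi b \<beta>) (k - 1)" using eq by simp
    then show ?thesis using psi_den[OF \<alpha>] ab
      unfolding crd_psi[OF \<alpha> k'(1)] crd_psi[OF \<beta> k'(1)] k' 1 2 by (cases a; cases b) auto
  qed (use 1 in simp)
qed

lemma psi_inj: "inj_on (psi a) (Gam :: (real^'n::{finite,wellorder}) set)"
proof (rule inj_onI)
  fix \<alpha> \<beta> :: "real^'n::_" assume \<alpha>: "\<alpha> \<in> Gam" and \<beta>: "\<beta> \<in> Gam" and eq: "psi a \<alpha> = psi a \<beta>"
  note e\<alpha> = psi_ends[OF \<alpha>, of a] and e\<beta> = psi_ends[OF \<beta>, of a, folded eq]
  have den: "1 + crd \<alpha> 1 - crd \<alpha> 2 = 1 + crd \<beta> 1 - crd \<beta> 2"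
  proof (cases a)
    case True
    then have "crd (psi a \<alpha>) 1 * (1 + crd \<alpha> 1 - crd \<alpha> 2)
        = 1" "crd (psi a \<alpha>) 1 * (1 + crd \<beta> 1 - crd \<beta> 2) = 1"
      using e\<alpha>(2) e\<beta>(2) by auto
    then show ?thesis by (metis mult_left_cancel mult_zero_left zero_neq_one)
  next
    case False
    define q where "q = crd (psi a \<alpha>) CARD('n)"
    have "q * (1 + crd \<alpha> 1 - crd \<alpha> 2) = crd \<alpha> 1 - crd \<alpha> 2" "q * (1 + crd \<beta> 1 - crd \<beta> 2)
        = crd \<beta> 1 - crd \<beta> 2"
      using False e\<alpha>(1) e\<beta>(1) by (auto simp: q_def)
    then have "(1 - q) * (1 + crd \<alpha> 1 - crd \<alpha> 2) = 1" "(1 - q) * (1 + crd \<beta> 1 - crd \<beta> 2) = 1"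
      by (simp_all add: left_diff_distrib)
    then show ?thesis by (metis mult_left_cancel mult_zero_left zero_neq_one)
  qed
  have "crd \<alpha> 1 = crd \<beta> 1 \<and> crd \<alpha> 2 = crd \<beta> 2"
  proof (cases a)
    case True
    then show ?thesis using e\<alpha>(1)[unfolded den] e\<beta>(1) den by simp
  next
    case False
    then show ?thesis using e\<alpha>(2)[unfolded den] e\<beta>(2) den by simp
  qed
  then show "\<alpha> = \<beta>" using psi_tail_eq[OF \<alpha> \<beta> eq] by simp
qed

text \<open>The images lie on opposite sides of the hyperplane where the first and last coordinates
  add up to 1. Meeting on it forces \<alpha>_1 = \<beta>_1 = 1, and there the two formulas
  coincide.\<close>

lemma psi_glue:
  fixes \<alpha> \<beta> :: "real^'n::{finite,wellorder}"
  assumes \<alpha>: "\<alpha> \<in> Gam" and \<beta>: "\<beta> \<in> Gam"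
  shows "psi False \<alpha> = psi True \<beta> \<longleftrightarrow> \<alpha> = \<beta> \<and> \<alpha> \<notin> Gam_o"
proof
  assume eq: "psi False \<alpha> = psi True \<beta>"
  define p q where "p = crd (psi False \<alpha>) 1" and "q = crd (psi False \<alpha>) CARD('n)"
  note e\<alpha> = psi_ends[OF \<alpha>, of False, folded p_def q_def, simplified]
    and e\<beta> = psi_ends[OF \<beta>, of True, folded eq, folded p_def q_def, simplified]
  have d: "0 < 1 + crd \<alpha> 1 - crd \<alpha> 2" "0 < 1 + crd \<beta> 1 - crd \<beta> 2"
      using psi_den[OF \<alpha>] psi_den[OF \<beta>] by auto
  have le: "crd \<alpha> 1 \<le> 1" "crd \<beta> 1 \<le> 1" using crd_range \<alpha> \<beta> by auto
  have "q * (1 + crd \<alpha> 1 - crd \<alpha> 2) \<le> (1 - p) * (1 + crd \<alpha> 1 - crd \<alpha> 2)"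
    using e\<alpha> le by (simp add: left_diff_distrib)
  then have 1: "q \<le> 1 - p" using d by simp
  have "(1 - p) * (1 + crd \<beta> 1 - crd \<beta> 2) \<le> q * (1 + crd \<beta> 1 - crd \<beta> 2)"
    using e\<beta> le by (simp add: left_diff_distrib)
  then have 2: "1 - p \<le> q" using d by simp
  have q: "q = 1 - p" using 1 2 by simp
  have a1: "crd \<alpha> 1 = 1" and b1: "crd \<beta> 1 = 1"
      using e\<alpha> e\<beta> unfolding q by (simp_all add: left_diff_distrib)
  have "p * (1 + crd \<alpha> 1 - crd \<alpha> 2) = p * (1 + crd \<beta> 1 - crd \<beta> 2)" "p \<noteq> 0"
      using e\<alpha>(2) e\<beta>(2) a1 by auto
  then have "crd \<alpha> 2 = crd \<beta> 2" using a1 b1 by simp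
  then show "\<alpha> = \<beta> \<and> \<alpha> \<notin> Gam_o" using psi_tail_eq[OF \<alpha> \<beta> eq] a1 b1 by (auto simp: Gam_o_iff)
next
  assume *: "\<alpha> = \<beta> \<and> \<alpha> \<notin> Gam_o"
  then have "crd \<alpha> 1 = 1" using \<alpha> crd_range(2)[OF \<alpha>, of 1] by (auto simp: Gam_o_iff)
  then show "psi False \<alpha> = psi True \<beta>" using * by (intro crd_eqI) (auto simp: crd_psi[OF \<beta>])
qed

lemma crd_continuous [continuous_intros]: "continuous_on S (\<lambda>\<alpha>. crd \<alpha> k)"
  for S :: "(real^'n::{finite,wellorder}) set"
proof (cases "k \<in> {1..CARD('n)}")
  case True
  then obtain i :: 'n where "idx i = k" using idx_ex by blast
  then show ?thesis by (auto intro!: continuous_intros)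
next
  case False
  then have "k = 0 \<or> CARD('n) < k" by auto
  then show ?thesis by auto
qed

lemma psi_continuous: "continuous_on (Gam :: (real^'n::{finite,wellorder}) set) (psi a)"
proof -
  have "continuous_on Gam (\<lambda>\<alpha>::real^'n::_. \<chi> i. ((if a then 1 - crd \<alpha> 1 else 0)
      + (crd \<alpha> 1 - crd \<alpha> 2) + crd \<alpha> (Suc (idx i)))
     / (1 + crd \<alpha> 1 - crd \<alpha> 2))"
    using psi_den by (cases a) (force intro!: continuous_intros continuous_on_vec_lambda)+
  then show ?thesis
    by (rule continuous_on_eq) (use psi_den in \<open>force simp: vec_eq_iff psi_nth\<close>)
qed

lemma tau_continuous: "continuous_on S (tau a)" for S :: "(real^'n::{finite,wellorder}) set"
proof -
  have "tau a = (\<lambda>\<alpha>::real^'n::_. \<chi> i. (if a then 1 - crd \<alpha> 1 else 0) + (crd \<alpha> 1 - crd \<alpha> 2) / 2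
      + crd \<alpha> (Suc (idx i)))"
    by (auto simp: fun_eq_iff vec_eq_iff tau_nth)
  then show ?thesis by (cases a) (auto intro!: continuous_intros continuous_on_vec_lambda)
qed

lemma closed_Gam: "closed (Gam :: (real^'n::{finite,wellorder}) set)"
proof -
  have eq: "Gam = {\<alpha> :: real^'n::_. \<forall>k. crd \<alpha> (Suc k) \<le> crd \<alpha> k}" by (auto simp: Gam_iff)
  show ?thesis unfolding eq by (intro closed_Collect_all closed_Collect_le continuous_intros)
qed

lemma compact_Gam: "compact (Gam :: (real^'n::{finite,wellorder}) set)"
proof -
  have "Gam \<subseteq> cbox 0 (1 :: real^'n::_)" by (auto simp: Gam_def mem_box_cart)
  then show ?thesis using closed_Gam bounded_subset[OF bounded_cbox]
      by (auto simp: compact_eq_bounded_closed)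
qed

lemma closed_Gam_bd: "closed (Gam - Gam_o :: (real^'n::{finite,wellorder}) set)"
proof -
  have "Gam - Gam_o = Gam \<inter> {\<alpha> :: real^'n::_. 1 \<le> crd \<alpha> 1}" by (auto simp: Gam_o_iff)
  then show ?thesis by (auto intro!: closed_Int closed_Gam closed_Collect_le continuous_intros)
qed

lemma zero_in_Gam: "0 \<in> Gam" by (auto simp: Gam_def)

section \<open>Barycentric coordinates and shrinking cells\<close>

text \<open>
  The barycentric coordinates of \<open>\<alpha>\<close>; \<open>lin_val xs\<close> is the affine function with values \<open>xs\<close> at
  the vertices \<open>v\<^sub>0, \<dots>, v\<^sub>n\<close>.
\<close>

definition bc :: "real^'n::{finite,wellorder} \<Rightarrow> nat \<Rightarrow> real" where
  "bc \<alpha> j = (if j = 0 then 1 - crd \<alpha> 1 else crd \<alpha> (CARD('n) + 1 - j) - crd \<alpha> (CARD('n) + 2 - j))"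

definition lin_val :: "real list \<Rightarrow> real^'n::{finite,wellorder} \<Rightarrow> real" where
  "lin_val xs \<alpha> = (\<Sum>j\<le>CARD('n). xs ! j * bc \<alpha> j)"

lemma sum_reverse_telescope_1: "(m::nat) \<le> n \<Longrightarrow>
    (\<Sum>j=1..m. g (n + 1 - j) - g (n + 2 - j)) = g (n + 1 - m) - (g (n + 1) :: real)"
proof (induction m)
  case (Suc m)
  have "n + 2 - Suc m = n + 1 - m" using Suc.prems by simp
  then show ?case using Suc by simp
qed simp

lemma atMost_eq_insert_0: "{..n} = insert 0 {1..n::nat}" by auto

lemma sum_bc: "(\<Sum>j\<le>CARD('n). bc \<alpha> j) = 1" for \<alpha> :: "real^'n::{finite,wellorder}"
proof -
  have "(\<Sum>j=1..CARD('n). bc \<alpha> j) = crd \<alpha> 1"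
    using sum_reverse_telescope_1[of "CARD('n)" "CARD('n)" "crd \<alpha>"] by (simp add: bc_def)
  then show ?thesis unfolding atMost_eq_insert_0 by (simp add: bc_def)
qed

lemma bc_nonneg: "\<alpha> \<in> Gam \<Longrightarrow> 0 \<le> bc \<alpha> j"
  using Gam_antimono[of \<alpha> "_ - j"] crd_range(2)[of \<alpha> 1] by (auto simp: bc_def)

lemma lin_val_range:
  fixes \<alpha> :: "real^'n::{finite,wellorder}"
  assumes "\<alpha> \<in> Gam" "length xs = Suc CARD('n)" "set xs \<subseteq> {l..h}"
  shows "lin_val xs \<alpha> \<in> {l..h}"
proof -
  have x: "xs ! j \<in> {l..h}" if "j \<le> CARD('n)" for j using assms(2,3) that by (auto simp: subset_iff)
  have "(\<Sum>j\<le>CARD('n). l * bc \<alpha> j) \<le> lin_val xs \<alpha>" "lin_val xs \<alpha> \<le> (\<Sum>j\<le>CARD('n). h * bc \<alpha> j)"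
    unfolding lin_val_def using x bc_nonneg[OF assms(1)] by (auto intro!: sum_mono mult_right_mono)
  then show ?thesis by (simp add: sum_bc flip: sum_distrib_left)
qed

text \<open>On vertices: v_n goes to the midpoint of the edge v_0 v_1, v_(j-1) goes to v_j, and v_0
  goes to the end of that edge chosen by a.\<close>

lemma bc_tau:
  fixes \<alpha> :: "real^'n::{finite,wellorder}"
  shows "bc (tau a \<alpha>) 0 = (if a then 0 else bc \<alpha> 0) + bc \<alpha> CARD('n) / 2"
    and "bc (tau a \<alpha>) 1 = (if a then bc \<alpha> 0 else 0) + bc \<alpha> CARD('n) / 2"
    and "j \<in> {2..CARD('n)} \<Longrightarrow> bc (tau a \<alpha>) j = bc \<alpha> (j - 1)"
proof -
  let ?n = "CARD('n)"
  note n = card_n[where 'n = 'n]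
  have bn: "bc \<alpha> ?n = crd \<alpha> 1 - crd \<alpha> 2" using n by (simp add: bc_def)
  have S2: "Suc 1 = 2" by simp
  show "bc (tau a \<alpha>) 0 = (if a then 0 else bc \<alpha> 0) + bc \<alpha> CARD('n) / 2"
    using crd_tau[of 1 a \<alpha>] n unfolding bn S2 by (cases a) (auto simp: bc_def field_simps)
  show "bc (tau a \<alpha>) 1 = (if a then bc \<alpha> 0 else 0) + bc \<alpha> CARD('n) / 2"
    using crd_tau[of ?n a \<alpha>] n unfolding bn by (cases a) (auto simp: bc_def)
  assume j: "j \<in> {2..CARD('n)}"
  then have m: "?n + 1 - j \<in> {1..?n}" "?n + 2 - j \<in> {1..?n}"
    and "?n + 1 - (j - 1) = Suc (?n + 1 - j)" "?n + 2 - (j - 1) = Suc (?n + 2 - j)" "?n + 2 - j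
        = Suc (?n + 1 - j)" by auto
  then show "bc (tau a \<alpha>) j = bc \<alpha> (j - 1)"
    using j crd_tau[OF m(1), of a \<alpha>] crd_tau[OF m(2), of a \<alpha>] by (auto simp: bc_def)
qed

lemma lin_val_tau:
  fixes \<alpha> :: "real^'n::{finite,wellorder}"
  assumes "length xs = Suc CARD('n)"
  shows "lin_val xs (tau a \<alpha>) = lin_val (bisect a xs) \<alpha>"
proof -
  let ?n = "CARD('n)"
  obtain m where m: "?n = Suc m" using card_n[where 'n = 'n] by (metis Suc_le_D One_nat_def)
  obtain x y ys where xs: "xs = x # y # ys" "length ys = m"
    using assms m by (cases xs; cases "tl xs") auto
  have "lin_val xs (tau a \<alpha>) = x * bc (tau a \<alpha>) 0 + y * bc (tau a \<alpha>) 1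
      + (\<Sum>j<m. ys ! j * bc \<alpha> (Suc j))"
  proof -
    have "lin_val xs (tau a \<alpha>) = (\<Sum>j<Suc (Suc m). xs ! j * bc (tau a \<alpha>) j)"
      by (simp add: lin_val_def m lessThan_Suc_atMost del: sum.lessThan_Suc)
    also have "\<dots> = x * bc (tau a \<alpha>) 0 + (y * bc (tau a \<alpha>) 1
        + (\<Sum>j<m. ys ! j * bc (tau a \<alpha>) (Suc (Suc j))))"
      by (simp add: xs sum.lessThan_Suc_shift del: sum.lessThan_Suc)
    also have "(\<Sum>j<m. ys ! j * bc (tau a \<alpha>) (Suc (Suc j))) = (\<Sum>j<m. ys ! j * bc \<alpha> (Suc j))"
      by (intro sum.cong refl) (use bc_tau(3)[of _ a \<alpha>] m in auto)
    finally show ?thesis by simp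
  qed
  moreover have "lin_val (bisect a xs) \<alpha>
      = (if a then y else x) * bc \<alpha> 0 + (\<Sum>j<m. ys ! j * bc \<alpha> (Suc j)) + (x + y) / 2 * bc \<alpha> ?n"
  proof -
    have "lin_val (bisect a xs) \<alpha> = (\<Sum>j<Suc (Suc m). bisect a xs ! j * bc \<alpha> j)"
      by (simp add: lin_val_def m lessThan_Suc_atMost del: sum.lessThan_Suc)
    also have "\<dots> = bisect a xs ! 0 * bc \<alpha> 0 + (\<Sum>j<Suc m. bisect a xs ! Suc j * bc \<alpha> (Suc j))"
      by (simp only: sum.lessThan_Suc_shift)
    also have "(\<Sum>j<Suc m. bisect a xs ! Suc j * bc \<alpha> (Suc j))
        = (\<Sum>j<m. ys ! j * bc \<alpha> (Suc j)) + (x + y) / 2 * bc \<alpha> (Suc m)"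
      using xs(2) by (simp add: xs(1) nth_append)
    finally show ?thesis by (simp add: xs(1) m)
  qed
  ultimately show ?thesis unfolding bc_tau(1,2)
    by (cases a) (simp_all add: algebra_simps add_divide_distrib)
qed

lemma lin_val_word:
  fixes \<alpha> :: "real^'n::{finite,wellorder}"
  assumes "length xs = Suc CARD('n)"
  shows "lin_val xs (word_comp tau u \<alpha>) = lin_val (run u xs) \<alpha>"
  using assms
proof (induction u arbitrary: xs)
  case (Cons a u)
  then show ?case by (simp add: lin_val_tau run_Cons)
qed simp

text \<open>The \<open>k\<close>-th coordinate has value 1 at the vertices \<open>v\<^sub>1, \<dots>, v\<^bsub>n+1-k\<^esub>\<close> and 0 at the others.\<close>

lemma crd_lin_val:
  fixes \<alpha> :: "real^'n::{finite,wellorder}"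
  assumes k: "k \<in> {1..CARD('n)}"
  shows "crd \<alpha> k = lin_val (map (\<lambda>j. if 1 \<le> j \<and> j
      \<le> CARD('n) + 1 - k then 1 else 0) [0..<Suc CARD('n)]) \<alpha>"
proof -
  let ?n = "CARD('n)"
  let ?f = "\<lambda>j. if 1 \<le> j \<and> j \<le> ?n + 1 - k then 1 else 0 :: real"
  have "lin_val (map ?f [0..<Suc ?n]) \<alpha> = (\<Sum>j\<le>?n. ?f j * bc \<alpha> j)"
    unfolding lin_val_def by (intro sum.cong) (auto simp del: upt_Suc)
  also have "\<dots> = (\<Sum>j=1..?n + 1 - k. bc \<alpha> j)"
    using k by (intro sum.mono_neutral_cong_right) auto
  also have "\<dots> = crd \<alpha> (?n + 1 - (?n + 1 - k))"
  proof -
    have le: "?n + 1 - k \<le> ?n" using k by auto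
    show ?thesis using sum_reverse_telescope_1[OF le, of "crd \<alpha>"] by (simp add: bc_def)
  qed
  finally show ?thesis using k by simp
qed

text \<open>On a cell a coordinate stays within the range of its values at the vertices. These
  evolve by \<open>bisect\<close>, and every batch of (n + 1) n letters contracts their range by the
  factor ?c.\<close>

lemma tau_shrink_crd:
  assumes "0 < e"
  shows "\<exists>t. \<forall>u. \<forall>\<alpha>\<in>Gam. \<forall>\<beta>\<in>Gam. \<forall>k\<in>{1..CARD('n::{finite,wellorder})}. t \<le> length u \<longrightarrow>
    \<bar>crd (word_comp tau u (\<alpha> :: real^'n::_)) k - crd (word_comp tau u (\<beta> :: real^'n::_)) k\<bar> < e"
proof -
  let ?n = "CARD('n)"
  let ?c = "(1::real) - 1 / 2 ^ (?n + 2)"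
  have c: "0 \<le> ?c" "?c < 1" using one_le_power[of "2::real" "?n + 2"] by (simp_all add: field_simps)
  obtain m where m: "?c ^ m < e" using real_arch_pow_inv[OF assms c(2)] by blast
  have "\<bar>crd (word_comp tau u \<alpha>) k - crd (word_comp tau u \<beta>) k\<bar> < e"
    if u: "m * ((?n + 1) * ?n) \<le> length u" and \<alpha>: "\<alpha> \<in> Gam" and \<beta>: "\<beta> \<in> Gam" and k: "k \<in> {1..?n}"
    for u and \<alpha> \<beta> :: "real^'n::_" and k
  proof -
    define xs :: "real list" where "xs = map (\<lambda>j. if 1 \<le> j \<and> j
        \<le> ?n + 1 - k then 1 else 0) [0..<Suc ?n]"
    have xs: "set xs \<subseteq> {0..1}" "length xs = Suc ?n" by (auto simp: xs_def)
    obtain l h where lh: "set (run u xs) \<subseteq> {l..h}" "h - l \<le> ?c ^ m * (1 - 0)"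
      using run_contracts_pow[OF xs u] by auto
    have "crd (word_comp tau u \<gamma>) k \<in> {l..h}" if "\<gamma> \<in> Gam" for \<gamma> :: "real^'n::_"
    proof -
      have "crd (word_comp tau u \<gamma>) k = lin_val (run u xs) \<gamma>"
        unfolding crd_lin_val[OF k] xs_def[symmetric] using xs(2) by (rule lin_val_word)
      then show ?thesis using lin_val_range[OF that _ lh(1)] xs(2) by simp
    qed
    from this[OF \<alpha>] this[OF \<beta>] show ?thesis using lh(2) m by (simp add: abs_less_iff)
  qed
  then show ?thesis by (intro exI[of _ "m * ((?n + 1) * ?n)"] allI ballI impI)
qed

lemma tau_shrink:
  assumes "0 < e"
  shows "\<exists>t. \<forall>u x y. t \<le> length u \<longrightarrow> x \<in> (Gam :: (real^'n::{finite,wellorder}) set) \<longrightarrow> y \<in> Gam \<longrightarrow>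
    dist (word_comp tau u x) (word_comp tau u y) < e"
proof -
  let ?n = "CARD('n)"
  have n: "0 < real ?n" using card_n[where 'n = 'n] by simp
  obtain t where t: "\<forall>u. \<forall>\<alpha>\<in>Gam. \<forall>\<beta>\<in>Gam. \<forall>k\<in>{1..?n}. t \<le> length u \<longrightarrow>
      \<bar>crd (word_comp tau u (\<alpha> :: real^'n::_)) k - crd (word_comp tau u (\<beta> :: real^'n::_)) k\<bar>
          < e / ?n"
    using tau_shrink_crd[of "e / ?n", where 'n = 'n] assms n by (meson divide_pos_pos)
  have "dist (word_comp tau u x) (word_comp tau u y) < e"
    if "t \<le> length u" "x \<in> Gam" "y \<in> Gam" for u and x y :: "real^'n::_"
  proof -
    let ?d = "word_comp tau u x - word_comp tau u y"
    have "norm ?d \<le> (\<Sum>i\<in>UNIV. \<bar>?d $ i\<bar>)" by (rule norm_le_l1_cart)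
    also have "\<dots> < (\<Sum>i\<in>(UNIV :: 'n set). e / ?n)"
    proof (rule sum_strict_mono)
      fix i :: 'n
      show "\<bar>?d $ i\<bar> < e / ?n" using t[rule_format, OF \<open>x \<in> Gam\<close> \<open>y \<in> Gam\<close>, of "idx i" u] that
          idx_range[of i] by simp
    qed auto
    also have "\<dots> = e" using n by simp
    finally show ?thesis by (simp add: dist_norm)
  qed
  then show ?thesis by blast
qed

section \<open>Volume\<close>

lemma abs_det_compose_involution:
  fixes f R :: "real^'n::{finite,wellorder} \<Rightarrow> real^'n::_"
  assumes "linear f" "linear R" "\<And>x. R (R x) = x"
  shows "\<bar>det (matrix (\<lambda>x. R (f x)))\<bar> = \<bar>det (matrix f)\<bar>"
proof -
  have "matrix R ** matrix R = matrix (R \<circ> R)" using matrix_compose[OF assms(2,2)] by simp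
  also have "R \<circ> R = id" using assms(3) by auto
  finally have "matrix R ** matrix R = (mat 1 :: real^'n::_^'n::_)" by (simp only: matrix_id_mat_1)
  then have "det (matrix R) * det (matrix R) = 1" by (metis det_I det_mul)
  then have "det (matrix R) ^ 2 = 1" by (simp add: power2_eq_square)
  then have "\<bar>det (matrix R)\<bar> = 1" by (auto simp: power2_eq_1_iff)
  then show ?thesis using matrix_compose[OF assms(1,2)] by (simp add: o_def det_mul abs_mult)
qed

lemma crd_linear:
  fixes x y :: "real^'n::{finite,wellorder}"
  assumes "1 \<le> k"
  shows "crd (x + y) k = crd x k + crd y k" "crd (c *\<^sub>R x) k = c * crd x k"
proof -
  have "crd (x + y) k = crd x k + crd y k \<and> crd (c *\<^sub>R x) k = c * crd x k"
  proof (cases "k \<le> CARD('n)")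
    case True
    then obtain i :: 'n where "idx i = k" using idx_ex[of k] assms by auto
    then show ?thesis by auto
  qed simp
  then show "crd (x + y) k = crd x k + crd y k" "crd (c *\<^sub>R x) k = c * crd x k" by auto
qed

definition tau_lin :: "bool \<Rightarrow> real^'n::{finite,wellorder} \<Rightarrow> real^'n::_" where
  "tau_lin a x = (\<chi> i. (if a then - crd x 1 else 0) + (crd x 1 - crd x 2) / 2
      + crd x (Suc (idx i)))"

lemma tau_eq_lin: "tau a x = (if a then 1 else 0) + tau_lin a x"
  by (simp add: vec_eq_iff tau_nth tau_lin_def)

lemma linear_tau_lin: "linear (tau_lin a :: real^'n::{finite,wellorder} \<Rightarrow> _)"
  by (rule linearI) (auto simp: vec_eq_iff tau_lin_def crd_linear field_simps)

text \<open>The reflection of \<open>\<Gamma>\<close> that swaps the vertices \<open>v\<^sub>0\<close> and \<open>v\<^sub>1\<close>, up to translation.\<close>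

definition swap_lin :: "real^'n::{finite,wellorder} \<Rightarrow> real^'n::_" where
  "swap_lin x = (\<chi> i. x $ i - (crd x 1 + crd x CARD('n)))"

lemma crd_swap_lin: "k \<in> {1..CARD('n)} \<Longrightarrow> crd (swap_lin x) k = crd x k - (crd x 1 + crd x CARD('n))"
  for x :: "real^'n::{finite,wellorder}"
  using idx_ex[of k, where 'n = 'n] by (auto simp: swap_lin_def)

lemma linear_swap_lin: "linear (swap_lin :: real^'n::{finite,wellorder} \<Rightarrow> _)"
  using card_n[where 'n = 'n]
  by (intro linearI) (auto simp: vec_eq_iff swap_lin_def crd_linear algebra_simps)

lemma swap_lin_involution: "swap_lin (swap_lin x) = x"
proof (rule crd_eqI)
  fix k assume "k \<in> {1..CARD('a)}"
  then show "crd (swap_lin (swap_lin x)) k = crd x k" by (simp add: crd_swap_lin)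
qed

lemma crd_tau_lin: "k \<in> {1..CARD('n)} \<Longrightarrow>
    crd (tau_lin a x) k = (if a then - crd x 1 else 0) + (crd x 1 - crd x 2) / 2 + crd x (Suc k)"
  for x :: "real^'n::{finite,wellorder}"
  using idx_ex[of k, where 'n = 'n] by (auto simp: tau_lin_def)

lemma tau_lin_True: "tau_lin True x = swap_lin (tau_lin False x)"
  for x :: "real^'n::{finite,wellorder}"
proof (rule crd_eqI)
  fix k assume k: "k \<in> {1..CARD('n)}"
  have "Suc 1 = (2::nat)" by simp
  then show "crd (tau_lin True x) k = crd (swap_lin (tau_lin False x)) k"
    using k card_n[where 'n = 'n] crd_tau_lin[of 1 False x] crd_tau_lin[of "CARD('n)" False x]
    by (simp add: crd_swap_lin crd_tau_lin field_simps numeral_2_eq_2)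
qed

text \<open>The linear parts differ by a reflection, so both branches scale volume by the same
  factor, left unevaluated here.\<close>

lemma measure_tau_image:
  fixes S :: "(real^'n::{finite,wellorder}) set"
  assumes "S \<in> lmeasurable"
  shows "tau a ` S \<in> lmeasurable"
    and "measure lebesgue (tau a ` S) = \<bar>det (matrix (tau_lin False :: real^'n::_ \<Rightarrow> _))\<bar> * measure
        lebesgue S"
proof -
  have im: "tau a ` S = (+) (if a then 1 else 0) ` tau_lin a ` S"
      by (auto simp: tau_eq_lin image_image)
  have det: "\<bar>det (matrix (tau_lin a :: real^'n::_ \<Rightarrow> _))\<bar>
      = \<bar>det (matrix (tau_lin False :: real^'n::_ \<Rightarrow> _))\<bar>"
  proof (cases a)
    case True
    have "(tau_lin True :: real^'n::_ \<Rightarrow> _) = (\<lambda>x. swap_lin (tau_lin False x))"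
        by (auto simp: tau_lin_True)
    then show ?thesis
      using abs_det_compose_involution[OF linear_tau_lin linear_swap_lin swap_lin_involution] True
          by simp
  qed simp
  show "tau a ` S \<in> lmeasurable"
    unfolding im by (intro measurable_translation measurable_linear_image linear_tau_lin assms)
  show "measure lebesgue (tau a ` S) = \<bar>det (matrix (tau_lin False :: real^'n::_ \<Rightarrow> _))\<bar> * measure
      lebesgue S"
    unfolding im using measure_linear_image[OF linear_tau_lin assms] det
        by (simp add: measure_translation)
qed

text \<open>The hyperplane bisecting the edge \<open>v\<^sub>0v\<^sub>1\<close>, fixed by the reflection above.\<close>

definition wall :: "(real^'n::{finite,wellorder}) set" where
  "wall = {y. crd y 1 + crd y CARD('n) = 1}"

lemma negligible_wall: "negligible (wall :: (real^'n::{finite,wellorder}) set)"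
proof -
  obtain i j :: 'n where ij: "idx i = 1" "idx j = CARD('n)"
    using idx_ex[of 1, where 'n = 'n] idx_ex[of "CARD('n)", where 'n = 'n] card_n[where 'n = 'n]
        by auto
  have eq: "wall = {y :: real^'n::_. (axis i 1 + axis j 1) \<bullet> y = 1}"
    using crd_simps(2)[of _ i] crd_simps(2)[of _ j] ij
    by (auto simp: wall_def inner_add_left inner_axis' )
  show ?thesis unfolding eq by (rule negligible_hyperplane) simp
qed

lemma tau_image_wall: "tau False ` Gam \<inter> tau True ` Gam \<subseteq> (wall :: (real^'n::{finite,wellorder})
    set)"
proof
  fix y :: "real^'n::_" assume "y \<in> tau False ` Gam \<inter> tau True ` Gam"
  then obtain \<alpha> \<beta> where \<alpha>: "\<alpha> \<in> Gam" "y = tau False \<alpha>" and \<beta>: "\<beta> \<in> Gam" "y = tau True \<beta>" by auto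
  have S: "Suc 1 = (2::nat)" by simp
  note n = card_n[where 'n = 'n]
  have "crd y 1 + crd y CARD('n) = crd \<alpha> 1"
    using crd_tau[of 1 False \<alpha>] crd_tau[of "CARD('n)" False \<alpha>] n
        unfolding \<alpha>(2) S by (simp add: field_simps)
  moreover have "crd y 1 + crd y CARD('n) = 2 - crd \<beta> 1"
    using crd_tau[of 1 True \<beta>] crd_tau[of "CARD('n)" True \<beta>] n
        unfolding \<beta>(2) S by (simp add: field_simps)
  ultimately show "y \<in> wall" using crd_range(2)[OF \<alpha>(1), of 1] crd_range(2)[OF \<beta>(1), of 1]
      by (simp add: wall_def)
qed

section \<open>Interior points and normalized volume\<close>

definition Gam_int :: "(real^'n::{finite,wellorder}) set" where
  "Gam_int = {\<alpha>. \<forall>k\<le>CARD('n). crd \<alpha> (Suc k) < crd \<alpha> k}"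

lemma Gam_int_sub: "Gam_int \<subseteq> Gam"
  unfolding Gam_iff subset_iff by (auto simp: Gam_int_def less_imp_le intro: crd_decI)

lemma interior_point:
  obtains q :: "real^'n::{finite,wellorder}" and r :: real
  where "q \<in> Gam" "0 < r" "ball q r \<subseteq> Gam_int"
proof -
  let ?n = "CARD('n)"
  \<comment> \<open>Equally spaced coordinates satisfy all the inequalities strictly.\<close>
  define f where "f k = 1 - real k / real (Suc ?n)" for k
  have dec: "f (Suc k) < f k" for k by (simp add: f_def field_simps)
  have f: "f 0 = 1" "f (Suc ?n) = 0" by (simp_all add: f_def)
  define q where "q = (of_crd f :: real^'n::_)"
  have eq: "Gam_int = (\<Inter>k\<in>{..?n}. {x :: real^'n::_. crd x (Suc k) < crd x k})"
      by (auto simp: Gam_int_def)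
  have "open (Gam_int :: (real^'n::_) set)"
    unfolding eq by (intro open_INT finite_atMost ballI open_Collect_less continuous_intros)
  moreover have q: "q \<in> Gam_int" unfolding Gam_int_def q_def
      using crd_of_crd'[of f, where 'n = 'n] f dec by auto
  ultimately obtain r where r: "0 < r" "ball q r \<subseteq> Gam_int" by (meson open_contains_ball)
  show ?thesis using q Gam_int_sub r by (intro that[of q r]) auto
qed

lemma measure_Gam_pos: "0 < measure lborel (Gam :: (real^'n::{finite,wellorder}) set)"
proof -
  obtain q :: "real^'n::_" and r where q: "q \<in> Gam" "0 < r" "ball q r \<subseteq> Gam_int"
    by (rule interior_point)
  have "ball q r \<subseteq> Gam" using q(3) Gam_int_sub by blast
  moreover have "Gam \<in> fmeasurable (lborel :: (real^'n::_) measure)"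
      using compact_Gam by (rule fmeasurable_compact)
  ultimately have "measure lborel (ball q r) \<le> measure lborel (Gam :: (real^'n::_) set)"
    by (intro measure_mono_fmeasurable) auto
  moreover have "0 < measure lborel (ball q r)" using q(2) by (rule content_ball_pos)
  ultimately show ?thesis by linarith
qed

lemma Gam_fmeasurable: "Gam \<in> fmeasurable (lborel :: (real^'n::{finite,wellorder}) measure)"
  using compact_Gam by (rule fmeasurable_compact)

lemma sets_lam [simp]: "sets lam = sets borel" and space_lam [simp]: "space lam = UNIV"
  by (simp_all add: lam_def)

lemma Gam_borel [measurable]: "Gam \<in> sets borel"
  using closed_Gam by (rule borel_closed)

lemma emeasure_lam:
  fixes A :: "(real^'n::{finite,wellorder}) set"
  assumes "A \<in> sets borel"
  shows "emeasure lam A = ennreal (measure lebesgue (Gam \<inter> A) / measure lebesgue (Gam ::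
      (real^'n::_) set))"
proof -
  have "Gam \<inter> A \<in> fmeasurable lborel" using Gam_fmeasurable assms
      by (auto intro: fmeasurable_Int_fmeasurable)
  then have "emeasure lborel (Gam \<inter> A) = ennreal (measure lborel (Gam \<inter> A))"
    by (intro emeasure_eq_measure2) (auto simp: fmeasurable_def)
  moreover have "emeasure lborel (Gam :: (real^'n::_) set)
      = ennreal (measure lborel (Gam :: (real^'n::_) set))"
    using Gam_fmeasurable by (intro emeasure_eq_measure2) (auto simp: fmeasurable_def)
  ultimately show ?thesis
    using assms measure_Gam_pos[where 'n = 'n] unfolding lam_def
    by (simp add: emeasure_uniform_measure divide_ennreal measure_completion)
qed

lemma lam_wall: "A \<in> sets borel \<Longrightarrow> A \<subseteq> wall \<Longrightarrow> emeasure lam A = 0"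
  for A :: "(real^'n::{finite,wellorder}) set"
proof -
  assume A: "A \<in> sets borel" "A \<subseteq> wall"
  then have "negligible (Gam \<inter> A)" by (intro negligible_subset[OF negligible_wall]) auto
  then have "measure lebesgue (Gam \<inter> A) = 0" by (rule negligible_imp_measure0)
  then show ?thesis unfolding emeasure_lam[OF A(1)] by (simp only:) simp
qed

lemma lam_self_similar:
  fixes A :: "(real^'n::{finite,wellorder}) set"
  assumes A: "A \<in> sets borel"
  shows "2 * emeasure lam A = emeasure lam (tau False -` A \<inter> Gam)
      + emeasure lam (tau True -` A \<inter> Gam)"
proof -
  let ?m = "measure (lebesgue :: (real^'n::_) measure)"
      and ?d = "\<bar>det (matrix (tau_lin False :: real^'n::_ \<Rightarrow> _))\<bar>"
  have tm: "tau a -` B \<inter> Gam \<in> sets borel" if "B \<in> sets borel" for a and B :: "(real^'n::_) set"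
  proof -
    have "tau a \<in> borel_measurable (borel :: (real^'n::_) measure)"
      by (intro borel_measurable_continuous_onI tau_continuous)
    from measurable_sets[OF this that] show ?thesis by auto
  qed
  have fm: "Gam \<inter> B \<in> lmeasurable" if "B \<in> sets borel" for B :: "(real^'n::_) set"
    using that bounded_subset[OF compact_imp_bounded[OF compact_Gam], of "Gam \<inter> B"]
    by (intro bounded_set_imp_lmeasurable) auto
  have half: "?m (Gam \<inter> B) = ?d * ?m (tau False -` B \<inter> Gam) + ?d * ?m (tau True -` B \<inter> Gam)"
    if B: "B \<in> sets borel" for B :: "(real^'n::_) set"
  proof -
    let ?T = "\<lambda>a. tau a ` (tau a -` B \<inter> Gam)"
    have lm: "tau a -` B \<inter> Gam \<in> lmeasurable" for a
        using fm[OF tm[OF B, of a]] by (simp add: Int_ac)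
    have "Gam \<inter> B = ?T False \<union> ?T True"
      using tau_cover[where 'n = 'n] tau_in[where 'n = 'n] by fast
    moreover have "?m (?T False \<union> ?T True) = ?m (?T False) + ?m (?T True)"
    proof (rule measure_Un_AE)
      have "negligible (wall :: (real^'n::_) set)" by (rule negligible_wall)
      then have "AE x in lebesgue. x \<notin> (wall :: (real^'n::_) set)"
        by (intro AE_not_in) (simp add: negligible_iff_null_sets)
      then show "AE x in lebesgue. x \<notin> ?T False \<or> x \<notin> ?T True"
        by eventually_elim (use tau_image_wall[where 'n = 'n] in blast)
    qed (use measure_tau_image(1)[OF lm] in auto)
    ultimately show ?thesis using measure_tau_image(2)[OF lm] by simp
  qed
  have pos: "0 < ?m Gam" using measure_Gam_pos[where 'n = 'n] by (simp add: measure_completion)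
  \<comment> \<open>Taking the whole space for B forces the factor to be 1/2, so no determinant has
    to be computed.\<close>
  have "tau a -` UNIV \<inter> Gam = Gam" for a by auto
  then have "?m Gam = 2 * ?d * ?m Gam" using half[of UNIV] by simp
  then have d: "?d = 1 / 2" using pos by simp
  have eq: "Gam \<inter> (tau a -` A \<inter> Gam) = tau a -` A \<inter> Gam" for a by auto
  have "2 * (?m (Gam \<inter> A) / ?m Gam) = ?m (tau False -` A \<inter> Gam) / ?m Gam
      + ?m (tau True -` A \<inter> Gam) / ?m Gam"
    unfolding half[OF A] d by (simp add: add_divide_distrib)
  then have "ennreal (2 * (?m (Gam \<inter> A) / ?m Gam))
      = ennreal (?m (tau False -` A \<inter> Gam) / ?m Gam) + ennreal (?m (tau True -` A \<inter> Gam) / ?m Gam)"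
    by (simp flip: ennreal_plus)
  moreover have "2 * ennreal y = ennreal (2 * y)" if "0 \<le> y" for y
      using that by (simp add: ennreal_mult)
  ultimately show ?thesis
    unfolding emeasure_lam[OF A] emeasure_lam[OF tm[OF A]] eq by simp
qed

lemma nested_singleton:
  fixes f :: "'a::heine_borel \<Rightarrow> 'a"
  assumes "compact X" "X \<noteq> {}" "continuous_on X f" "f ` X \<subseteq> X"
    and small: "\<And>e. 0 < e \<Longrightarrow> \<exists>k. \<forall>x\<in>X. \<forall>y\<in>X. dist ((f ^^ k) x) ((f ^^ k) y) < e"
  obtains p where "(\<Inter>k. (f ^^ k) ` X) = {p}"
proof -
  let ?F = "\<lambda>k. (f ^^ k) ` X"
  have "\<Inter> (range ?F) \<noteq> {}"
  proof (rule compact_nest)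
    show "compact (?F k)" for k
      by (intro compact_continuous_image continuous_on_funpow assms)
    show "?F k \<subseteq> ?F l" if "l \<le> k" for l k
    proof -
      have "f ^^ k = f ^^ l \<circ> f ^^ (k - l)" using that by (simp flip: funpow_add)
      then show ?thesis using funpow_image_subset[OF assms(4), of "k - l"]
          by (auto simp: image_comp[symmetric])
    qed
  qed (use assms(2) in auto)
  then obtain p where p: "\<And>k. p \<in> ?F k" by blast
  have "q = p" if q: "\<And>k. q \<in> ?F k" for q
  proof (rule ccontr)
    assume "q \<noteq> p"
    then obtain k where k: "\<And>x y. x \<in> X \<Longrightarrow> y \<in> X \<Longrightarrow> dist ((f ^^ k) x) ((f ^^ k) y) < dist q p"
      using small[of "dist q p"] by auto
    obtain x y where "x \<in> X" "y \<in> X" "q = (f ^^ k) x" "p = (f ^^ k) y" using p[of k] q[of k] by auto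
    then show False using k[of x y] by simp
  qed
  then have "(\<Inter>k. ?F k) = {p}" using p by auto
  then show ?thesis by (rule that)
qed

lemma crd_zero: "1 \<le> k \<Longrightarrow> crd 0 k = 0"
  using crd_linear(2)[of k 0 0] by simp

lemma Gam_int_sub_o: "Gam_int \<subseteq> Gam_o"
proof
  fix \<alpha> :: "real^'a::_" assume \<alpha>: "\<alpha> \<in> Gam_int"
  then have "crd \<alpha> (Suc 0) < crd \<alpha> 0" unfolding Gam_int_def by blast
  then show "\<alpha> \<in> Gam_o" using \<alpha> Gam_int_sub by (auto simp: Gam_o_iff)
qed

lemma psi_zero: "psi False (0 :: real^'n::{finite,wellorder}) = 0"
  by (rule crd_eqI) (simp add: crd_psi[OF zero_in_Gam] crd_zero)

text \<open>A cell inside the interior stays there whatever letters are put in front of its word;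
  this supplies the deep word.\<close>

lemma psi_Gam_int:
  fixes \<alpha> :: "real^'n::{finite,wellorder}"
  assumes "\<alpha> \<in> Gam_int"
  shows "psi a \<alpha> \<in> Gam_int"
  unfolding Gam_int_def
proof (intro CollectI allI impI)
  fix k assume k: "k \<le> CARD('n)"
  note n = card_n[where 'n = 'n]
  have S: "Suc (Suc 0) = 2" "Suc 1 = (2::nat)" by simp_all
  have \<alpha>: "\<alpha> \<in> Gam" using assms Gam_int_sub by blast
  have st: "crd \<alpha> (Suc k) < crd \<alpha> k" if "k \<le> CARD('n)" for k
      using assms that by (auto simp: Gam_int_def)
  have d: "crd \<alpha> 1 < 1" "crd \<alpha> 2 < crd \<alpha> 1" using st[of 0] st[of 1] n by (simp_all add: S)
  note den = psi_den[OF \<alpha>]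
  consider "k = 0" | "1 \<le> k" "k < CARD('n)" | "1 \<le> k" "k = CARD('n)" using k by linarith
  then show "crd (psi a \<alpha>) (Suc k) < crd (psi a \<alpha>) k"
  proof cases
    case 1
    have "crd (psi a \<alpha>) 1 * (1 + crd \<alpha> 1 - crd \<alpha> 2) < 1 * (1 + crd \<alpha> 1 - crd \<alpha> 2)"
      using psi_ends(2)[OF \<alpha>, of a] d crd_range(2)[OF \<alpha>, of 2] by (cases a) simp_all
    then show ?thesis using 1 den by simp
  next
    case 2
    then show ?thesis using st[of "Suc k"] den
      by (simp add: crd_psi[OF \<alpha>] divide_strict_right_mono)
  next
    case 3
    then show ?thesis using d den by (simp add: crd_psi[OF \<alpha>] add_nonneg_pos)
  qed
qed

section \<open>The Minkowski function and the Minkowski measure\<close>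

context
  fixes \<Phi> :: "real^'n::{finite,wellorder} \<Rightarrow> real^'n::_"
  assumes \<Phi>: "is_minkowski_function \<Phi>"
begin

lemma Phi_cell: "\<Phi> ` word_comp psi u ` Gam = word_comp tau u ` Gam"
proof (cases "u = []")
  case True
  then show ?thesis using \<Phi> by (auto simp: is_minkowski_function_def homeomorphism_def)
next
  case False
  then obtain g where "homeomorphism (word_comp psi u ` Gam) (word_comp tau u ` Gam) \<Phi> g"
    using \<Phi> by (auto simp: is_minkowski_function_def)
  then show ?thesis by (rule homeomorphism_image1)
qed

lemma Phi_inverse: obtains \<Phi>' where "homeomorphism Gam Gam \<Phi> \<Phi>'"
  using \<Phi> by (auto simp: is_minkowski_function_def)

lemma Phi_image: "\<Phi> ` Gam = Gam"
  using Phi_cell[of "[]"] by simp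

lemma Phi_inj: "inj_on \<Phi> Gam"
  using Phi_inverse by (metis homeomorphism_def inj_on_inverseI)

lemma psi_word_in: "x \<in> Gam \<Longrightarrow> word_comp psi u x \<in> Gam" for x :: "real^'n::_"
  by (induction u) (auto simp: psi_in)

lemma psi_shrink:
  assumes e: "0 < e"
  shows "\<exists>t. \<forall>u x y. t \<le> length u \<longrightarrow> x \<in> (Gam :: (real^'n::_) set) \<longrightarrow> y \<in> Gam \<longrightarrow>
    dist (word_comp psi u x) (word_comp psi u y) < e"
proof -
  obtain \<Phi>' where h: "homeomorphism Gam Gam \<Phi> \<Phi>'" by (rule Phi_inverse)
  then have "uniformly_continuous_on Gam \<Phi>'"
    by (intro compact_uniformly_continuous compact_Gam) (auto simp: homeomorphism_def)
  then obtain d where d: "0 < d" "\<And>x y. x \<in> Gam \<Longrightarrow> y \<in> Gam \<Longrightarrow> dist y x < d \<Longrightarrow> dist (\<Phi>' y) (\<Phi>' x) < e"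
    using e unfolding uniformly_continuous_on_def by metis
  obtain t where t: "\<And>u x y. t \<le> length u \<Longrightarrow> x \<in> (Gam :: (real^'n::_) set) \<Longrightarrow> y \<in> Gam \<Longrightarrow>
      dist (word_comp tau u x) (word_comp tau u y) < d" using tau_shrink[OF d(1)] by metis
  have "dist (word_comp psi u x) (word_comp psi u y) < e"
    if u: "t \<le> length u" and xy: "x \<in> Gam" "y \<in> Gam" for u and x y :: "real^'n::_"
  proof -
    have in_Gam: "word_comp psi u x \<in> Gam" "word_comp psi u y \<in> Gam" using xy psi_word_in by auto
    obtain x' y' where "x' \<in> Gam" "\<Phi> (word_comp psi u x) = word_comp tau u x'"
      "y' \<in> Gam" "\<Phi> (word_comp psi u y) = word_comp tau u y'" using Phi_cell[of u] xy by blast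
    then have "dist (\<Phi> (word_comp psi u x)) (\<Phi> (word_comp psi u y)) < d" using t u by simp
    then have "dist (\<Phi>' (\<Phi> (word_comp psi u x))) (\<Phi>' (\<Phi> (word_comp psi u y))) < e"
      using d(2)[of "\<Phi> (word_comp psi u y)" "\<Phi> (word_comp psi u x)"] in_Gam Phi_image by blast
    then show ?thesis using h in_Gam by (simp add: homeomorphism_def)
  qed
  then show ?thesis by blast
qed

lemma psi_word_ex: "p \<in> (Gam :: (real^'n::_) set) \<Longrightarrow> \<exists>u. length u = t \<and> p \<in> word_comp psi u ` Gam"
proof (induction t arbitrary: p)
  case (Suc t)
  then obtain a x where x: "x \<in> Gam" "p = psi a x" using psi_cover by blast
  then obtain u where "length u = t" "x \<in> word_comp psi u ` Gam" using Suc.IH by blast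
  then show ?case using x by (intro exI[of _ "a # u"]) auto
qed auto

text \<open>For every code u of x both sides lie in the \<open>tau\<close> cell of the word a # u,
  and these cells become arbitrarily small.\<close>

lemma Phi_psi:
  assumes x: "x \<in> Gam"
  shows "\<Phi> (psi a x) = tau a (\<Phi> x)"
proof (rule ccontr)
  assume ne: "\<Phi> (psi a x) \<noteq> tau a (\<Phi> x)"
  define e where "e = dist (\<Phi> (psi a x)) (tau a (\<Phi> x))"
  have "0 < e" using ne by (simp add: e_def)
  then obtain t where t: "\<And>u x y. t \<le> length u \<Longrightarrow> x \<in> (Gam :: (real^'n::_) set) \<Longrightarrow> y \<in> Gam \<Longrightarrow>
      dist (word_comp tau u x) (word_comp tau u y) < e" using tau_shrink by metis
  obtain u where u: "length u = t" "x \<in> word_comp psi u ` Gam" using psi_word_ex[OF x] by blast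
  have "\<Phi> x \<in> word_comp tau u ` Gam" using u(2) Phi_cell[of u] by blast
  then obtain y where y: "y \<in> Gam" "tau a (\<Phi> x) = word_comp tau (a # u) y" by auto
  have "psi a x \<in> word_comp psi (a # u) ` Gam" using u(2) by auto
  then have "\<Phi> (psi a x) \<in> word_comp tau (a # u) ` Gam" using Phi_cell[of "a # u"] by blast
  then obtain z where z: "z \<in> Gam" "\<Phi> (psi a x) = word_comp tau (a # u) z" by blast
  show False using t[of "a # u" z y] y z u(1) by (simp add: e_def)
qed

text \<open>A short enough cell through the centre of a ball in the interior stays in the
  ball.\<close>

lemma psi_deep: "\<exists>w. \<forall>u. \<forall>x\<in>(Gam :: (real^'n::_) set). word_comp psi u (word_comp psi w x) \<in> Gam_o"
proof -
  obtain q :: "real^'n::_" and r where q: "q \<in> Gam" "0 < r" "ball q r \<subseteq> Gam_int"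
    by (rule interior_point)
  obtain t where t: "\<And>u x y. t \<le> length u \<Longrightarrow> x \<in> (Gam :: (real^'n::_) set) \<Longrightarrow> y \<in> Gam \<Longrightarrow>
      dist (word_comp psi u x) (word_comp psi u y) < r" using psi_shrink[OF q(2)] by metis
  obtain w y where w: "length w = t" "y \<in> Gam" "q = word_comp psi w y"
      using psi_word_ex[OF q(1)] by blast
  have "word_comp psi w x \<in> Gam_int" if "x \<in> Gam" for x :: "real^'n::_"
  proof -
    have "dist (word_comp psi w x) q < r" using t[of w x y] w that by simp
    then have "word_comp psi w x \<in> ball q r" by (simp add: dist_commute)
    then show ?thesis using q(3) by blast
  qed
  then have "word_comp psi u (word_comp psi w x) \<in> Gam_int" if "x \<in> Gam" for u and x :: "real^'n::_"
    using that by (induction u) (auto simp: psi_Gam_int)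
  then show ?thesis using Gam_int_sub_o by blast
qed

lemma psi_pow_small: "0 < e \<Longrightarrow> \<exists>k. \<forall>x\<in>(Gam :: (real^'n::_) set). \<forall>y\<in>Gam. dist ((psi a ^^ k) x) ((psi
    a ^^ k) y) < e"
proof -
  assume "0 < e"
  then obtain t where "\<And>u x y. t \<le> length u \<Longrightarrow> x \<in> (Gam :: (real^'n::_) set) \<Longrightarrow> y \<in> Gam \<Longrightarrow>
      dist (word_comp psi u x) (word_comp psi u y) < e" using psi_shrink by metis
  from this[of "replicate t a"] show ?thesis by (intro exI[of _ t]) (auto simp: word_comp_replicate)
qed

lemma psi_image: "psi a ` (Gam :: (real^'n::_) set) \<subseteq> Gam"
  using psi_in by blast

lemma Int_psi_True: "(\<Inter>k. (psi True ^^ k) ` Gam) = {v'_minus1 :: real^'n::_}"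
proof -
  obtain p :: "real^'n::_" where p: "(\<Inter>k. (psi True ^^ k) ` Gam) = {p}"
    using nested_singleton[OF compact_Gam _ psi_continuous psi_image psi_pow_small] zero_in_Gam
        by blast
  then have "(v'_minus1 :: real^'n::_) = p" unfolding v'_minus1_def by auto
  then show ?thesis using p by simp
qed

lemma Int_psi_False: "(\<Inter>k. (psi False ^^ k) ` Gam) = {0 :: real^'n::_}"
proof -
  obtain p :: "real^'n::_" where p: "(\<Inter>k. (psi False ^^ k) ` Gam) = {p}"
    using nested_singleton[OF compact_Gam _ psi_continuous psi_image psi_pow_small] zero_in_Gam
        by blast
  have "(psi False ^^ k) 0 = (0 :: real^'n::_)" for k by (induction k) (auto simp: psi_zero)
  then have "(0 :: real^'n::_) \<in> (\<Inter>k. (psi False ^^ k) ` Gam)"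
      using zero_in_Gam by (metis INT_I image_eqI)
  then show ?thesis using p by auto
qed

lemma Gam_coded: "coded_ifs Gam Gam_o psi v'_minus1 (0 :: real^'n::_)"
proof
  show "Gam_o \<subseteq> (Gam :: (real^'n::_) set)" by (auto simp: Gam_o_iff)
  show "psi False x = psi True y \<longleftrightarrow> x = y \<and> x \<notin> Gam_o" if "x \<in> Gam" "y \<in> Gam" for x y :: "real^'n::_"
    using that by (rule psi_glue)
qed (rule compact_Gam closed_Gam_bd psi_in psi_continuous psi_inj psi_cover Int_psi_True
    Int_psi_False
    psi_shrink psi_deep; assumption)+

text \<open>Uniqueness of level and preimage in the tower is what makes the choices in
  \<open>E_map\<close> evaluate as intended.\<close>

lemma E_map_odometer: "odometer_ifs Gam Gam_o psi v'_minus1 (0 :: real^'n::_) E_map"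
proof -
  interpret coded_ifs Gam Gam_o psi v'_minus1 "0 :: real^'n::_" by (rule Gam_coded)
  note T = tower_unique[OF s_inj s_image sXo True_cover True_disj Int_True]
  note nv = tower_neq[OF s_inj s_image sXo True_cover True_disj Int_True]
  show ?thesis
  proof
    show "E_map v'_minus1 = (0 :: real^'n::_)" by (simp add: E_map_def)
    fix x :: "real^'n::_" and k assume x: "x \<in> Gam_o"
    let ?p = "(psi True ^^ k) (psi False x)"
    have "(THE l. ?p \<in> (psi True ^^ l \<circ> psi False) ` Gam_o) = k"
    proof (rule the_equality)
      show "?p \<in> (psi True ^^ k \<circ> psi False) ` Gam_o" using x by auto
      fix l assume "?p \<in> (psi True ^^ l \<circ> psi False) ` Gam_o"
      then obtain y where "y \<in> Gam_o" "?p = (psi True ^^ l) (psi False y)" by auto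
      then show "l = k" using T[OF x, of y k l] by simp
    qed
    moreover have "the_inv_into Gam_o (psi True ^^ k \<circ> psi False) ?p = x"
    proof -
      have "inj_on (psi True ^^ k \<circ> psi False) (Gam_o :: (real^'n::_) set)"
      proof (rule inj_onI)
        fix y z :: "real^'n::_" assume y: "y \<in> Gam_o" and z: "z \<in> Gam_o"
          and "(psi True ^^ k \<circ> psi False) y = (psi True ^^ k \<circ> psi False) z"
        then have "psi False y = psi False z" using T[OF y z, of k k] by simp
        then show "y = z" using s_inj[of False] y z Xo_sub by (auto dest: inj_onD)
      qed
      from the_inv_into_f_f[OF this x] show ?thesis by simp
    qed
    ultimately show "E_map ?p = (psi False ^^ k) (psi True x)"
      using nv[OF x, of k] by (simp add: E_map_def)
  qed
qed

lemma Phi_borel: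
  assumes A: "A \<in> sets (borel_on Gam)"
  shows "\<Phi> ` A \<in> sets borel" "\<Phi> ` A \<subseteq> Gam"
proof -
  obtain \<Phi>' where h: "homeomorphism Gam Gam \<Phi> \<Phi>'" by (rule Phi_inverse)
  have sub: "A \<subseteq> Gam" using sets.sets_into_space[OF A] by simp
  then show "\<Phi> ` A \<subseteq> Gam" using Phi_image by blast
  have "\<Phi>' \<in> measurable (borel_on Gam) (borel_on Gam)"
    using h by (intro continuous_on_measurable_borel_on) (auto simp: homeomorphism_def)
  from measurable_sets[OF this A] have "\<Phi>' -` A \<inter> Gam \<in> sets (borel_on Gam)" by simp
  moreover have "\<Phi>' -` A \<inter> Gam = \<Phi> ` A"
    using h sub by (auto simp: homeomorphism_def image_iff subset_iff) metis
  ultimately show "\<Phi> ` A \<in> sets borel" by (auto simp: borel_on_def sets_restrict_space)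
qed

lemma sets_minkowski [simp]: "sets (minkowski_measure \<Phi>) = sets (borel_on Gam)"
  unfolding minkowski_measure_def
  by (metis sets.sigma_sets_eq sets_measure_of sets.space_closed space_borel_on)

text \<open>\<open>measure_of\<close> returns the given values only for a countably additive set
  function. Additivity comes from recognizing the push-forward of the restricted Lebesgue measure
  under the inverse of \<Phi>.\<close>

lemma emeasure_minkowski:
  assumes A: "A \<in> sets (borel_on Gam)"
  shows "emeasure (minkowski_measure \<Phi>) A = emeasure lam (\<Phi> ` A)"
proof -
  obtain \<Phi>' where h: "homeomorphism Gam Gam \<Phi> \<Phi>'" by (rule Phi_inverse)
  let ?l = "restrict_space lam (Gam :: (real^'n::_) set)"
  let ?M = "distr ?l (borel_on Gam) \<Phi>'"
  have sl: "sets ?l = sets (borel_on Gam)" by (auto simp: borel_on_def sets_restrict_space)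
  have m: "\<Phi>' \<in> measurable ?l (borel_on Gam)"
    unfolding measurable_cong_sets[OF sl refl]
    using h by (intro continuous_on_measurable_borel_on) (auto simp: homeomorphism_def)
  have M: "emeasure ?M B = emeasure lam (\<Phi> ` B)" if B: "B \<in> sets (borel_on Gam)" for B
  proof -
    have sub: "B \<subseteq> Gam" using sets.sets_into_space[OF B] by simp
    have "\<Phi>' -` B \<inter> Gam = \<Phi> ` B"
      using h sub by (auto simp: homeomorphism_def image_iff subset_iff) metis
    then have "emeasure ?M B = emeasure ?l (\<Phi> ` B)"
      using emeasure_distr[OF m B] by (simp add: space_restrict_space)
    also have "\<dots> = emeasure lam (\<Phi> ` B)"
        using Phi_borel[OF B] by (intro emeasure_restrict_space) auto
    finally show ?thesis .
  qed
  have "minkowski_measure \<Phi> = measure_of Gam (sets (borel_on Gam)) (emeasure ?M)"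
    unfolding minkowski_measure_def
  proof (rule measure_of_eq)
    show "sets (borel_on Gam) \<subseteq> Pow (Gam :: (real^'n::_) set)"
        using sets.space_closed[of "borel_on Gam"] by simp
    fix B :: "(real^'n::_) set" assume "B \<in> sigma_sets Gam (sets (borel_on Gam))"
    then have "B \<in> sets (borel_on Gam)"
        using sets.sigma_sets_eq[of "borel_on (Gam :: (real^'n::_) set)"] by simp
    then show "emeasure lam (\<Phi> ` B) = emeasure ?M B" by (simp add: M)
  qed
  also have "\<dots> = ?M" using measure_of_of_measure[of ?M] by simp
  finally show ?thesis using M[OF A] by simp
qed

lemma minkowski_odometer: "odometer_measure Gam Gam_o psi v'_minus1 (0 :: real^'n::_) E_map
    (minkowski_measure \<Phi>)"
proof -
  interpret odometer_ifs Gam Gam_o psi v'_minus1 "0 :: real^'n::_" E_map by (rule E_map_odometer)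
  let ?\<mu> = "minkowski_measure \<Phi>"
  have sp: "space ?\<mu> = Gam" using sets_eq_imp_space_eq[OF sets_minkowski] by simp
  have pm: "psi a -` A \<inter> Gam \<in> sets (borel_on Gam)" if "A \<in> sets (borel_on Gam)"
    for a and A :: "(real^'n::_) set"
    using measurable_sets[OF continuous_on_measurable_borel_on[OF s_cont s_image] that, of a]
        by simp
  have ss: "2 * emeasure ?\<mu> A = emeasure ?\<mu> (psi False -` A \<inter> Gam)
      + emeasure ?\<mu> (psi True -` A \<inter> Gam)"
    if A: "A \<in> sets (borel_on Gam)" for A :: "(real^'n::_) set"
  proof -
    have sub: "A \<subseteq> Gam" using sets.sets_into_space[OF A] by simp
    have "\<Phi> ` (psi a -` A \<inter> Gam) = tau a -` (\<Phi> ` A) \<inter> Gam" for a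
    proof
      show "\<Phi> ` (psi a -` A \<inter> Gam) \<subseteq> tau a -` (\<Phi> ` A) \<inter> Gam"
        using Phi_image by (auto simp flip: Phi_psi)
      show "tau a -` (\<Phi> ` A) \<inter> Gam \<subseteq> \<Phi> ` (psi a -` A \<inter> Gam)"
      proof
        fix y assume y: "y \<in> tau a -` (\<Phi> ` A) \<inter> Gam"
        then obtain x z where x: "x \<in> Gam" "y = \<Phi> x" and z: "z \<in> A" "tau a y = \<Phi> z"
            using Phi_image by blast
        then have "\<Phi> (psi a x) = \<Phi> z" by (simp add: Phi_psi)
        then have "psi a x = z" using Phi_inj x(1) z(1) sub psi_in by (auto dest: inj_onD)
        then show "y \<in> \<Phi> ` (psi a -` A \<inter> Gam)" using x z by auto
      qed
    qed
    then show ?thesis using lam_self_similar[OF Phi_borel(1)[OF A]]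
        by (simp add: emeasure_minkowski A pm)
  qed
  show ?thesis
  proof (rule odometer_measure.intro[OF E_map_odometer], rule odometer_measure_axioms.intro)
    show "sets ?\<mu> = sets (borel_on Gam)" by simp
    have "emeasure ?\<mu> Gam = emeasure lam (Gam :: (real^'n::_) set)"
      using emeasure_minkowski[of Gam] Phi_image sets.top[of "borel_on (Gam :: (real^'n::_) set)"]
          by simp
    also have "\<dots> = 1" using measure_Gam_pos[where 'n = 'n] by (simp add: emeasure_lam)
    finally show "prob_space ?\<mu>" by (intro prob_spaceI) (simp add: sp)
    show "2 * emeasure ?\<mu> A = emeasure ?\<mu> (psi False -` A \<inter> Gam)
        + emeasure ?\<mu> (psi True -` A \<inter> Gam)"
      if "A \<in> sets ?\<mu>" for A using ss that by simp
    show "emeasure ?\<mu> (Gam - Gam_o) = 0"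
    proof -
      \<comment> \<open>The image of the face itself under \<Phi> is not at hand, but both branches
        send a point of the face to the same point, and \<Phi> maps that point into the wall. So the
        image of the face under \<open>psi False\<close> is null, and self-similarity pulls this
        back to the face.\<close>
      let ?F = "Gam - Gam_o :: (real^'n::_) set"
      have "compact ?F" using compact_Int_closed[OF compact_Gam closed_Gam_bd]
          by (simp add: Int_absorb1)
      then have "closed (psi False ` ?F)"
        by (intro compact_imp_closed compact_continuous_image) (auto intro: continuous_on_subset[OF
            s_cont])
      then have B: "psi False ` ?F \<in> sets (borel_on Gam)"
          using psi_in by (intro closed_in_borel_on) auto
      have "\<Phi> ` psi False ` ?F \<subseteq> wall"
      proof
        fix y assume "y \<in> \<Phi> ` psi False ` ?F"
        then obtain x where x: "x \<in> Gam" "x \<notin> Gam_o" "y = \<Phi> (psi False x)" by auto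
        moreover have "psi False x = psi True x" using s_glue x by simp
        ultimately have "y = tau False (\<Phi> x)" "y = tau True (\<Phi> x)" "\<Phi> x \<in> Gam"
          using Phi_psi[of x False] Phi_psi[of x True] Phi_image by auto
        then show "y \<in> wall" using tau_image_wall by blast
      qed
      then have "emeasure ?\<mu> (psi False ` ?F) = 0"
        using lam_wall[OF Phi_borel(1)[OF B]] emeasure_minkowski[OF B] by simp
      then have "emeasure ?\<mu> (psi False -` (psi False ` ?F) \<inter> Gam) = 0" using ss[OF B] by simp
      moreover have "psi False -` (psi False ` ?F) \<inter> Gam = ?F"
        using s_inj[of False] by (auto dest: inj_onD)
      ultimately show ?thesis by simp
    qed
  qed
qed

end

section \<open>Rational points\<close>

lemma crd_Rats: "(\<forall>i. \<alpha> $ i \<in> \<rat>) \<Longrightarrow> crd \<alpha> k \<in> \<rat>" for \<alpha> :: "real^'n::{finite,wellorder}"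
proof (cases "k \<in> {1..CARD('n)}")
  case True
  then obtain i :: 'n where "idx i = k" using idx_ex by blast
  moreover assume "\<forall>i. \<alpha> $ i \<in> \<rat>"
  ultimately show ?thesis by auto
next
  case False
  then have "k = 0 \<or> CARD('n) < k" by auto
  then show ?thesis by auto
qed

lemma psi_word_Rats: "(word_comp psi u 0 :: real^'n::{finite,wellorder}) \<in> {\<alpha> \<in> Gam. \<forall>i. \<alpha> $ i \<in> \<rat>}"
proof (induction u)
  case (Cons a u)
  let ?\<alpha> = "word_comp psi u (0 :: real^'n::_)"
  have \<alpha>: "?\<alpha> \<in> Gam" "\<And>k. crd ?\<alpha> k \<in> \<rat>" using Cons crd_Rats[of ?\<alpha>] by auto
  have "psi a ?\<alpha> $ i \<in> \<rat>" for i
    using psi_den[OF \<alpha>(1)] \<alpha>(2) by (cases a) (simp_all add: psi_nth)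
  then show ?case using psi_in[OF \<alpha>(1)] by simp
qed (simp add: zero_in_Gam)

lemma common_denominator:
  assumes "finite S" "\<And>i. i \<in> S \<Longrightarrow> f i \<in> (\<rat> :: real set)"
  shows "\<exists>N>0. \<forall>i\<in>S. real N * f i \<in> \<int>"
  using assms
proof (induction rule: finite_induct)
  case (insert x S)
  then obtain N where N: "N > 0" "\<forall>i\<in>S. real N * f i \<in> \<int>" by auto
  obtain a b where ab: "f x = real_of_int a / real_of_int b" "b > 0"
    using insert.prems[of x] by (auto elim!: Rats_cases')
  have "real (N * nat b) * f i \<in> \<int>" if "i \<in> insert x S" for i
  proof (cases "i = x")
    case True
    then have "real (N * nat b) * f i = of_int (int N * a)" using ab by simp
    then show ?thesis by (metis Ints_of_int)
  next
    case False
    then have "real N * f i * of_int b \<in> \<int>" using N that by auto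
    then show ?thesis using ab by (simp add: mult_ac)
  qed
  then show ?case using N ab by (intro exI[of _ "N * nat b"]) auto
qed auto

text \<open>
  Inverting \<open>\<psi>\<^sub>a\<close> either lowers the denominator \<open>N\<close> or makes one more barycentric coordinate vanish.
\<close>

lemma rational_psi_word:
  fixes \<beta> :: "real^'n::{finite,wellorder}"
  assumes "\<beta> \<in> Gam" "0 < N" "\<And>k. real N * crd \<beta> k \<in> \<int>" "crd \<beta> (Suc j) = crd \<beta> 1" "j \<le> CARD('n)"
  shows "\<exists>u. \<beta> = word_comp psi u 0"
  using assms
\<comment> \<open>The measure is lexicographic: N first, then n - j, which is less than n + 1.
  Equality of the coordinates 1 and j + 1 means that those in between agree as well, so that j
  barycentric coordinates vanish.\<close>
proof (induction "N * (CARD('n) + 1) + (CARD('n) - j)" arbitrary: N j \<beta> rule: less_induct)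
  case less
  let ?n = "CARD('n)"
  note n = card_n[where 'n = 'n]
  show ?case
  proof (cases "j = ?n")
    case True
    then have "crd \<beta> 1 = 0" using less.prems(4) by simp
    then have "crd \<beta> k = 0" if "1 \<le> k" for k
      using Gam_antimono[OF less.prems(1) that] crd_range(1)[OF less.prems(1), of k] by simp
    then have "\<beta> = 0" by (intro crd_eqI) (simp add: crd_zero)
    then show ?thesis by (intro exI[of _ "[]"]) simp
  next
    case False
    define a where "a = (\<not> crd \<beta> 1 + crd \<beta> ?n \<le> 1)"
    \<comment> \<open>c is the factor called N in \<open>psi_preimage\<close>, so the denominator N
      of \<beta> yields N c for its preimage.\<close>
    define c where "c = (if a then crd \<beta> 1 else 1 - crd \<beta> ?n)"
    from psi_preimage[OF less.prems(1), folded a_def, folded c_def]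
    obtain \<alpha> where c: "0 < c" "c \<le> 1" and \<alpha>: "\<alpha> \<in> Gam" "psi a \<alpha> = \<beta>"
      "c * crd \<alpha> 1 = (if a then 1 - crd \<beta> ?n else crd \<beta> 1)"
      "\<And>k. k \<in> {2..?n} \<Longrightarrow> c * crd \<alpha> k = crd \<beta> (k - 1) - crd \<beta> ?n"
      by blast
    have Z: "real N * crd \<beta> k \<in> \<int>" for k by (rule less.prems(3))
    have ZN: "real N \<in> \<int>" by simp
    have Zc: "real N * c \<in> \<int>" using Z[of 1] Ints_diff[OF ZN Z[of ?n]]
        by (auto simp: c_def right_diff_distrib)
    have Z\<alpha>: "real N * c * crd \<alpha> k \<in> \<int>" for k
    proof -
      consider "k = 0" | "k = 1" | "k \<in> {2..?n}" | "?n < k" by fastforce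
      then show ?thesis
      proof cases
        case 2
        then show ?thesis using \<alpha>(3) Z[of 1] Ints_diff[OF ZN Z[of ?n]]
          by (auto simp: mult.assoc right_diff_distrib)
      next
        case 3
        then show ?thesis using \<alpha>(4)[OF 3] Ints_diff[OF Z[of "k - 1"] Z[of ?n]]
          by (simp add: mult.assoc right_diff_distrib)
      qed (use Zc in auto)
    qed
    have "0 < real N * c" using c less.prems(2) by simp
    then obtain M where M: "real N * c = real M" "0 < M"
      using Zc by (metis Ints_cases of_int_of_nat_eq of_nat_0_less_iff pos_int_cases
          of_int_0_less_iff)
    have "\<exists>u. \<alpha> = word_comp psi u 0"
    proof (cases "c = 1")
      case True
      then have "M = N" using M by simp
      have j: "j < ?n" using False less.prems(5) by simp
      \<comment> \<open>c = 1 means \<beta>_1 = 1 or \<beta>_n = 0, according to the branch. Then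
        \<alpha>_1 obeys the same formula as a shifted coordinate, and the initial run of equal
        coordinates grows by one.\<close>
      have eq: "crd \<alpha> (Suc (Suc j)) = crd \<alpha> 1"
      proof -
        have 1: "crd \<alpha> 1 = crd \<beta> 1 - crd \<beta> ?n"
          using \<alpha>(3) True unfolding c_def by (cases a) auto
        show ?thesis
        proof (cases "Suc (Suc j) \<le> ?n")
          case T: True
          then show ?thesis using \<alpha>(4)[of "Suc (Suc j)"] True 1 less.prems(4) by simp
        next
          case F: False
          then have "Suc j = ?n" using j by simp
          then show ?thesis using 1 less.prems(4) by simp
        qed
      qed
      show ?thesis
        by (rule less.hyps[of N "Suc j"]) (use j eq \<alpha> less.prems(2) Z\<alpha> True in auto)
    next
      case False
      then have "real M < real N" using c less.prems(2) unfolding M(1)[symmetric] by simp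
      then have "M + 1 \<le> N" by simp
      then have "(M + 1) * (?n + 1) \<le> N * (?n + 1)" by (rule mult_le_mono1)
      then have "M * (?n + 1) + (?n - 0) < N * (?n + 1) + (?n - j)" by simp
      then show ?thesis
        by (rule less.hyps[of M 0]) (use \<alpha> M Z\<alpha> in auto)
    qed
    then obtain u where "\<alpha> = word_comp psi u 0" by blast
    then have "\<beta> = word_comp psi (a # u) 0" using \<alpha>(2) by simp
    then show ?thesis by blast
  qed
qed

lemma rational_points: "range (\<lambda>u. word_comp psi u 0)
    = {\<alpha> :: real^'n::{finite,wellorder}. \<alpha> \<in> Gam \<and> (\<forall>i. \<alpha> $ i \<in> \<rat>)}"
proof
  show "range (\<lambda>u. word_comp psi u 0) \<subseteq> {\<alpha> :: real^'n::_. \<alpha> \<in> Gam \<and> (\<forall>i. \<alpha> $ i \<in> \<rat>)}"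
    using psi_word_Rats by auto
  show "{\<alpha> :: real^'n::_. \<alpha> \<in> Gam \<and> (\<forall>i. \<alpha> $ i \<in> \<rat>)} \<subseteq> range (\<lambda>u. word_comp psi u 0)"
  proof clarify
    fix \<alpha> :: "real^'n::_" assume \<alpha>: "\<alpha> \<in> Gam" "\<forall>i. \<alpha> $ i \<in> \<rat>"
    obtain N where N: "N > 0" "\<And>i. real N * \<alpha> $ i \<in> \<int>"
      using common_denominator[of UNIV "\<lambda>i. \<alpha> $ i"] \<alpha>(2) by auto
    have "real N * crd \<alpha> k \<in> \<int>" for k
    proof (cases "k \<in> {1..CARD('n)}")
      case True
      then obtain i :: 'n where "idx i = k" using idx_ex by blast
      then show ?thesis using N(2)[of i] by auto
    next
      case False
      then have "k = 0 \<or> CARD('n) < k" by auto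
      then show ?thesis by auto
    qed
    from rational_psi_word[OF \<alpha>(1) N(1) this, of 0]
    show "\<alpha> \<in> range (\<lambda>u. word_comp psi u 0)" by auto
  qed
qed

lemma infinite_Gam: "infinite (Gam :: (real^'n::{finite,wellorder}) set)"
proof
  assume "finite (Gam :: (real^'n::_) set)"
  then have "measure lebesgue (Gam :: (real^'n::_) set) = 0"
      by (intro negligible_imp_measure0 negligible_finite)
  then show False using measure_Gam_pos[where 'n = 'n] by (simp add: measure_completion)
qed

theorem theorem5p1:
  fixes \<Phi> :: "real^'n::{finite,wellorder} \<Rightarrow> real^'n::_"
  assumes "is_minkowski_function \<Phi>"
  shows "bij_betw E_map (Gam :: (real^'n::_) set) Gam \<and>
         minimal_on (Gam :: (real^'n::_) set) E_map \<and>
         uniquely_ergodic_with Gam E_map (minkowski_measure \<Phi>) \<and>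
         (\<forall>p \<in> (Gam :: (real^'n::_) set).
            uniformly_distributed_on Gam (minkowski_measure \<Phi>) (\<lambda>i. (E_map ^^ i) p)) \<and>
         bij_betw (\<lambda>k. (E_map ^^ k) (0 :: real^'n::_)) UNIV {\<alpha> \<in> Gam. \<forall>i. \<alpha> $ i \<in> \<rat>}"
proof -
  interpret odometer_measure Gam Gam_o psi v'_minus1 "0 :: real^'n::_" E_map "minkowski_measure \<Phi>"
    using assms by (rule minkowski_odometer)
  have "(0 :: real^'n::_) \<in> Gam_o" by (simp add: Gam_o_iff zero_in_Gam crd_zero)
  then have "bij_betw (\<lambda>k. (E_map ^^ k) (0 :: real^'n::_)) UNIV {\<alpha> \<in> Gam. \<forall>i. \<alpha> $ i \<in> \<rat>}"
    using orbit_z orbit_inj[OF infinite_Gam zero_in_Gam] rational_points[where 'n = 'n]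
    by (simp add: bij_betw_def)
  then show ?thesis
    using E_bij minimal uniquely_ergodic uniformly_distributed by blast
qed

end
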